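(* Consider the following downlink model in $\mathbb{R}^2$. Let $\alpha>2$, $\mu>0$, $P_m,P_f>0$, $W\in(0,1]$, $\sigma^2\ge0$, $\lambda_m>0$, $P_{\mathrm{busy},m}\in(0,1]$, $\lambda_m'=\lambda_mP_{\mathrm{busy},m}$, $\lambda_p>0$, $\lambda_c'\ge0$, $R_c>0$. Let $\Phi_m$ be a homogeneous Poisson point process (PPP) of intensity $\lambda_m$ and $\Phi_m'$ its independent thinning with retention probability $P_{\mathrm{busy},m}$. Let $\Phi_f'$ be a Neyman–Scott cluster process independent of $\Phi_m$ and the thinning: $\Phi_f'=\bigcup_{x\in\Phi_p}\Phi^x$, where $\Phi_p$ is a homogeneous PPP of intensity $\lambda_p$ and, given $\Phi_p$, the $\Phi^x$ are independent PPPs of intensity $\lambda_c'$ on the disk of radius $R_c$ centered at $x$. A typical user is at the origin $o$ and is served by the point $b_0\in\Phi_m$ nearest to $o$; $r=|b_0|$. Let $h$ and $\{g_y\}$ (one per point $y$ of $\Phi_m'\cup\Phi_f'$) be i.i.d. with $\mathbb{P}\{h>x\}=\mathbb{P}\{g_y>x\}=e^{-\mu x}$, independent of the point processes. Define $$\mathrm{SINR}=\frac{P_m h r^{-\alpha}}{\sum_{y\in\Phi_m'\setminus\{b_0\}}P_m g_y|y|^{-\alpha}+\sum_{y\in\Phi_f'}W P_f g_y|y|^{-\alpha}+\sigma^2}.$$ Then for every $T>0$, $$\mathbb{P}\{\mathrm{SINR}\le T\}=1-\pi\lambda_m\int_0^\infty\exp\bigg(-\pi v\lambda_m-\lambda_p\int_{\mathbb{R}^2}\Big(1-\eta\Big(\frac{Tv^{\alpha/2}WP_f}{P_m},x\Big)\Big)\mathrm{d}x-\frac{\mu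 T v^{\alpha/2}\sigma^2}{P_m}-\pi v\lambda_m'\varphi(T,\alpha)\bigg)\mathrm{d}v,$$ and $$\mathbb{E}\{\ln(1+\mathrm{SINR})\}=\pi\lambda_m\int_0^\infty\int_0^\infty\exp\bigg(-\pi v\lambda_m-\lambda_p\int_{\mathbb{R}^2}\Big(1-\eta\Big(\frac{(e^t-1)v^{\alpha/2}WP_f}{P_m},x\Big)\Big)\mathrm{d}x-\frac{\mu(e^t-1)v^{\alpha/2}\sigma^2}{P_m}-\pi v\lambda_m'\varphi(e^t-1,\alpha)\bigg)\mathrm{d}v\,\mathrm{d}t,$$ where $\varphi(T,\alpha)=T^{2/\alpha}\int_{T^{-2/\alpha}}^\infty\frac{1}{1+u^{\alpha/2}}\mathrm{d}u$ and, for $s>0$ and $x\in\mathbb{R}^2$, $$\eta(s,x)=\exp\Big(-\lambda_c'\int_{C(o,R_c)}\frac{1}{1+\frac{1}{s}|x+y|^\alpha}\,\mathrm{d}y\Big),$$ with $C(o,R_c)$ the disk of radius $R_c$ centered at the origin.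
   Context: $\ln$ is the natural logarithm. The model describes a macrocell user in a two-tier network with clustered femtocell access points and Rayleigh fading on all links: $\Phi_m'$ are the macro base stations active on the user's subchannel, $\Phi_f'$ the (clustered) femtocell access points active on that subchannel, $W$ a wall penetration loss, $P_m,P_f$ transmit powers, $\sigma^2$ noise power. *)

theory Defs
  imports "HOL-Probability.Probability"
begin

definition config_space :: "'x measure \<Rightarrow> 'x set measure" where
  "config_space X = sigma UNIV {{S. finite (S \<inter> B) \<and> card (S \<inter> B) = n} | B n. B \<in> sets X}"

definition is_ppp :: "'a measure \<Rightarrow> 'x measure \<Rightarrow> ('a \<Rightarrow> 'x set) \<Rightarrow> bool" where
  "is_ppp M Lam Psi \<longleftrightarrow>
     prob_space M \<and> Psi \<in> measurable M (config_space Lam) \<and>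
     (\<forall>B \<in> sets Lam. emeasure Lam B < \<infinity> \<longrightarrow>
        (AE \<omega> in M. finite (Psi \<omega> \<inter> B)) \<and>
        (\<forall>n::nat. measure M {\<omega> \<in> space M. finite (Psi \<omega> \<inter> B) \<and> card (Psi \<omega> \<inter> B) = n}
                 = exp (- measure Lam B) * measure Lam B ^ n / fact n)) \<and>
     (\<forall>(B :: nat \<Rightarrow> 'x set) k.
        (\<forall>i<k. B i \<in> sets Lam \<and> emeasure Lam (B i) < \<infinity>) \<and> disjoint_family_on B {..<k} \<longrightarrow>
        prob_space.indep_vars M (\<lambda>_. count_space UNIV) (\<lambda>i \<omega>. card (Psi \<omega> \<inter> B i)) {..<k})"

definition exp_law :: "real \<Rightarrow> real measure" where
  "exp_law mu = density lborel (\<lambda>x. ennreal (exponential_density mu x))"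

text \<open>Macro BSs, independently marked by (busy indicator, fading):
  intensity lambda_m Leb \<otimes> Bernoulli(P_busy) \<otimes> Exp(mu).\<close>
definition macro_intensity :: "real \<Rightarrow> real \<Rightarrow> real \<Rightarrow> ((real^2) \<times> bool \<times> real) measure" where
  "macro_intensity lm Pb mu =
     density lborel (\<lambda>_. ennreal lm) \<Otimes>\<^sub>M (measure_pmf (bernoulli_pmf Pb) \<Otimes>\<^sub>M exp_law mu)"

text \<open>One cluster (relative to its parent), points marked by fading:
  intensity lambda_c' Leb restricted to the disk C(o,R_c), \<otimes> Exp(mu).\<close>
definition cluster_intensity :: "real \<Rightarrow> real \<Rightarrow> real \<Rightarrow> ((real^2) \<times> real) measure" where
  "cluster_intensity lc Rc mu =
     density lborel (\<lambda>y. ennreal lc * indicator (cball 0 Rc) y) \<Otimes>\<^sub>M exp_law mu"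

text \<open>Parents marked by their (relative, fading-marked) cluster, whose law is Q.\<close>
definition parent_intensity ::
    "real \<Rightarrow> ((real^2) \<times> real) set measure \<Rightarrow> ((real^2) \<times> ((real^2) \<times> real) set) measure" where
  "parent_intensity lp Q = density lborel (\<lambda>_. ennreal lp) \<Otimes>\<^sub>M Q"

definition nearest :: "(real^2) set \<Rightarrow> real^2" where
  "nearest S = (SOME y. y \<in> S \<and> (\<forall>z \<in> S. norm y \<le> norm z))"

definition serving_bs :: "((real^2) \<times> bool \<times> real) set \<Rightarrow> real^2" where
  "serving_bs Psim = nearest (fst ` Psim)"

definition interf_m :: "real \<Rightarrow> real \<Rightarrow> ((real^2) \<times> bool \<times> real) set \<Rightarrow> real" where
  "interf_m Pm alpha Psim =
     infsum (\<lambda>(y, busy, g). Pm * g * norm y powr (- alpha))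
       {p \<in> Psim. fst (snd p) \<and> fst p \<noteq> serving_bs Psim}"

definition interf_f :: "real \<Rightarrow> real \<Rightarrow> real \<Rightarrow> ((real^2) \<times> ((real^2) \<times> real) set) set \<Rightarrow> real" where
  "interf_f W Pf alpha Psip =
     infsum (\<lambda>(x, D). infsum (\<lambda>(d, g). W * Pf * g * norm (x + d) powr (- alpha)) D) Psip"

definition sinr ::
  "real \<Rightarrow> real \<Rightarrow> real \<Rightarrow> real \<Rightarrow> real \<Rightarrow>
   ((real^2) \<times> bool \<times> real) set \<Rightarrow> ((real^2) \<times> ((real^2) \<times> real) set) set \<Rightarrow> real \<Rightarrow> real" where
  "sinr alpha Pm Pf W sigma2 Psim Psip h =
     Pm * h * norm (serving_bs Psim) powr (- alpha) /
     (interf_m Pm alpha Psim + interf_f W Pf alpha Psip + sigma2)"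

definition varphi :: "real \<Rightarrow> real \<Rightarrow> real" where
  "varphi T alpha = T powr (2 / alpha) *
     set_lebesgue_integral lborel {T powr (- 2 / alpha)..} (\<lambda>u. 1 / (1 + u powr (alpha / 2)))"

definition eta :: "real \<Rightarrow> real \<Rightarrow> real \<Rightarrow> real \<Rightarrow> real^2 \<Rightarrow> real" where
  "eta lc Rc alpha s x = exp (- lc *
     set_lebesgue_integral lborel (cball 0 Rc) (\<lambda>y::real^2. 1 / (1 + (1 / s) * norm (x + y) powr alpha)))"

end

theory Submission
  imports Defs
begin

text \<open>By the Laplace functional of a Poisson process, obtained from independent counts for simple
  functions and by monotone convergence in general, configurations enter only through
  $E\,e^{-\sum f} = e^{-\int (1 - e^{-f})}$. For the macro tier put $v = |b_0|^2$: it is exponential of rate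
  $\pi\lambda_m$, and given $v$ the remaining stations are a Poisson process outside the disk of area
  $\pi v$; this is made rigorous by rounding $v$ up to dyadic levels. Applying the Laplace functional once
  to a cluster and once to the parents gives the femto factor. As $h$ is exponential,
  $P(\mathrm{SINR} > T)$ is the joint Laplace transform of interference and noise at
  $\mu T v^{\alpha/2}/P_m$, and the rate is the integral of the tail $P(\mathrm{SINR} > e^t - 1)$.\<close>

section \<open>Poisson processes\<close>

text \<open>The difficulty lies less in the formula than in the reading of \<open>sinr\<close>: its
  interference terms are real \<open>infsum\<close>s, which return 0 on divergence, the serving
  station is picked by \<open>SOME\<close>, and division by 0 yields 0. Sums are therefore formed in
  \<open>ennreal\<close>, and it is shown that almost surely they converge, the macro interference
  is positive and the nearest station is unique. Only then does \<open>sinr\<close> agree with a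
  measurable function, which is why probabilities are taken in \<open>completion M\<close>. No
  conditional distribution given the nearest station is constructed: a weight that vanishes below a
  level does not see the points there, and avoiding that region is itself a case of the Laplace
  functional, with infinite weight. For this reason \<open>lexp\<close> extends e^-x to infinity by
  0. Thinning and fading are marks carried by the intensity, so they are averaged inside the
  exponent.\<close>

definition lexp :: "ennreal \<Rightarrow> real" where
  "lexp x = (if x = \<top> then 0 else exp (- enn2real x))"

lemma lexp_ennreal: "0 \<le> x \<Longrightarrow> lexp (ennreal x) = exp (- x)"
  by (simp add: lexp_def)

lemma lexp_top [simp]: "lexp \<top> = 0"
  by (simp add: lexp_def)

lemma lexp_zero [simp]: "lexp 0 = 1"
  by (simp add: lexp_def)

lemma lexp_nonneg [simp]: "0 \<le> lexp x"
  by (simp add: lexp_def)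

lemma lexp_le_one [simp]: "lexp x \<le> 1"
  by (simp add: lexp_def)

lemma lexp_add: "lexp (x + y) = lexp x * lexp y"
  by (cases x; cases y) (auto simp: lexp_ennreal mult_exp_exp simp flip: ennreal_plus)

lemma lexp_sum: "lexp (\<Sum>i\<in>I. f i) = (\<Prod>i\<in>I. lexp (f i))"
  by (induction I rule: infinite_finite_induct) (auto simp: lexp_add)

lemma lexp_antimono: "x \<le> y \<Longrightarrow> lexp y \<le> lexp x"
  by (cases x; cases y) (auto simp: lexp_ennreal top_unique)

text \<open>Convexity gives e^-r >= 1 - r. The bound later dominates \<open>1 - eta\<close> by an
  integral that is linear in the path loss.\<close>

lemma one_minus_lexp_le: "ennreal (1 - lexp x) \<le> x"
proof (cases x)
  case (real r)
  with exp_ge_add_one_self[of "- r"] show ?thesis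
    by (simp add: lexp_ennreal ennreal_leI)
qed simp

text \<open>The value 0 at infinity is the continuous extension of e^-x, so limits to infinity are
  covered too, by an explicit bound.\<close>

lemma tendsto_lexp:
  assumes "(X \<longlongrightarrow> L) F"
  shows "((\<lambda>n. lexp (X n)) \<longlongrightarrow> lexp L) F"
proof (cases L)
  case (real r)
  have ev: "\<forall>\<^sub>F n in F. X n < \<top>"
    using order_tendstoD(2)[OF assms, of \<top>] real by simp
  have "((\<lambda>n. exp (- enn2real (X n))) \<longlongrightarrow> exp (- enn2real (ennreal r))) F"
    using assms real by (intro tendsto_intros tendsto_enn2real) auto
  then have "((\<lambda>n. exp (- enn2real (X n))) \<longlongrightarrow> lexp L) F"
    using real by (simp add: lexp_ennreal)
  then show ?thesis
    by (rule tendsto_cong[THEN iffD1, rotated]) (use ev in eventually_elim, auto simp: lexp_def)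
next
  case top
  show ?thesis unfolding top lexp_top
  proof (rule order_tendstoI)
    fix a :: real assume "a < 0"
    then show "\<forall>\<^sub>F n in F. a < lexp (X n)"
      by (intro always_eventually allI) (rule less_le_trans[OF _ lexp_nonneg])
  next
    fix a :: real assume a: "0 < a"
    \<comment> \<open>For \<open>a < 1\<close> this gives e^-b = a; the maximum with 0 keeps
      \<open>b\<close> nonnegative when \<open>a\<close> is at least 1.\<close>
    define b where "b = max 0 (- ln a)"
    have b0: "0 \<le> b" by (simp add: b_def)
    have "\<forall>\<^sub>F n in F. ennreal b < X n"
      using order_tendstoD(1)[OF assms, of "ennreal b"] top by simp
    then show "\<forall>\<^sub>F n in F. lexp (X n) < a"
    proof eventually_elim
      case (elim n)
      show ?case
      proof (cases "X n")
        case (real r)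
        then have "b < r" using elim by (simp add: b0 ennreal_less_iff)
        then have "- r < ln a" by (auto simp: b_def)
        then have "exp (- r) < exp (ln a)" by simp
        then show ?thesis using a real by (simp add: lexp_ennreal)
      qed (use a in simp)
    qed
  qed
qed

lemma borel_measurable_lexp [measurable]: "lexp \<in> borel_measurable borel"
  unfolding lexp_def by measurable

text \<open>Integration against counting measure needs no enumeration of the configuration, makes
  sense for every set, and inherits linearity and monotone convergence in \<open>f\<close>.\<close>

definition psum :: "('x \<Rightarrow> ennreal) \<Rightarrow> 'x set \<Rightarrow> ennreal" where
  "psum f S = (\<integral>\<^sup>+ x. f x \<partial>count_space S)"

lemma psum_cong: "(\<And>x. x \<in> S \<Longrightarrow> f x = g x) \<Longrightarrow> psum f S = psum g S"
  unfolding psum_def by (rule nn_integral_cong) simp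

lemma psum_zero [simp]: "psum (\<lambda>_. 0) S = 0"
  by (simp add: psum_def)

lemma psum_add: "psum (\<lambda>x. f x + g x) S = psum f S + psum g S"
  unfolding psum_def by (rule nn_integral_add) auto

lemma psum_cmult: "psum (\<lambda>x. c * f x) S = c * psum f S"
  unfolding psum_def by (rule nn_integral_cmult) auto

lemma psum_sum: "psum (\<lambda>x. \<Sum>i\<in>I. f i x) S = (\<Sum>i\<in>I. psum (f i) S)"
  unfolding psum_def by (rule nn_integral_sum) auto

lemma psum_indicator: "psum (indicator B) S = (if finite (S \<inter> B) then of_nat (card (S \<inter> B)) else \<top>)"
proof -
  have "psum (indicator B) S = (\<integral>\<^sup>+ x. indicator (S \<inter> B) x \<partial>count_space S)"
    unfolding psum_def by (rule nn_integral_cong) (auto split: split_indicator)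
  also have "\<dots> = emeasure (count_space S) (S \<inter> B)"
    by (rule nn_integral_indicator) auto
  finally show ?thesis by (auto simp: emeasure_count_space)
qed

lemma psum_mono: "(\<And>x. x \<in> S \<Longrightarrow> f x \<le> g x) \<Longrightarrow> psum f S \<le> psum g S"
  unfolding psum_def by (rule nn_integral_mono) simp

lemma psum_SUP: "incseq f \<Longrightarrow> psum (\<lambda>x. SUP i. f i x) S = (SUP i. psum (f i) S)"
  unfolding psum_def by (rule nn_integral_monotone_convergence_SUP) auto

lemma psum_ge_point: "x \<in> S \<Longrightarrow> f x \<le> psum f S"
  unfolding psum_def by (rule nn_integral_ge_point)

lemma psum_restrict: "psum f {x\<in>S. P x} = psum (\<lambda>x. if P x then f x else 0) S"
proof -
  have "psum f {x\<in>S. P x} = psum (\<lambda>x. if P x then f x else 0) {x\<in>S. P x}"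
    by (rule psum_cong) auto
  also have "\<dots> = psum (\<lambda>x. if P x then f x else 0) S"
    unfolding psum_def by (rule nn_integral_count_space_eq) auto
  finally show ?thesis .
qed

text \<open>The defaults agree: for a divergent nonnegative family \<open>infsum\<close>, the
  Bochner integral and \<open>enn2real\<close> of infinity are all 0, so summability need not be
  known.\<close>

lemma infsum_eq_psum:
  fixes f :: "'x \<Rightarrow> real"
  assumes "\<And>x. x \<in> S \<Longrightarrow> 0 \<le> f x"
  shows "infsum f S = enn2real (psum (\<lambda>x. ennreal (f x)) S)"
proof -
  have "enn2real (psum (\<lambda>x. ennreal (f x)) S) = infsetsum f S"
    unfolding psum_def infsetsum_def using assms
    by (intro integral_eq_nn_integral[symmetric]) (auto simp: AE_count_space)
  moreover have "infsum f S = infsetsum f S"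
  proof (cases "Infinite_Sum.abs_summable_on f S")
    case True
    then show ?thesis
      using infsetsum_infsum[of f S] by (simp only: abs_summable_equivalent)
  next
    case False
    then have "\<not> f summable_on S"
      using assms summable_on_cong[of S "\<lambda>x. norm (f x)" f] by auto
    moreover have "\<not> integrable (count_space S) f"
      using False by (simp only: abs_summable_equivalent abs_summable_on_def not_False_eq_True)
    ultimately show ?thesis
      by (simp add: infsum_not_exists infsetsum_def not_integrable_integral_eq)
  qed
  ultimately show ?thesis by simp
qed

section \<open>The configuration space and its sigma-algebra\<close>

lemma space_config_space [simp]: "space (config_space X) = UNIV"
  by (simp add: config_space_def)

lemma sets_config_space_card:
  assumes "B \<in> sets X"
  shows "{S. finite (S \<inter> B) \<and> card (S \<inter> B) = n} \<in> sets (config_space X)"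
  unfolding config_space_def using assms by (subst sets_measure_of) auto

text \<open>Counting events generate \<open>config_space\<close>, so the case of an indicator holds
  by construction; linear combinations and increasing limits give every weight.\<close>

lemma borel_measurable_psum:
  assumes "f \<in> borel_measurable X" "space X = UNIV"
  shows "psum f \<in> borel_measurable (config_space X)"
  using assms(1)
proof induction
  case (cong f g)
  then have "f = g" using assms(2) by auto
  then show ?case using cong by simp
next
  case (set B)
  \<comment> \<open>With values in the countable type \<open>enat\<close>, only level sets matter:
    the finite levels are generators and the infinite one is the complement of their union.\<close>
  define t where "t S = (if finite (S \<inter> B) then enat (card (S \<inter> B)) else \<infinity>)" for S
  have "t \<in> measurable (config_space X) (count_space UNIV)"
  proof (subst measurable_count_space_eq2_countable, safe)
    fix a
    have fin: "t -` {enat n} \<inter> space (config_space X) \<in> sets (config_space X)" for n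
    proof -
      have "t -` {enat n} \<inter> space (config_space X) = {S. finite (S \<inter> B) \<and> card (S \<inter> B) = n}"
        by (auto simp: t_def split: if_splits)
      then show ?thesis using sets_config_space_card[OF set] by simp
    qed
    show "t -` {a} \<inter> space (config_space X) \<in> sets (config_space X)"
    proof (cases a)
      case (enat n) then show ?thesis using fin by simp
    next
      case infinity
      have "t -` {\<infinity>} \<inter> space (config_space X)
          = space (config_space X) - (\<Union>n. t -` {enat n} \<inter> space (config_space X))"
        by (auto simp: t_def)
      also have "\<dots> \<in> sets (config_space X)"
        using fin by (intro sets.Diff sets.top sets.countable_UN) auto
      finally show ?thesis using infinity by simp
    qed
  qed auto
  then have "(\<lambda>S. ennreal_of_enat (t S)) \<in> borel_measurable (config_space X)"
    by measurable
  moreover have "psum (indicator B) = (\<lambda>S. ennreal_of_enat (t S))"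
    by (auto simp: psum_indicator t_def fun_eq_iff)
  ultimately show ?case by simp
next
  case (mult u c)
  then show ?case by (simp add: psum_cmult[abs_def] borel_measurable_times)
next
  case (add u v)
  then show ?case by (simp add: psum_add[abs_def] borel_measurable_add)
next
  case (seq U)
  have "psum (\<lambda>x. SUP i. U i x) = (\<lambda>S. SUP i. psum (U i) S)"
    by (rule ext) (rule psum_SUP[OF seq(3)])
  moreover have "(SUP i. U i) = (\<lambda>x. SUP i. U i x)" by (auto simp: fun_eq_iff image_image)
  ultimately show ?case using seq by simp
qed

lemma sets_config_space_avoid:
  assumes "B \<in> sets X" "space X = UNIV"
  shows "{S. S \<inter> B = {}} \<in> sets (config_space X)"
proof -
  have "{S. S \<inter> B = {}} = {S. finite (S \<inter> B) \<and> card (S \<inter> B) = 0}" by auto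
  then show ?thesis using sets_config_space_card[OF assms(1), of 0] by simp
qed

section \<open>Laplace functional, void probabilities and almost sure properties\<close>

lemma is_pppD:
  assumes "is_ppp M \<Lambda> Psi"
  shows "prob_space M" "Psi \<in> measurable M (config_space \<Lambda>)"
    "\<And>B. B \<in> sets \<Lambda> \<Longrightarrow> emeasure \<Lambda> B < \<infinity> \<Longrightarrow> AE \<omega> in M. finite (Psi \<omega> \<inter> B)"
    "\<And>B n. B \<in> sets \<Lambda> \<Longrightarrow> emeasure \<Lambda> B < \<infinity> \<Longrightarrow>
       measure M {\<omega> \<in> space M. finite (Psi \<omega> \<inter> B) \<and> card (Psi \<omega> \<inter> B) = n}
         = exp (- measure \<Lambda> B) * measure \<Lambda> B ^ n / fact n"
    "\<And>(B :: nat \<Rightarrow> _) k. (\<And>i. i < k \<Longrightarrow> B i \<in> sets \<Lambda>) \<Longrightarrow> (\<And>i. i < k \<Longrightarrow> emeasure \<Lambda> (B i) < \<infinity>) \<Longrightarrow>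
       disjoint_family_on B {..<k} \<Longrightarrow>
       prob_space.indep_vars M (\<lambda>_. count_space UNIV) (\<lambda>i \<omega>. card (Psi \<omega> \<inter> B i)) {..<k}"
  subgoal using assms unfolding is_ppp_def by (elim conjE)
  subgoal using assms unfolding is_ppp_def by (elim conjE)
  subgoal using assms unfolding is_ppp_def by simp
  subgoal using assms unfolding is_ppp_def by simp
  subgoal using assms unfolding is_ppp_def by simp
  done

lemma ppp_card_sets:
  assumes "is_ppp M \<Lambda> Psi" "B \<in> sets \<Lambda>"
  shows "{\<omega> \<in> space M. finite (Psi \<omega> \<inter> B) \<and> card (Psi \<omega> \<inter> B) = n} \<in> sets M"
proof -
  have "{\<omega> \<in> space M. finite (Psi \<omega> \<inter> B) \<and> card (Psi \<omega> \<inter> B) = n}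
      = Psi -` {S. finite (S \<inter> B) \<and> card (S \<inter> B) = n} \<inter> space M" by auto
  then show ?thesis
    using measurable_sets[OF is_pppD(2)[OF assms(1)] sets_config_space_card[OF assms(2)]] by simp
qed

text \<open>This is the generating function of the Poisson law at \<open>lexp c\<close>. As
  \<open>card\<close> is 0 on infinite sets, almost sure finiteness has to exclude these before the
  expectation is split by the count.\<close>

lemma ppp_laplace_count:
  assumes ppp: "is_ppp M \<Lambda> Psi" and B: "B \<in> sets \<Lambda>" "emeasure \<Lambda> B < \<infinity>" and c: "c < \<top>"
  shows "(\<integral>\<^sup>+ \<omega>. ennreal (lexp (c * of_nat (card (Psi \<omega> \<inter> B)))) \<partial>M)
    = ennreal (exp (- (measure \<Lambda> B * (1 - lexp c))))"
proof -
  define E where "E n = {\<omega> \<in> space M. finite (Psi \<omega> \<inter> B) \<and> card (Psi \<omega> \<inter> B) = n}" for n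
  define m where "m = measure \<Lambda> B"
  define q where "q = lexp c"
  interpret prob_space M using is_pppD(1)[OF ppp] .
  have E [measurable]: "E n \<in> sets M" for n
    unfolding E_def by (rule ppp_card_sets[OF ppp B(1)])
  have prE: "emeasure M (E n) = ennreal (exp (- m) * m ^ n / fact n)" for n
    using is_pppD(4)[OF ppp B, of n] by (simp add: emeasure_eq_measure E_def m_def)
  have lexp_pow: "lexp (c * of_nat n) = q ^ n" for n
    by (induction n) (auto simp: q_def lexp_add distrib_left algebra_simps)
  have "(\<integral>\<^sup>+ \<omega>. ennreal (lexp (c * of_nat (card (Psi \<omega> \<inter> B)))) \<partial>M)
      = (\<integral>\<^sup>+ \<omega>. (\<Sum>n. ennreal (q ^ n) * indicator (E n) \<omega>) \<partial>M)"
  proof (rule nn_integral_cong_AE, use is_pppD(3)[OF ppp B] AE_space in eventually_elim)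
    case (elim \<omega>)
    define n where "n = card (Psi \<omega> \<inter> B)"
    have "(\<Sum>k. ennreal (q ^ k) * indicator (E k) \<omega>) = (\<Sum>k\<in>{n}. ennreal (q ^ k) * indicator (E k) \<omega>)"
      by (rule suminf_finite) (auto simp: E_def n_def)
    also have "\<dots> = ennreal (q ^ n)" using elim by (simp add: E_def n_def)
    finally show ?case by (simp add: lexp_pow n_def)
  qed
  also have "\<dots> = (\<Sum>n. \<integral>\<^sup>+ \<omega>. ennreal (q ^ n) * indicator (E n) \<omega> \<partial>M)"
    by (rule nn_integral_suminf) measurable
  also have "\<dots> = (\<Sum>n. ennreal (q ^ n * (exp (- m) * m ^ n / fact n)))"
    by (intro suminf_cong) (simp add: nn_integral_cmult_indicator prE q_def m_def flip: ennreal_mult)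
  also have "\<dots> = ennreal (exp (- m) * exp (m * q))"
  proof (rule suminf_ennreal_eq)
    have "(\<lambda>n. exp (- m) * ((m * q) ^ n /\<^sub>R fact n)) sums (exp (- m) * exp (m * q))"
      by (rule sums_mult[OF exp_converges])
    moreover have "exp (- m) * ((m * q) ^ n /\<^sub>R fact n) = q ^ n * (exp (- m) * m ^ n / fact n)" for n
      by (simp add: field_simps power_mult_distrib)
    ultimately show "(\<lambda>n. q ^ n * (exp (- m) * m ^ n / fact n)) sums (exp (- m) * exp (m * q))"
      by simp
  qed (auto simp: q_def m_def)
  also have "exp (- m) * exp (m * q) = exp (- (m * (1 - q)))"
    by (simp add: mult_exp_exp algebra_simps)
  finally show ?thesis by (simp add: m_def q_def)
qed

text \<open>The weight is constant on each \<open>B i\<close>, so the sum over the configuration is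
  a linear combination of independent counts and its transform factors into Poisson generating
  functions. Intersecting with \<open>A\<close> gives the \<open>B i\<close> finite mass.\<close>

lemma ppp_laplace_simple:
  assumes ppp: "is_ppp M \<Lambda> Psi" and sp: "space \<Lambda> = UNIV"
    and f: "simple_function \<Lambda> f" "\<And>x. f x < \<top>" and A: "A \<in> sets \<Lambda>" "emeasure \<Lambda> A < \<infinity>"
  shows "(\<integral>\<^sup>+ \<omega>. ennreal (lexp (psum (\<lambda>x. f x * indicator A x) (Psi \<omega>))) \<partial>M)
    = ennreal (lexp (\<integral>\<^sup>+ x. ennreal (1 - lexp (f x * indicator A x)) \<partial>\<Lambda>))"
proof -
  interpret prob_space M using is_pppD(1)[OF ppp] .
  have "finite (range f)" using f(1) sp by (simp add: simple_function_def)
  \<comment> \<open>The values are numbered because \<open>is_ppp\<close> states independence for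
    families indexed by naturals.\<close>
  then obtain e where e: "bij_betw e {0..<card (range f)} (range f)"
    using ex_bij_betw_nat_finite by blast
  define k where "k = card (range f)"
  have e: "bij_betw e {..<k} (range f)" using e by (simp add: k_def lessThan_atLeast0)
  define B where "B i = f -` {e i} \<inter> A" for i
  have fe: "e i < \<top>" if "i < k" for i
    using bij_betwE[OF e] that f(2) by (metis (no_types, lifting) imageE lessThan_iff)
  have Bs [measurable]: "B i \<in> sets \<Lambda>" for i
    using simple_functionD(2)[OF f(1), of "{e i}"] A(1) sp by (simp add: B_def)
  have Bf: "emeasure \<Lambda> (B i) < \<infinity>" for i
    using emeasure_mono[of "B i" A \<Lambda>] A by (auto simp: B_def intro: le_less_trans)
  have disj: "disjoint_family_on B {..<k}"
    using e by (auto simp: disjoint_family_on_def B_def bij_betw_def inj_on_def)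
  have ex1: "\<exists>j<k. f x = e j" for x
  proof -
    have "f x \<in> e ` {..<k}" using bij_betw_imp_surj_on[OF e] by auto
    then show ?thesis by auto
  qed
  \<comment> \<open>Kept general in \<open>h\<close> because the partition is used twice: with the
    identity for the sum over points, with 1 - e^-x for the exponent.\<close>
  have dec: "h (f x) * indicator A x = (\<Sum>i<k. h (e i) * indicator (B i) x)" for x and h :: "ennreal \<Rightarrow> ennreal"
  proof -
    obtain j where j: "j < k" "f x = e j" using ex1 by blast
    have "(\<Sum>i<k. h (e i) * indicator (B i) x) = (\<Sum>i\<in>{j}. h (e i) * indicator (B i) x)"
    proof (rule sum.mono_neutral_right)
      show "\<forall>i\<in>{..<k} - {j}. h (e i) * indicator (B i) x = 0"
      proof
        fix i assume i: "i \<in> {..<k} - {j}"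
        then have "e i \<noteq> e j" using bij_betw_imp_inj_on[OF e] j(1) by (auto simp: inj_on_def)
        then have "x \<notin> B i" using j(2) by (simp add: B_def)
        then show "h (e i) * indicator (B i) x = 0" by simp
      qed
    qed (use j in auto)
    also have "\<dots> = h (e j) * indicator (B j) x"
      by (simp only: sum.insert finite.emptyI empty_iff not_False_eq_True sum.empty add_0_right)
    also have "indicator (B j) x = (indicator A x :: ennreal)"
      using j(2) by (simp add: B_def indicator_def)
    finally show ?thesis unfolding j(2) by (rule sym)
  qed
  have ind: "indep_vars (\<lambda>_. count_space UNIV) (\<lambda>i \<omega>. card (Psi \<omega> \<inter> B i)) {..<k}"
    by (rule is_pppD(5)[OF ppp]) (use Bs Bf disj in auto)
  have AEf: "AE \<omega> in M. \<forall>i<k. finite (Psi \<omega> \<inter> B i)"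
    using is_pppD(3)[OF ppp Bs Bf] by (simp add: AE_all_countable)
  have "(\<integral>\<^sup>+ \<omega>. ennreal (lexp (psum (\<lambda>x. f x * indicator A x) (Psi \<omega>))) \<partial>M)
      = (\<integral>\<^sup>+ \<omega>. (\<Prod>i<k. ennreal (lexp (e i * of_nat (card (Psi \<omega> \<inter> B i))))) \<partial>M)"
  proof (rule nn_integral_cong_AE, use AEf in eventually_elim)
    case (elim \<omega>)
    have "lexp (psum (\<lambda>x. f x * indicator A x) (Psi \<omega>))
        = (\<Prod>i<k. lexp (e i * psum (indicator (B i)) (Psi \<omega>)))"
      by (simp only: dec[of "\<lambda>x. x"] psum_sum psum_cmult lexp_sum)
    also have "\<dots> = (\<Prod>i<k. lexp (e i * of_nat (card (Psi \<omega> \<inter> B i))))"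
      using elim by (intro prod.cong) (auto simp: psum_indicator)
    finally show ?case by (simp add: prod_ennreal)
  qed
  also have "\<dots> = (\<Prod>i<k. \<integral>\<^sup>+ \<omega>. ennreal (lexp (e i * of_nat (card (Psi \<omega> \<inter> B i)))) \<partial>M)"
    by (rule indep_vars_nn_integral) (auto intro!: indep_vars_compose2[OF ind])
  also have "\<dots> = (\<Prod>i<k. ennreal (exp (- (measure \<Lambda> (B i) * (1 - lexp (e i))))))"
    using ppp_laplace_count[OF ppp Bs Bf fe] by (intro prod.cong) auto
  also have "\<dots> = ennreal (exp (- (\<Sum>i<k. measure \<Lambda> (B i) * (1 - lexp (e i)))))"
    by (simp add: prod_ennreal exp_sum flip: sum_negf)
  finally have lhs: "(\<integral>\<^sup>+ \<omega>. ennreal (lexp (psum (\<lambda>x. f x * indicator A x) (Psi \<omega>))) \<partial>M)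
      = ennreal (exp (- (\<Sum>i<k. measure \<Lambda> (B i) * (1 - lexp (e i)))))" .
  have "(\<integral>\<^sup>+ x. ennreal (1 - lexp (f x * indicator A x)) \<partial>\<Lambda>)
      = (\<integral>\<^sup>+ x. (\<Sum>i<k. ennreal (1 - lexp (e i)) * indicator (B i) x) \<partial>\<Lambda>)"
    unfolding dec[of "\<lambda>x. ennreal (1 - lexp x)", symmetric]
    by (rule nn_integral_cong) (auto split: split_indicator)
  also have "\<dots> = (\<Sum>i<k. ennreal (1 - lexp (e i)) * emeasure \<Lambda> (B i))"
    by (subst nn_integral_sum) (auto simp: nn_integral_cmult_indicator)
  also have "\<dots> = (\<Sum>i<k. ennreal (measure \<Lambda> (B i) * (1 - lexp (e i))))"
    using Bf by (intro sum.cong) (auto simp: emeasure_eq_ennreal_measure ennreal_mult mult.commute less_top)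
  also have "\<dots> = ennreal (\<Sum>i<k. measure \<Lambda> (B i) * (1 - lexp (e i)))"
    by (rule sum_ennreal) auto
  finally show ?thesis unfolding lhs by (simp add: lexp_ennreal sum_nonneg)
qed

text \<open>Values and space are truncated together, since the simple case covers only sets of
  finite mass. The transforms converge by domination by 1, the exponents by monotone convergence;
  \<open>lexp\<close> carries the latter limit even when it is infinite.\<close>

theorem ppp_laplace:
  assumes ppp: "is_ppp M \<Lambda> Psi" and sf: "sigma_finite_measure \<Lambda>" and sp: "space \<Lambda> = UNIV"
    and f [measurable]: "f \<in> borel_measurable \<Lambda>"
  shows "(\<integral>\<^sup>+ \<omega>. ennreal (lexp (psum f (Psi \<omega>))) \<partial>M)
    = ennreal (lexp (\<integral>\<^sup>+ x. ennreal (1 - lexp (f x)) \<partial>\<Lambda>))"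
proof -
  interpret prob_space M using is_pppD(1)[OF ppp] .
  interpret L: sigma_finite_measure \<Lambda> by fact
  note Psi [measurable] = is_pppD(2)[OF ppp]
  obtain F where F: "\<And>i. simple_function \<Lambda> (F i)" "incseq F" "\<And>i x. F i x < \<top>"
      "\<And>x. (SUP i. F i x) = f x"
    using borel_measurable_implies_simple_function_sequence'[OF f] by blast
  obtain A :: "nat \<Rightarrow> _" where A: "range A \<subseteq> sets \<Lambda>" "(\<Union>i. A i) = space \<Lambda>"
      "\<And>i. emeasure \<Lambda> (A i) \<noteq> \<infinity>" "incseq A"
    using L.sigma_finite_incseq by metis
  define g where "g n x = F n x * indicator (A n) x" for n x
  have As [measurable]: "A n \<in> sets \<Lambda>" for n using A(1) by auto
  have Fm [measurable]: "F n \<in> borel_measurable \<Lambda>" for n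
    using F(1) by (rule borel_measurable_simple_function)
  have gm [measurable]: "g n \<in> borel_measurable \<Lambda>" for n unfolding g_def by measurable
  have gx: "incseq g"
    unfolding g_def using F(2) A(4)
    by (auto simp: incseq_def le_fun_def subset_eq split: split_indicator)
  have glim: "(\<lambda>n. g n x) \<longlonglongrightarrow> f x" for x
  proof -
    obtain N where "x \<in> A N" using A(2) sp by auto
    then have "g n x = F n x" if "n \<ge> N" for n
      using A(4) that by (auto simp: g_def incseq_def subset_eq indicator_def)
    then have ev: "\<forall>\<^sub>F n in sequentially. F n x = g n x"
      by (auto simp: eventually_sequentially intro!: exI[of _ N])
    have "incseq (\<lambda>n. F n x)" using F(2) by (auto simp: incseq_def le_fun_def)
    then have "(\<lambda>n. F n x) \<longlonglongrightarrow> f x"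
      using LIMSEQ_SUP[of "\<lambda>n. F n x"] F(4) by simp
    then show ?thesis using tendsto_cong[OF ev] by simp
  qed
  have psl: "(\<lambda>n. psum (g n) S) \<longlonglongrightarrow> psum f S" for S
    unfolding psum_def using gx glim
    by (intro nn_integral_LIMSEQ) auto
  have "(\<lambda>n. \<integral>\<^sup>+ \<omega>. ennreal (lexp (psum (g n) (Psi \<omega>))) \<partial>M)
      \<longlonglongrightarrow> (\<integral>\<^sup>+ \<omega>. ennreal (lexp (psum f (Psi \<omega>))) \<partial>M)"
  proof (rule nn_integral_dominated_convergence[where w="\<lambda>_. 1"])
    show "AE \<omega> in M. (\<lambda>n. ennreal (lexp (psum (g n) (Psi \<omega>)))) \<longlonglongrightarrow> ennreal (lexp (psum f (Psi \<omega>)))"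
      by (intro AE_I2 tendsto_ennrealI tendsto_lexp psl)
    show "(\<lambda>\<omega>. ennreal (lexp (psum (g n) (Psi \<omega>)))) \<in> borel_measurable M" for n
      using borel_measurable_psum[OF gm sp, of n] by measurable
    show "(\<lambda>\<omega>. ennreal (lexp (psum f (Psi \<omega>)))) \<in> borel_measurable M"
      using borel_measurable_psum[OF f sp] by measurable
  qed (auto simp: emeasure_space_1)
  moreover have "(\<integral>\<^sup>+ \<omega>. ennreal (lexp (psum (g n) (Psi \<omega>))) \<partial>M)
      = ennreal (lexp (\<integral>\<^sup>+ x. ennreal (1 - lexp (g n x)) \<partial>\<Lambda>))" for n
    unfolding g_def
    by (rule ppp_laplace_simple[OF ppp sp F(1,3) As]) (use A(3) in \<open>simp add: less_top\<close>)
  moreover have "(\<lambda>n. ennreal (lexp (\<integral>\<^sup>+ x. ennreal (1 - lexp (g n x)) \<partial>\<Lambda>)))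
      \<longlonglongrightarrow> ennreal (lexp (\<integral>\<^sup>+ x. ennreal (1 - lexp (f x)) \<partial>\<Lambda>))"
  proof (rule tendsto_ennrealI, rule tendsto_lexp, rule nn_integral_LIMSEQ)
    show "incseq (\<lambda>n x. ennreal (1 - lexp (g n x)))"
      using gx by (auto simp: incseq_def le_fun_def intro!: ennreal_leI lexp_antimono)
    show "(\<lambda>n. ennreal (1 - lexp (g n x))) \<longlonglongrightarrow> ennreal (1 - lexp (f x))" for x
      by (intro tendsto_intros tendsto_ennrealI tendsto_lexp glim)
  qed measurable
  ultimately show ?thesis by (auto intro: LIMSEQ_unique)
qed

text \<open>Infinite weight on \<open>B\<close> encodes avoidance: one point in \<open>B\<close>
  makes the sum infinite and its \<open>lexp\<close> 0. On \<open>B\<close> the exponent then has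
  density 1 and contributes the mass of \<open>B\<close>, possibly infinite; as \<open>f\<close>
  vanishes there, the two parts separate.\<close>

lemma ppp_avoid:
  assumes ppp: "is_ppp M \<Lambda> Psi" and sf: "sigma_finite_measure \<Lambda>" and sp: "space \<Lambda> = UNIV"
    and B [measurable]: "B \<in> sets \<Lambda>" and f [measurable]: "f \<in> borel_measurable \<Lambda>"
    and f0: "\<And>x. x \<in> B \<Longrightarrow> f x = 0"
  shows "(\<integral>\<^sup>+ \<omega>. ennreal (lexp (psum f (Psi \<omega>))) * indicator {\<omega>. Psi \<omega> \<inter> B = {}} \<omega> \<partial>M)
    = ennreal (lexp (emeasure \<Lambda> B) * lexp (\<integral>\<^sup>+ x. ennreal (1 - lexp (f x)) \<partial>\<Lambda>))"
proof -
  define g where "g x = f x + \<top> * indicator B x" for x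
  have [measurable]: "g \<in> borel_measurable \<Lambda>" unfolding g_def by measurable
  have "ennreal (lexp (psum f S)) * indicator {\<omega>. Psi \<omega> \<inter> B = {}} \<omega> = ennreal (lexp (psum g S))"
    if "S = Psi \<omega>" for S \<omega>
    unfolding g_def psum_add psum_cmult psum_indicator lexp_add that
    by (auto split: split_indicator simp: ennreal_top_mult ennreal_mult_eq_top_iff)
  then have "(\<integral>\<^sup>+ \<omega>. ennreal (lexp (psum f (Psi \<omega>))) * indicator {\<omega>. Psi \<omega> \<inter> B = {}} \<omega> \<partial>M)
      = (\<integral>\<^sup>+ \<omega>. ennreal (lexp (psum g (Psi \<omega>))) \<partial>M)" by simp
  also have "\<dots> = ennreal (lexp (\<integral>\<^sup>+ x. ennreal (1 - lexp (g x)) \<partial>\<Lambda>))"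
    by (rule ppp_laplace[OF ppp sf sp]) measurable
  also have "(\<integral>\<^sup>+ x. ennreal (1 - lexp (g x)) \<partial>\<Lambda>)
      = (\<integral>\<^sup>+ x. indicator B x + ennreal (1 - lexp (f x)) \<partial>\<Lambda>)"
    using f0 by (intro nn_integral_cong) (auto simp: g_def split: split_indicator)
  also have "\<dots> = emeasure \<Lambda> B + (\<integral>\<^sup>+ x. ennreal (1 - lexp (f x)) \<partial>\<Lambda>)"
    by (subst nn_integral_add) auto
  finally show ?thesis by (simp add: lexp_add)
qed

text \<open>The exceptional set is null, so its count is 0 with probability 1. Properties of almost
  every location and mark thus hold for all points at once.\<close>

lemma ppp_AE_ball:
  assumes ppp: "is_ppp M \<Lambda> Psi" and ae: "AE x in \<Lambda>. P x" and sp: "space \<Lambda> = UNIV"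
  shows "AE \<omega> in M. \<forall>x\<in>Psi \<omega>. P x"
proof -
  interpret prob_space M using is_pppD(1)[OF ppp] .
  obtain N where N: "{x \<in> space \<Lambda>. \<not> P x} \<subseteq> N" "N \<in> sets \<Lambda>" "emeasure \<Lambda> N = 0"
    using ae by (auto elim: AE_E)
  have "prob {\<omega> \<in> space M. finite (Psi \<omega> \<inter> N) \<and> card (Psi \<omega> \<inter> N) = 0} = 1"
    using is_pppD(4)[OF ppp N(2), of 0] N(3) by (simp add: measure_def)
  then have "AE \<omega> in M. \<omega> \<in> {\<omega> \<in> space M. finite (Psi \<omega> \<inter> N) \<and> card (Psi \<omega> \<inter> N) = 0}"
    by (subst prob_eq_1[symmetric]) (auto intro: ppp_card_sets[OF ppp N(2)])
  then show ?thesis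
    by eventually_elim (use N(1) sp in \<open>auto simp: set_eq_iff subset_eq\<close>)
qed

text \<open>\<open>is_ppp\<close> prescribes counts only on sets of finite mass; for infinite mass
  the void probability is the value 0 of \<open>lexp\<close> at infinity.\<close>

lemma ppp_AE_meets:
  assumes ppp: "is_ppp M \<Lambda> Psi" and sf: "sigma_finite_measure \<Lambda>" and sp: "space \<Lambda> = UNIV"
    and B [measurable]: "B \<in> sets \<Lambda>" and inf: "emeasure \<Lambda> B = \<infinity>"
  shows "AE \<omega> in M. Psi \<omega> \<inter> B \<noteq> {}"
proof -
  interpret prob_space M using is_pppD(1)[OF ppp] .
  note Psi [measurable] = is_pppD(2)[OF ppp]
  have [measurable]: "psum (indicator B) \<in> borel_measurable (config_space \<Lambda>)"
    by (rule borel_measurable_psum[OF _ sp]) measurable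
  have "{\<omega>\<in>space M. Psi \<omega> \<inter> B = {}} = {\<omega> \<in> space M. psum (indicator B) (Psi \<omega>) = 0}"
    by (auto simp: psum_indicator)
  also have "\<dots> \<in> sets M" by measurable
  finally have m: "{\<omega>\<in>space M. Psi \<omega> \<inter> B = {}} \<in> sets M" .
  have "emeasure M {\<omega>\<in>space M. Psi \<omega> \<inter> B = {}} = (\<integral>\<^sup>+ \<omega>. indicator {\<omega>\<in>space M. Psi \<omega> \<inter> B = {}} \<omega> \<partial>M)"
    using m by simp
  also have "\<dots> = (\<integral>\<^sup>+ \<omega>. ennreal (lexp (psum (\<lambda>_. 0) (Psi \<omega>))) * indicator {\<omega>. Psi \<omega> \<inter> B = {}} \<omega> \<partial>M)"
    by (intro nn_integral_cong) (auto simp: psum_def split: split_indicator)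
  also have "\<dots> = 0"
    using ppp_avoid[OF ppp sf sp B, of "\<lambda>_. 0"] inf by simp
  finally show ?thesis using m by (intro AE_I[where N="{\<omega>\<in>space M. Psi \<omega> \<inter> B = {}}"]) auto
qed

text \<open>Replacing $f$ by $f/n$, the Laplace transform tends to the probability that the sum is finite,
  while by dominated convergence its exponent tends to $0$.\<close>
lemma ppp_AE_psum_finite:
  assumes ppp: "is_ppp M \<Lambda> Psi" and sf: "sigma_finite_measure \<Lambda>" and sp: "space \<Lambda> = UNIV"
    and f [measurable]: "f \<in> borel_measurable \<Lambda>" and ffin: "AE x in \<Lambda>. f x < \<top>"
    and int: "(\<integral>\<^sup>+ x. ennreal (1 - lexp (f x)) \<partial>\<Lambda>) < \<top>"
  shows "AE \<omega> in M. psum f (Psi \<omega>) < \<top>"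
proof -
  interpret prob_space M using is_pppD(1)[OF ppp] .
  note Psi [measurable] = is_pppD(2)[OF ppp]
  define c where "c n = ennreal (1 / Suc n)" for n
  have c1: "c n \<le> 1" for n by (auto simp: c_def intro!: ennreal_leI simp flip: ennreal_1)
  have c0: "c \<longlonglongrightarrow> 0"
    unfolding c_def using tendsto_ennrealI[OF LIMSEQ_inverse_real_of_nat] by (simp add: inverse_eq_divide)
  have pm [measurable]: "psum f \<in> borel_measurable (config_space \<Lambda>)"
    by (rule borel_measurable_psum[OF f sp])
  have lim: "(\<lambda>n. \<integral>\<^sup>+ x. ennreal (1 - lexp (c n * f x)) \<partial>\<Lambda>) \<longlonglongrightarrow> (\<integral>\<^sup>+ x. 0 \<partial>\<Lambda>)"
  proof (rule nn_integral_dominated_convergence[where w="\<lambda>x. ennreal (1 - lexp (f x))"])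
    show "AE x in \<Lambda>. ennreal (1 - lexp (c n * f x)) \<le> ennreal (1 - lexp (f x))" for n
      using mult_right_mono[OF c1] by (auto intro!: ennreal_leI lexp_antimono)
    show "AE x in \<Lambda>. (\<lambda>n. ennreal (1 - lexp (c n * f x))) \<longlonglongrightarrow> 0"
      using ffin
    proof eventually_elim
      case (elim x)
      have "(\<lambda>n. c n * f x) \<longlonglongrightarrow> 0 * f x"
        using c0 elim by (intro tendsto_mult_ennreal) (auto simp: less_top)
      then have "(\<lambda>n. lexp (c n * f x)) \<longlonglongrightarrow> 1" using tendsto_lexp by fastforce
      then have "(\<lambda>n. ennreal (1 - lexp (c n * f x))) \<longlonglongrightarrow> ennreal (1 - 1)"
        by (intro tendsto_ennrealI tendsto_intros)
      then show ?case by simp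
    qed
  qed (use int in auto)
  have le: "ennreal (lexp (\<integral>\<^sup>+ x. ennreal (1 - lexp (c n * f x)) \<partial>\<Lambda>))
      \<le> emeasure M {\<omega>\<in>space M. psum f (Psi \<omega>) < \<top>}" for n
  proof -
    have "ennreal (lexp (\<integral>\<^sup>+ x. ennreal (1 - lexp (c n * f x)) \<partial>\<Lambda>))
        = (\<integral>\<^sup>+ \<omega>. ennreal (lexp (c n * psum f (Psi \<omega>))) \<partial>M)"
      using ppp_laplace[OF ppp sf sp, of "\<lambda>x. c n * f x"] by (simp add: psum_cmult)
    also have "\<dots> \<le> (\<integral>\<^sup>+ \<omega>. indicator {\<omega>\<in>space M. psum f (Psi \<omega>) < \<top>} \<omega> \<partial>M)"
    proof (rule nn_integral_mono)
      fix \<omega> assume "\<omega> \<in> space M"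
      show "ennreal (lexp (c n * psum f (Psi \<omega>))) \<le> indicator {\<omega>\<in>space M. psum f (Psi \<omega>) < \<top>} \<omega>"
      proof (cases "psum f (Psi \<omega>) = \<top>")
        case True
        then show ?thesis by (simp add: c_def ennreal_mult_top)
      next
        case False
        then show ?thesis using \<open>\<omega> \<in> space M\<close> by (simp add: less_top[symmetric])
      qed
    qed
    also have "\<dots> = emeasure M {\<omega>\<in>space M. psum f (Psi \<omega>) < \<top>}" by simp
    finally show ?thesis .
  qed
  have "(\<lambda>n. ennreal (lexp (\<integral>\<^sup>+ x. ennreal (1 - lexp (c n * f x)) \<partial>\<Lambda>))) \<longlonglongrightarrow> ennreal (lexp 0)"
    using lim by (intro tendsto_ennrealI tendsto_lexp) simp
  then have "1 \<le> emeasure M {\<omega>\<in>space M. psum f (Psi \<omega>) < \<top>}"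
    using le by (intro LIMSEQ_le_const2) auto
  then have "prob {\<omega>\<in>space M. psum f (Psi \<omega>) < \<top>} = 1"
    using measure_le_1 by (intro antisym) (auto simp: emeasure_eq_measure)
  then have "AE \<omega> in M. \<omega> \<in> {\<omega>\<in>space M. psum f (Psi \<omega>) < \<top>}"
    by (subst (asm) prob_eq_1) auto
  then show ?thesis by simp
qed

text \<open>Under the image law the configuration itself is the sample point. The tiers can then be
  analysed separately and joined later as a product measure.\<close>

lemma is_ppp_distr:
  assumes ppp: "is_ppp M \<Lambda> Psi"
  shows "is_ppp (distr M (config_space \<Lambda>) Psi) \<Lambda> (\<lambda>S. S)"
proof -
  interpret prob_space M using is_pppD(1)[OF ppp] .
  note Psi [measurable] = is_pppD(2)[OF ppp]
  let ?D = "distr M (config_space \<Lambda>) Psi"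
  interpret D: prob_space ?D by (rule prob_space_distr[OF Psi])
  \<comment> \<open>The generators speak of \<open>finite\<close> and \<open>card\<close> together.
    A positive \<open>card\<close> implies finiteness, while \<open>card = 0\<close>, which also
    holds for infinite intersections, is the complement of all positive values.\<close>
  have card_m [measurable]: "(\<lambda>S. card (S \<inter> B)) \<in> measurable (config_space \<Lambda>) (count_space UNIV)"
    if B: "B \<in> sets \<Lambda>" for B
  proof (subst measurable_count_space_eq2_countable, safe)
    fix n :: nat
    have pos: "(\<lambda>S. card (S \<inter> B)) -` {n} \<inter> space (config_space \<Lambda>) \<in> sets (config_space \<Lambda>)"
      if "n > 0" for n
    proof -
      have "(\<lambda>S. card (S \<inter> B)) -` {n} \<inter> space (config_space \<Lambda>)
          = {S. finite (S \<inter> B) \<and> card (S \<inter> B) = n}"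
        using that by (auto intro: card_ge_0_finite)
      then show ?thesis using sets_config_space_card[OF B] by simp
    qed
    show "(\<lambda>S. card (S \<inter> B)) -` {n} \<inter> space (config_space \<Lambda>) \<in> sets (config_space \<Lambda>)"
    proof (cases "n > 0")
      case False
      have "(\<lambda>S. card (S \<inter> B)) -` {0} \<inter> space (config_space \<Lambda>)
          = space (config_space \<Lambda>) - (\<Union>n\<in>{0<..}. (\<lambda>S. card (S \<inter> B)) -` {n} \<inter> space (config_space \<Lambda>))"
        by auto
      also have "\<dots> \<in> sets (config_space \<Lambda>)"
        using pos by (intro sets.Diff sets.top sets.countable_UN') auto
      finally show ?thesis using False by simp
    qed (rule pos)
  qed auto
  show ?thesis
    unfolding is_ppp_def
  proof (intro conjI ballI impI allI)
    show "prob_space ?D" by (rule D.prob_space_axioms)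
    show "(\<lambda>S. S) \<in> measurable ?D (config_space \<Lambda>)" by simp
  next
    fix B assume B: "B \<in> sets \<Lambda>" "emeasure \<Lambda> B < \<infinity>"
    have "{S. finite (S \<inter> B)} = (\<Union>n. {S. finite (S \<inter> B) \<and> card (S \<inter> B) = n})" by auto
    also have "\<dots> \<in> sets (config_space \<Lambda>)"
      using sets_config_space_card[OF B(1)] by (intro sets.countable_UN) auto
    finally show "AE S in ?D. finite (S \<inter> B)"
      using is_pppD(3)[OF ppp B] by (subst AE_distr_iff) auto
  next
    fix B n assume B: "B \<in> sets \<Lambda>" "emeasure \<Lambda> B < \<infinity>"
    show "measure ?D {S \<in> space ?D. finite (S \<inter> B) \<and> card (S \<inter> B) = n}
        = exp (- measure \<Lambda> B) * measure \<Lambda> B ^ n / fact n"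
      using is_pppD(4)[OF ppp B, of n] sets_config_space_card[OF B(1), of n]
      by (simp add: measure_distr vimage_def Int_def conj_commute)
  next
    fix B :: "nat \<Rightarrow> _" and k
    assume B: "(\<forall>i<k. B i \<in> sets \<Lambda> \<and> emeasure \<Lambda> (B i) < \<infinity>) \<and> disjoint_family_on B {..<k}"
    have iv: "indep_vars (\<lambda>_. count_space UNIV) (\<lambda>i \<omega>. card (Psi \<omega> \<inter> B i)) {..<k}"
      using B by (intro is_pppD(5)[OF ppp]) auto
    \<comment> \<open>The characterisation of independence by product laws asks for a nonempty index
      set, hence the separate case \<open>k = 0\<close>.\<close>
    show "D.indep_vars (\<lambda>_. count_space UNIV) (\<lambda>i S. card (S \<inter> B i)) {..<k}"
    proof (cases "k = 0")
      case True
      then show ?thesis by (simp add: D.indep_vars_def D.indep_sets_def)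
    next
      case False
      then have ne: "{..<k} \<noteq> {}" by auto
      have "distr M (PiM {..<k} (\<lambda>_. count_space UNIV)) (\<lambda>x. \<lambda>i\<in>{..<k}. card (Psi x \<inter> B i))
          = PiM {..<k} (\<lambda>i. distr M (count_space UNIV) (\<lambda>\<omega>. card (Psi \<omega> \<inter> B i)))"
        using iv B by (subst (asm) indep_vars_iff_distr_eq_PiM'[OF ne]) auto
      moreover have "distr ?D (PiM {..<k} (\<lambda>_. count_space UNIV)) (\<lambda>S. \<lambda>i\<in>{..<k}. card (S \<inter> B i))
          = distr M (PiM {..<k} (\<lambda>_. count_space UNIV)) (\<lambda>x. \<lambda>i\<in>{..<k}. card (Psi x \<inter> B i))"
        using B by (subst distr_distr) (auto simp: comp_def intro!: measurable_restrict)
      moreover have "PiM {..<k} (\<lambda>i. distr ?D (count_space UNIV) (\<lambda>S. card (S \<inter> B i)))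
          = PiM {..<k} (\<lambda>i. distr M (count_space UNIV) (\<lambda>\<omega>. card (Psi \<omega> \<inter> B i)))"
        using B by (intro PiM_cong refl) (subst distr_distr, auto simp: comp_def)
      ultimately show ?thesis
        using B by (subst D.indep_vars_iff_distr_eq_PiM'[OF ne]) auto
    qed
  qed
qed

section \<open>The lowest point of a Poisson process\<close>

text \<open>An abstract distance to the nearest station: in the plane the mass below squared
  distance v is linear in v, and this is what is kept of the geometry. The process is the identity
  on its own law \<open>P\<close>.\<close>

locale ppp_height =
  fixes P :: "'x set measure" and \<Lambda> :: "'x measure" and q :: "'x \<Rightarrow> real" and c :: real
  assumes ppp: "is_ppp P \<Lambda> (\<lambda>S. S)" and sets_P [measurable_cong]: "sets P = sets (config_space \<Lambda>)"
    and sf: "sigma_finite_measure \<Lambda>" and sp: "space \<Lambda> = UNIV"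
    and q [measurable]: "q \<in> borel_measurable \<Lambda>" and q_nonneg: "\<And>x. 0 \<le> q x"
    and c_pos: "0 < c" and vol: "\<And>v. 0 \<le> v \<Longrightarrow> emeasure \<Lambda> {x. q x < v} = ennreal (c * v)"
begin

sublocale prob_space P using is_pppD(1)[OF ppp] .

lemma space_P [simp]: "space P = UNIV"
  using sets_eq_imp_space_eq[OF sets_P] by simp

lemma sublevel_sets [measurable]: "{x. q x < v} \<in> sets \<Lambda>" "{x. q x \<le> v} \<in> sets \<Lambda>"
proof -
  have "{x\<in>space \<Lambda>. q x < v} \<in> sets \<Lambda>" "{x\<in>space \<Lambda>. q x \<le> v} \<in> sets \<Lambda>" by measurable
  then show "{x. q x < v} \<in> sets \<Lambda>" "{x. q x \<le> v} \<in> sets \<Lambda>" by (auto simp: sp)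
qed

text \<open>A closed sublevel lies in every larger open one; the slack \<open>e / c\<close> becomes
  \<open>e\<close> under \<open>vol\<close>. So no single level carries mass.\<close>

lemma vol_le:
  assumes "0 \<le> v" shows "emeasure \<Lambda> {x. q x \<le> v} = ennreal (c * v)"
proof (rule antisym)
  show "emeasure \<Lambda> {x. q x \<le> v} \<le> ennreal (c * v)"
  proof (rule ennreal_le_epsilon)
    fix e :: real assume "0 < e"
    have "emeasure \<Lambda> {x. q x \<le> v} \<le> emeasure \<Lambda> {x. q x < v + e / c}"
      using \<open>0 < e\<close> c_pos by (intro emeasure_mono) (auto simp: add_strict_increasing2 intro: le_less_trans)
    also have "\<dots> = ennreal (c * v) + ennreal e"
      using \<open>0 < e\<close> c_pos assms by (subst vol) (auto simp: field_simps simp flip: ennreal_plus)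
    finally show "emeasure \<Lambda> {x. q x \<le> v} \<le> ennreal (c * v) + ennreal e" .
  qed
  have "emeasure \<Lambda> {x. q x < v} \<le> emeasure \<Lambda> {x. q x \<le> v}"
    by (intro emeasure_mono) auto
  then show "ennreal (c * v) \<le> emeasure \<Lambda> {x. q x \<le> v}"
    by (simp add: vol assms)
qed

lemma vol_UNIV: "emeasure \<Lambda> UNIV = \<infinity>"
proof (rule ccontr)
  assume "emeasure \<Lambda> UNIV \<noteq> \<infinity>"
  then obtain r where r: "0 \<le> r" "emeasure \<Lambda> UNIV = ennreal r"
    by (cases "emeasure \<Lambda> UNIV") auto
  have "ennreal (c * ((r + 1) / c)) \<le> emeasure \<Lambda> UNIV"
    using r(1) c_pos sets.top[of \<Lambda>] sp
    by (subst vol[symmetric]) (auto intro!: emeasure_mono)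
  then show False using r c_pos by simp
qed

text \<open>An infimum involves no choice of a minimiser, so its measurability follows from void
  events. Its value on the empty configuration is unspecified.\<close>

definition hmin :: "'x set \<Rightarrow> real" where "hmin S = Inf (q ` S)"

lemma hmin_less_iff: "S \<noteq> {} \<Longrightarrow> hmin S < a \<longleftrightarrow> S \<inter> {x. q x < a} \<noteq> {}"
  unfolding hmin_def using q_nonneg
  by (subst cInf_less_iff) (auto intro!: bdd_belowI[where m=0])

lemma hmin_nonneg: "S \<noteq> {} \<Longrightarrow> 0 \<le> hmin S"
  unfolding hmin_def using q_nonneg by (intro cInf_greatest) auto

lemma avoid_sets [measurable]: "B \<in> sets \<Lambda> \<Longrightarrow> {S. S \<inter> B = {}} \<in> sets (config_space \<Lambda>)"
  by (rule sets_config_space_avoid[OF _ sp])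

lemma measurable_hmin [measurable]: "hmin \<in> borel_measurable (config_space \<Lambda>)"
proof (rule borel_measurable_iff_less[THEN iffD2], rule allI)
  fix a
  have e: "{S::'x set. S = {}} \<in> sets (config_space \<Lambda>)"
    using avoid_sets[of UNIV] sets.top[of \<Lambda>] sp by simp
  \<comment> \<open>\<open>hmin {}\<close> is a fixed but unknown number, so the empty configuration
    is added or left out as a whole.\<close>
  have "{S \<in> space (config_space \<Lambda>). hmin S < a}
      = ((UNIV - {S. S \<inter> {x. q x < a} = {}}) \<inter> (UNIV - {S. S = {}}))
        \<union> (if hmin {} < a then {S. S = {}} else {})"
  proof (rule set_eqI)
    fix S
    show "S \<in> {S \<in> space (config_space \<Lambda>). hmin S < a} \<longleftrightarrow> S \<in>
       ((UNIV - {S. S \<inter> {x. q x < a} = {}}) \<inter> (UNIV - {S. S = {}}))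
        \<union> (if hmin {} < a then {S. S = {}} else {})"
      using hmin_less_iff[of S a] by (cases "S = {}") auto
  qed
  also have "\<dots> \<in> sets (config_space \<Lambda>)"
    using e sets.compl_sets[OF e] sets.compl_sets[OF avoid_sets[OF sublevel_sets(1)[of a]]]
    by (intro sets.Un sets.Int) auto
  finally show "{S \<in> space (config_space \<Lambda>). hmin S < a} \<in> sets (config_space \<Lambda>)" .
qed

lemma AE_nonempty: "AE S in P. S \<noteq> {}"
  using ppp_AE_meets[OF ppp sf sp, of UNIV] vol_UNIV sets.top[of \<Lambda>] sp by simp

lemma AE_finite_sublevel: "AE S in P. \<forall>v. finite (S \<inter> {x. q x < v})"
proof -
  have "AE S in P. \<forall>n::nat. finite (S \<inter> {x. q x < real n})"
    unfolding AE_all_countable using is_pppD(3)[OF ppp sublevel_sets(1)] vol by auto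
  then show ?thesis
  proof eventually_elim
    case (elim S)
    show ?case
    proof
      fix v
      obtain n :: nat where "v \<le> real n" using real_arch_simple by blast
      then show "finite (S \<inter> {x. q x < v})"
        using elim by (auto intro: finite_subset[of _ "S \<inter> {x. q x < real n}"])
    qed
  qed
qed

lemma AE_pos: "AE S in P. \<forall>x\<in>S. 0 < q x"
proof (rule ppp_AE_ball[OF ppp _ sp])
  show "AE x in \<Lambda>. 0 < q x"
    using vol_le[of 0] by (intro AE_I[where N="{x. q x \<le> 0}"]) auto
qed

text \<open>Below any level there are finitely many points, so the minimum is attained, and it is
  positive since level 0 is null. In the bound \<open>q z + 1\<close> the 1 only puts
  \<open>z\<close> into a strict sublevel.\<close>

lemma AE_hmin_attained: "AE S in P. \<exists>x\<in>S. q x = hmin S \<and> 0 < hmin S \<and> (\<forall>y\<in>S. hmin S \<le> q y)"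
  using AE_nonempty AE_finite_sublevel AE_pos
proof eventually_elim
  case (elim S)
  obtain z where z: "z \<in> S" using elim(1) by auto
  let ?F = "S \<inter> {x. q x < q z + 1}"
  have fin: "finite ?F" and ne: "?F \<noteq> {}" using elim(2) z by auto
  obtain x where x: "x \<in> ?F" "\<And>y. y \<in> ?F \<Longrightarrow> q x \<le> q y"
    using arg_min_if_finite[OF fin ne, of q] by (metis linorder_not_less)
  have le: "q x \<le> q y" if "y \<in> S" for y
    using x(2)[of y] x(1) that by (cases "q y < q z + 1") auto
  have "hmin S = q x"
    unfolding hmin_def by (rule cInf_eq_minimum) (use x le in auto)
  then show ?case using x(1) le elim(3) by (intro bexI[of _ x]) auto
qed

text \<open>The complement, count 0 or 1, has probability e^-m (1 + m), which is at least (1 - m)(1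
  + m) = 1 - m^2.\<close>

lemma prob_two_points_le:
  assumes B: "B \<in> sets \<Lambda>" and m: "emeasure \<Lambda> B = ennreal m" "0 \<le> m"
  shows "{S. \<not> (finite (S \<inter> B) \<and> card (S \<inter> B) \<le> 1)} \<in> sets P"
    "prob {S. \<not> (finite (S \<inter> B) \<and> card (S \<inter> B) \<le> 1)} \<le> m\<^sup>2"
proof -
  let ?E = "\<lambda>n. {S. finite (S \<inter> B) \<and> card (S \<inter> B) = n}"
  have E: "?E n \<in> sets P" for n using sets_config_space_card[OF B] sets_P by simp
  have eq: "{S. \<not> (finite (S \<inter> B) \<and> card (S \<inter> B) \<le> 1)} = space P - (?E 0 \<union> ?E 1)"
    by (auto simp: le_Suc_eq)
  show "{S. \<not> (finite (S \<inter> B) \<and> card (S \<inter> B) \<le> 1)} \<in> sets P"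
    unfolding eq using E[of 0] E[of 1] by (intro sets.Diff sets.top sets.Un)
  have mB: "measure \<Lambda> B = m" using m by (simp add: measure_def)
  have pE: "prob (?E n) = exp (- m) * m ^ n / fact n" for n
    using is_pppD(4)[OF ppp B, of n] m mB by simp
  have "prob (?E 0 \<union> ?E 1) = exp (- m) * (1 + m)"
    using finite_measure_Union[OF E E, of 0 1] pE[of 0] pE[of 1]
    by (simp add: algebra_simps disjoint_iff)
  then have "prob {S. \<not> (finite (S \<inter> B) \<and> card (S \<inter> B) \<le> 1)} = 1 - exp (- m) * (1 + m)"
    unfolding eq using E by (subst prob_compl) auto
  moreover have "(1 - m) * (1 + m) \<le> exp (- m) * (1 + m)"
    using m(2) exp_ge_add_one_self[of "- m"] by (intro mult_right_mono) auto
  ultimately show "prob {S. \<not> (finite (S \<inter> B) \<and> card (S \<inter> B) \<le> 1)} \<le> m\<^sup>2"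
    by (simp add: algebra_simps power2_eq_square)
qed

text \<open>A tie below level $R$ puts two points into one of $2^n R$ slabs of mass $c/2^n$, which has
  probability at most $2^n R (c/2^n)^2 \to 0$.\<close>
lemma AE_inj_on: "AE S in P. inj_on q S"
proof -
  define A where "A n j = {x. real j / 2 ^ n \<le> q x \<and> q x < (real j + 1) / 2 ^ n}" for n j :: nat
  define bad where "bad n j = {S. \<not> (finite (S \<inter> A n j) \<and> card (S \<inter> A n j) \<le> 1)}" for n j
  have A_eq: "A n j = {x. q x < (real j + 1) / 2 ^ n} - {x. q x < real j / 2 ^ n}" for n j
    by (auto simp: A_def)
  have As: "A n j \<in> sets \<Lambda>" for n j unfolding A_eq by measurable
  have Am: "emeasure \<Lambda> (A n j) = ennreal (c / 2 ^ n)" for n j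
  proof -
    have "emeasure \<Lambda> (A n j) = ennreal (c * ((real j + 1) / 2 ^ n)) - ennreal (c * (real j / 2 ^ n))"
      unfolding A_eq by (subst emeasure_Diff) (auto simp: vol less_le_trans divide_right_mono)
    also have "\<dots> = ennreal (c / 2 ^ n)"
      using c_pos by (subst ennreal_minus) (auto simp: field_simps)
    finally show ?thesis .
  qed
  have "AE S in P. \<exists>n. \<forall>j < R * 2 ^ n. S \<notin> bad n j" for R :: nat
  proof (rule AE_I)
    let ?N = "\<Inter>n. \<Union>j < R * 2 ^ n. bad n j"
    show "{S \<in> space P. \<not> (\<exists>n. \<forall>j < R * 2 ^ n. S \<notin> bad n j)} \<subseteq> ?N" by auto
    have bs: "bad n j \<in> sets P" and bp: "prob (bad n j) \<le> (c / 2 ^ n)\<^sup>2" for n j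
      using prob_two_points_le[OF As Am] c_pos by (auto simp: bad_def)
    have U: "(\<Union>j < R * 2 ^ n. bad n j) \<in> sets P" for n using bs by auto
    show N: "?N \<in> sets P" using U by auto
    have "prob ?N \<le> real R * c\<^sup>2 * (1 / 2) ^ n" for n
    proof -
      have "prob ?N \<le> prob (\<Union>j < R * 2 ^ n. bad n j)"
        using U by (intro finite_measure_mono) auto
      also have "\<dots> \<le> (\<Sum>j < R * 2 ^ n. prob (bad n j))"
        using bs by (intro finite_measure_subadditive_finite) auto
      also have "\<dots> \<le> (\<Sum>j < R * 2 ^ n. (c / 2 ^ n)\<^sup>2)"
        by (rule sum_mono) (rule bp)
      also have "\<dots> = real R * c\<^sup>2 * (1 / 2) ^ n"
        by (simp add: power2_eq_square field_simps power_one_over)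
      finally show ?thesis .
    qed
    moreover have "(\<lambda>n. real R * c\<^sup>2 * (1 / 2) ^ n) \<longlonglongrightarrow> real R * c\<^sup>2 * 0"
      by (intro tendsto_intros LIMSEQ_realpow_zero) auto
    ultimately have "prob ?N \<le> 0"
      by (intro LIMSEQ_le_const) auto
    then show "emeasure P ?N = 0" by (simp add: emeasure_eq_measure measure_le_0_iff)
  qed
  then have "AE S in P. \<forall>R::nat. \<exists>n. \<forall>j < R * 2 ^ n. S \<notin> bad n j"
    by (simp add: AE_all_countable)
  then show ?thesis
  proof eventually_elim
    case (elim S)
    show ?case
    proof (rule inj_onI, rule ccontr)
      fix x y assume xy: "x \<in> S" "y \<in> S" "q x = q y" "x \<noteq> y"
      obtain R :: nat where R: "q x < real R" using reals_Archimedean2 by blast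
      obtain n where n: "\<And>j. j < R * 2 ^ n \<Longrightarrow> S \<notin> bad n j" using elim by blast
      define j where "j = nat \<lfloor>q x * 2 ^ n\<rfloor>"
      have rj: "real j = of_int \<lfloor>q x * 2 ^ n\<rfloor>" using q_nonneg by (simp add: j_def)
      then have j: "real j \<le> q x * 2 ^ n" "q x * 2 ^ n < real j + 1" by linarith+
      have "real j < real (R * 2 ^ n)"
        using j(1) R by (simp add: le_less_trans)
      then have "j < R * 2 ^ n" by (simp only: of_nat_less_iff)
      then have "S \<notin> bad n j" by (rule n)
      then have "finite (S \<inter> A n j)" "card (S \<inter> A n j) \<le> 1" by (auto simp: bad_def)
      moreover have "{x, y} \<subseteq> S \<inter> A n j" using xy j by (auto simp: A_def field_simps)
      ultimately have "card {x, y} \<le> 1" using card_mono[of "S \<inter> A n j" "{x, y}"] by linarith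
      then show False using xy by simp
    qed
  qed
qed

text \<open>Almost surely the event is avoidance of the open sublevel at \<open>a\<close>, where
  \<open>f\<close> is 0, so the void probability splits off.\<close>

lemma nn_integral_lexp_hmin_ge:
  assumes a: "0 \<le> a" and f [measurable]: "f \<in> borel_measurable \<Lambda>" and f0: "\<And>x. q x < a \<Longrightarrow> f x = 0"
  shows "(\<integral>\<^sup>+ S. ennreal (lexp (psum f S)) * indicator {S. a \<le> hmin S} S \<partial>P)
    = ennreal (exp (- c * a) * lexp (\<integral>\<^sup>+ x. ennreal (1 - lexp (f x)) \<partial>\<Lambda>))"
proof -
  have "(\<integral>\<^sup>+ S. ennreal (lexp (psum f S)) * indicator {S. a \<le> hmin S} S \<partial>P)
      = (\<integral>\<^sup>+ S. ennreal (lexp (psum f S)) * indicator {S. S \<inter> {x. q x < a} = {}} S \<partial>P)"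
    by (rule nn_integral_cong_AE, use AE_nonempty in eventually_elim)
      (use hmin_less_iff in \<open>auto simp: not_less[symmetric] split: split_indicator\<close>)
  also have "\<dots> = ennreal (lexp (ennreal (c * a)) * lexp (\<integral>\<^sup>+ x. ennreal (1 - lexp (f x)) \<partial>\<Lambda>))"
    using ppp_avoid[OF ppp sf sp sublevel_sets(1)[of a] f] f0 a by (simp add: vol)
  finally show ?thesis using a c_pos by (simp add: lexp_ennreal)
qed

text \<open>A difference of two avoidance events. As \<open>f\<close> vanishes below
  \<open>b\<close>, both carry the same Laplace factor, and what remains is the probability of the
  slab: the points above \<open>b\<close> do not notice where below \<open>b\<close> the minimum
  lies.\<close>

lemma nn_integral_lexp_hmin_between:
  assumes a: "0 \<le> a" "a \<le> b" and f [measurable]: "f \<in> borel_measurable \<Lambda>"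
    and f0: "\<And>x. q x < b \<Longrightarrow> f x = 0"
  shows "(\<integral>\<^sup>+ S. ennreal (lexp (psum f S)) * indicator {S. a \<le> hmin S \<and> hmin S < b} S \<partial>P)
    = emeasure P {S. a \<le> hmin S \<and> hmin S < b} * ennreal (lexp (\<integral>\<^sup>+ x. ennreal (1 - lexp (f x)) \<partial>\<Lambda>))"
proof -
  have "{S \<in> space P. a \<le> hmin S \<and> hmin S < b} \<in> sets P" "{S \<in> space P. b \<le> hmin S} \<in> sets P"
    by measurable
  then have [measurable]: "{S. a \<le> hmin S \<and> hmin S < b} \<in> sets P" "{S. b \<le> hmin S} \<in> sets P"
    by simp_all
  \<comment> \<open>Proved for every admissible weight, so that the zero weight identifies the
    difference of exponentials as the probability of the slab.\<close>
  have main: "(\<integral>\<^sup>+ S. ennreal (lexp (psum f S)) * indicator {S. a \<le> hmin S \<and> hmin S < b} S \<partial>P)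
      = ennreal ((exp (- c * a) - exp (- c * b)) * lexp (\<integral>\<^sup>+ x. ennreal (1 - lexp (f x)) \<partial>\<Lambda>))"
    (is "?I = ennreal ((?ea - ?eb) * ?L)")
    if f [measurable]: "f \<in> borel_measurable \<Lambda>" and f0: "\<And>x. q x < b \<Longrightarrow> f x = 0" for f
  proof -
    have [measurable]: "psum f \<in> borel_measurable (config_space \<Lambda>)"
      by (rule borel_measurable_psum[OF f sp])
    \<comment> \<open>Instead of subtracting in \<open>ennreal\<close>, the finite part above
      \<open>b\<close> is added to both sides and cancelled.\<close>
    have "?I + ennreal (?eb * ?L)
       = ?I + (\<integral>\<^sup>+ S. ennreal (lexp (psum f S)) * indicator {S. b \<le> hmin S} S \<partial>P)"
      using nn_integral_lexp_hmin_ge[OF _ f f0] a by simp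
    also have "\<dots> = (\<integral>\<^sup>+ S. ennreal (lexp (psum f S)) * indicator {S. a \<le> hmin S \<and> hmin S < b} S
         + ennreal (lexp (psum f S)) * indicator {S. b \<le> hmin S} S \<partial>P)"
      by (rule nn_integral_add[symmetric]) measurable
    also have "\<dots> = (\<integral>\<^sup>+ S. ennreal (lexp (psum f S)) * indicator {S. a \<le> hmin S} S \<partial>P)"
      using a by (intro nn_integral_cong) (auto split: split_indicator)
    also have "\<dots> = ennreal (?ea * ?L)"
      using nn_integral_lexp_hmin_ge[OF a(1) f] f0 a by simp
    also have "\<dots> = ennreal ((?ea - ?eb) * ?L) + ennreal (?eb * ?L)"
      using a c_pos by (subst ennreal_plus[symmetric]) (auto simp: algebra_simps mult_right_mono)
    finally have "ennreal (?eb * ?L) + ?I = ennreal (?eb * ?L) + ennreal ((?ea - ?eb) * ?L)"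
      by (simp only: add.commute)
    then show ?thesis by (simp only: ennreal_add_left_cancel) simp
  qed
  have "emeasure P {S. a \<le> hmin S \<and> hmin S < b}
      = (\<integral>\<^sup>+ S. ennreal (lexp (psum (\<lambda>_. 0) S)) * indicator {S. a \<le> hmin S \<and> hmin S < b} S \<partial>P)"
  proof -
    have "(\<integral>\<^sup>+ S. ennreal (lexp (psum (\<lambda>_. 0) S)) * indicator {S. a \<le> hmin S \<and> hmin S < b} S \<partial>P)
        = (\<integral>\<^sup>+ S. indicator {S. a \<le> hmin S \<and> hmin S < b} S \<partial>P)"
      by (rule nn_integral_cong) (simp add: psum_def)
    also have "\<dots> = emeasure P {S. a \<le> hmin S \<and> hmin S < b}"
      by (rule nn_integral_indicator) measurable
    finally show ?thesis by (rule sym)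
  qed
  also have "\<dots> = ennreal (exp (- c * a) - exp (- c * b))"
    by (subst main) simp_all
  finally show ?thesis
    using main[OF f f0] a c_pos by (simp add: ennreal_mult)
qed

text \<open>The tail is the void probability of a closed sublevel. Because the minimum is attained,
  \<open>a < hmin S\<close> means that no point has level at most \<open>a\<close>.\<close>

lemma distributed_hmin: "distributed P lborel hmin (exponential_density c)"
proof (rule exponential_distributedI)
  fix a :: real assume a: "0 \<le> a"
  have "prob {S \<in> space P. a < hmin S} = exp (- a * c)"
  proof -
    have "emeasure P {S \<in> space P. a < hmin S} = (\<integral>\<^sup>+ S. indicator {S \<in> space P. a < hmin S} S \<partial>P)"
      by (rule nn_integral_indicator[symmetric]) measurable
    also have "\<dots> = (\<integral>\<^sup>+ S. ennreal (lexp (psum (\<lambda>_. 0) S)) * indicator {S. S \<inter> {x. q x \<le> a} = {}} S \<partial>P)"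
    proof (rule nn_integral_cong_AE, use AE_hmin_attained in eventually_elim)
      case (elim S)
      then have "a < hmin S \<longleftrightarrow> S \<inter> {x. q x \<le> a} = {}" by force
      then show ?case by (auto simp: psum_def split: split_indicator)
    qed
    also have "\<dots> = ennreal (exp (- a * c))"
      using ppp_avoid[OF ppp sf sp sublevel_sets(2)[of a], of "\<lambda>_. 0"] a c_pos
      by (simp add: vol_le lexp_ennreal mult.commute)
    finally show ?thesis by (simp add: emeasure_eq_measure)
  qed
  moreover have "prob {S \<in> space P. hmin S \<le> a} = 1 - prob {S \<in> space P. a < hmin S}"
  proof -
    have "{S \<in> space P. a < hmin S} \<in> sets P" by measurable
    from prob_compl[OF this] have "prob (space P - {S \<in> space P. a < hmin S}) = 1 - prob {S \<in> space P. a < hmin S}" .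
    moreover have "space P - {S \<in> space P. a < hmin S} = {S \<in> space P. hmin S \<le> a}" by auto
    ultimately show ?thesis by simp
  qed
  ultimately show "emeasure P {S \<in> space P. hmin S \<le> a} = 1 - ennreal (exp (- a * c))"
    by (simp add: emeasure_eq_measure ennreal_minus ennreal_1[symmetric] del: ennreal_1)
qed (use c_pos in \<open>auto intro: measurable_hmin\<close>)

text \<open>Upper end of the dyadic interval of length 2^-n containing v. The added 1 puts it
  strictly above v, so the lowest point itself never satisfies
  \<open>dyad n (hmin S) \<le> q x\<close>.\<close>

definition dyad :: "nat \<Rightarrow> real \<Rightarrow> real" where
  "dyad n v = (real (nat \<lfloor>2 ^ n * v\<rfloor>) + 1) / 2 ^ n"

lemma dyad_gt: "0 \<le> v \<Longrightarrow> v < dyad n v"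
proof -
  assume "0 \<le> v"
  then have "real (nat \<lfloor>2 ^ n * v\<rfloor>) = of_int \<lfloor>2 ^ n * v\<rfloor>" by simp
  then have "2 ^ n * v < real (nat \<lfloor>2 ^ n * v\<rfloor>) + 1" by linarith
  then show ?thesis by (simp add: dyad_def field_simps)
qed

lemma dyad_le: "0 \<le> v \<Longrightarrow> dyad n v \<le> v + (1 / 2) ^ n"
proof -
  assume "0 \<le> v"
  then have "real (nat \<lfloor>2 ^ n * v\<rfloor>) = of_int \<lfloor>2 ^ n * v\<rfloor>" by simp
  then have "real (nat \<lfloor>2 ^ n * v\<rfloor>) \<le> 2 ^ n * v" by linarith
  then show ?thesis by (simp add: dyad_def field_simps power_one_over)
qed

text \<open>Dyadic intervals are nested, so their upper ends decrease; the core is floor(2x) <= 2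
  floor(x) + 1.\<close>

lemma dyad_Suc_le: "0 \<le> v \<Longrightarrow> dyad (Suc n) v \<le> dyad n v"
proof -
  assume v: "0 \<le> v"
  have "\<lfloor>2 * (2 ^ n * v)\<rfloor> \<le> 2 * \<lfloor>2 ^ n * v\<rfloor> + 1" by linarith
  then have "nat \<lfloor>2 ^ Suc n * v\<rfloor> \<le> 2 * nat \<lfloor>2 ^ n * v\<rfloor> + 1" by (simp add: mult.assoc)
  then have "real (nat \<lfloor>2 ^ Suc n * v\<rfloor>) \<le> 2 * real (nat \<lfloor>2 ^ n * v\<rfloor>) + 1" by linarith
  then have "(real (nat \<lfloor>2 ^ Suc n * v\<rfloor>) + 1) / 2 ^ Suc n \<le> (2 * real (nat \<lfloor>2 ^ n * v\<rfloor>) + 2) / 2 ^ Suc n"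
    by (intro divide_right_mono) auto
  also have "\<dots> = (real (nat \<lfloor>2 ^ n * v\<rfloor>) + 1) / 2 ^ n" by (simp add: field_simps)
  finally show ?thesis by (simp add: dyad_def)
qed

lemma dyad_tendsto: "0 \<le> v \<Longrightarrow> (\<lambda>n. dyad n v) \<longlonglongrightarrow> v"
proof (rule tendsto_sandwich)
  assume "0 \<le> v"
  then show "\<forall>\<^sub>F n in sequentially. v \<le> dyad n v" "\<forall>\<^sub>F n in sequentially. dyad n v \<le> v + (1 / 2) ^ n"
    using dyad_gt dyad_le by (auto intro!: always_eventually less_imp_le)
  have "(\<lambda>n. v + (1 / 2) ^ n) \<longlonglongrightarrow> v + 0"
    by (intro tendsto_intros LIMSEQ_realpow_zero) auto
  then show "(\<lambda>n. v + (1 / 2) ^ n) \<longlonglongrightarrow> v" by simp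
qed auto

text \<open>The cutoff depends on the configuration, so this is not the sum of one fixed weight and
  the Laplace functional does not apply to it directly.\<close>

definition above :: "('x \<Rightarrow> ennreal) \<Rightarrow> 'x set \<Rightarrow> ennreal" where
  "above w S = psum (\<lambda>x. if hmin S < q x then w x else 0) S"

text \<open>The rounded levels decrease to \<open>hmin S\<close> while staying above it, so the
  weights cut off there increase to the strictly cut off weight and monotone convergence
  applies.\<close>

lemma above_LIMSEQ_SUP:
  assumes "S \<noteq> {}"
  shows "(\<lambda>n. psum (\<lambda>x. if dyad n (hmin S) \<le> q x then w x else 0) S) \<longlonglongrightarrow> above w S"
    and "above w S = (SUP n. psum (\<lambda>x. if dyad n (hmin S) \<le> q x then w x else 0) S)"
proof -
  let ?f = "\<lambda>n x. if dyad n (hmin S) \<le> q x then w x else 0"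
  note h = hmin_nonneg[OF assms]
  have inc: "incseq ?f"
    by (rule incseq_SucI) (use dyad_Suc_le[OF h] in \<open>auto simp: le_fun_def intro: order_trans\<close>)
  have lim: "(\<lambda>n. ?f n x) \<longlonglongrightarrow> (if hmin S < q x then w x else 0)" for x
  proof (rule tendsto_eventually)
    show "\<forall>\<^sub>F n in sequentially. ?f n x = (if hmin S < q x then w x else 0)"
    proof (cases "hmin S < q x")
      case True
      have "\<forall>\<^sub>F n in sequentially. dyad n (hmin S) < q x"
        by (rule order_tendstoD(2)[OF dyad_tendsto[OF h] True])
      then show ?thesis by eventually_elim (use True in auto)
    next
      case False
      then have "\<not> dyad n (hmin S) \<le> q x" for n using dyad_gt[OF h, of n] by linarith
      then show ?thesis using False by (intro always_eventually) simp
    qed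
  qed
  show L: "(\<lambda>n. psum (?f n) S) \<longlonglongrightarrow> above w S"
    unfolding psum_def above_def using inc lim by (intro nn_integral_LIMSEQ) auto
  have "incseq (\<lambda>n. psum (?f n) S)"
    using inc by (auto simp: incseq_def le_fun_def intro!: psum_mono)
  then show "above w S = (SUP n. psum (?f n) S)"
    using LIMSEQ_SUP L LIMSEQ_unique by blast
qed

text \<open>At a fixed level the sum has a fixed weight; a rounded level takes countably many
  values, so the random level may be substituted.\<close>

lemma measurable_above [measurable]:
  assumes w [measurable]: "w \<in> borel_measurable \<Lambda>"
  shows "above w \<in> borel_measurable (config_space \<Lambda>)"
proof -
  have "(\<lambda>S. psum (\<lambda>x. if (real (nat j) + 1) / 2 ^ n \<le> q x then w x else 0) S)
      \<in> borel_measurable (config_space \<Lambda>)" for n and j :: int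
    by (rule borel_measurable_psum[OF _ sp]) measurable
  then have "(\<lambda>S. psum (\<lambda>x. if (real (nat \<lfloor>2 ^ n * hmin S\<rfloor>) + 1) / 2 ^ n \<le> q x then w x else 0) S)
      \<in> borel_measurable (config_space \<Lambda>)" for n
    by (rule measurable_compose_countable) measurable
  then have "(\<lambda>S. SUP n. psum (\<lambda>x. if dyad n (hmin S) \<le> q x then w x else 0) S)
      \<in> borel_measurable (config_space \<Lambda>)"
    unfolding dyad_def by measurable
  moreover have "above w S = (SUP n. psum (\<lambda>x. if dyad n (hmin S) \<le> q x then w x else 0) S)" for S
    using above_LIMSEQ_SUP(2)[of S w] by (cases "S = {}") (auto simp: above_def psum_def nn_integral_empty)
  ultimately show ?thesis by (simp add: fun_eq_iff cong: measurable_cong)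
qed

text \<open>On each slab of lowest levels the rounded level is a constant \<open>t j\<close>, and
  \<open>F (t j)\<close> ignores everything below it. The slab factorisation therefore replaces the
  random sum by its Laplace transform, and the slabs are summed back.\<close>

lemma nn_integral_lexp_dyad:
  fixes G :: "real \<Rightarrow> real" and F :: "real \<Rightarrow> 'x \<Rightarrow> ennreal"
  assumes F: "\<And>v. 0 < v \<Longrightarrow> F v \<in> borel_measurable \<Lambda>" and F0: "\<And>v x. q x < v \<Longrightarrow> F v x = 0"
    and L: "\<And>v. 0 < v \<Longrightarrow> lexp (\<integral>\<^sup>+ x. ennreal (1 - lexp (F v x)) \<partial>\<Lambda>) = L v" and G: "\<And>v. 0 \<le> G v"
  shows "(\<integral>\<^sup>+ S. ennreal (G (dyad n (hmin S)) * lexp (psum (F (dyad n (hmin S))) S)) \<partial>P)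
    = (\<integral>\<^sup>+ S. ennreal (G (dyad n (hmin S)) * L (dyad n (hmin S))) \<partial>P)"
proof -
  define t where "t j = (real j + 1) / 2 ^ n" for j :: nat
  define E where "E j = {S. real j / 2 ^ n \<le> hmin S \<and> hmin S < t j}" for j :: nat
  have t_pos: "0 < t j" for j by (simp add: t_def add_nonneg_pos)
  have L_nonneg: "0 \<le> L (t j)" for j using L[OF t_pos[of j]] by (metis lexp_nonneg)
  have E_sets [measurable]: "E j \<in> sets P" for j
  proof -
    have "E j = {S \<in> space P. real j / 2 ^ n \<le> hmin S \<and> hmin S < t j}" by (auto simp: E_def)
    also have "\<dots> \<in> sets P" by measurable
    finally show ?thesis .
  qed
  have iff: "S \<in> E j \<longleftrightarrow> nat \<lfloor>2 ^ n * hmin S\<rfloor> = j" if "0 \<le> hmin S" for S j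
  proof -
    have "S \<in> E j \<longleftrightarrow> real j \<le> 2 ^ n * hmin S \<and> 2 ^ n * hmin S < real j + 1"
      by (simp add: E_def t_def field_simps)
    also have "\<dots> \<longleftrightarrow> \<lfloor>2 ^ n * hmin S\<rfloor> = int j"
      by (simp add: floor_eq_iff)
    also have "\<dots> \<longleftrightarrow> nat \<lfloor>2 ^ n * hmin S\<rfloor> = j"
      using that by auto
    finally show ?thesis .
  qed
  have split: "(\<integral>\<^sup>+ S. H (dyad n (hmin S)) S \<partial>P) = (\<Sum>j. \<integral>\<^sup>+ S. H (t j) S * indicator (E j) S \<partial>P)"
    if H [measurable]: "\<And>j. H (t j) \<in> borel_measurable P" for H :: "real \<Rightarrow> 'x set \<Rightarrow> ennreal"
  proof -
    have "(\<integral>\<^sup>+ S. H (dyad n (hmin S)) S \<partial>P) = (\<integral>\<^sup>+ S. (\<Sum>j. H (t j) S * indicator (E j) S) \<partial>P)"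
    proof (rule nn_integral_cong_AE, use AE_nonempty in eventually_elim)
      case (elim S)
      define j where "j = nat \<lfloor>2 ^ n * hmin S\<rfloor>"
      note i = iff[OF hmin_nonneg[OF elim], folded j_def]
      have "(\<Sum>k. H (t k) S * indicator (E k) S) = (\<Sum>k\<in>{j}. H (t k) S * indicator (E k) S)"
        by (rule suminf_finite) (auto simp: i)
      also have "\<dots> = H (t j) S" using i by simp
      finally show ?case by (simp add: dyad_def t_def j_def)
    qed
    also have "\<dots> = (\<Sum>j. \<integral>\<^sup>+ S. H (t j) S * indicator (E j) S \<partial>P)"
      by (rule nn_integral_suminf) measurable
    finally show ?thesis .
  qed
  have pm [measurable]: "psum (F (t j)) \<in> borel_measurable (config_space \<Lambda>)" for j
    by (rule borel_measurable_psum[OF F[OF t_pos] sp])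
  have "(\<integral>\<^sup>+ S. ennreal (G (dyad n (hmin S)) * lexp (psum (F (dyad n (hmin S))) S)) \<partial>P)
     = (\<Sum>j. \<integral>\<^sup>+ S. ennreal (G (t j) * lexp (psum (F (t j)) S)) * indicator (E j) S \<partial>P)"
    by (intro split) measurable
  also have "\<dots> = (\<Sum>j. \<integral>\<^sup>+ S. ennreal (G (t j) * L (t j)) * indicator (E j) S \<partial>P)"
  proof (rule suminf_cong)
    fix j
    have "(\<integral>\<^sup>+ S. ennreal (G (t j) * lexp (psum (F (t j)) S)) * indicator (E j) S \<partial>P)
        = ennreal (G (t j)) * (\<integral>\<^sup>+ S. ennreal (lexp (psum (F (t j)) S)) * indicator (E j) S \<partial>P)"
      using pm[of j] G by (subst nn_integral_cmult[symmetric]) (auto simp: ennreal_mult mult.assoc)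
    also have "\<dots> = ennreal (G (t j)) * (emeasure P (E j) * ennreal (L (t j)))"
    proof -
      have "real j / 2 ^ n \<le> t j" by (simp add: t_def divide_right_mono)
      from nn_integral_lexp_hmin_between[OF _ this F[OF t_pos] F0]
      show ?thesis by (simp add: E_def L[OF t_pos])
    qed
    also have "\<dots> = (\<integral>\<^sup>+ S. ennreal (G (t j) * L (t j)) * indicator (E j) S \<partial>P)"
      using G L_nonneg by (subst nn_integral_cmult_indicator) (auto simp: ennreal_mult ac_simps)
    finally show "(\<integral>\<^sup>+ S. ennreal (G (t j) * lexp (psum (F (t j)) S)) * indicator (E j) S \<partial>P)
        = (\<integral>\<^sup>+ S. ennreal (G (t j) * L (t j)) * indicator (E j) S \<partial>P)" .
  qed
  also have "\<dots> = (\<integral>\<^sup>+ S. ennreal (G (dyad n (hmin S)) * L (dyad n (hmin S))) \<partial>P)"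
    by (intro split[symmetric]) measurable
  finally show ?thesis .
qed

lemma measurable_dyad [measurable]: "dyad n \<in> borel_measurable borel"
  unfolding dyad_def by measurable

text \<open>Conditionally on the lowest level $v$, the points above it form a Poisson process. Replacing
  $v$ by the next dyadic level makes this an instance of independence over disjoint slabs.\<close>
theorem nn_integral_lexp_above:
  fixes G L :: "real \<Rightarrow> real"
  assumes w [measurable]: "w \<in> borel_measurable \<Lambda>"
    and G: "continuous_on {0<..} G" "\<And>v. 0 \<le> G v" "\<And>v. G v \<le> 1"
    and Lc: "continuous_on {0<..} L"
    and L: "\<And>v. 0 < v \<Longrightarrow>
      lexp (\<integral>\<^sup>+ x. ennreal (1 - lexp (ennreal (v powr \<beta>) * (if v \<le> q x then w x else 0))) \<partial>\<Lambda>) = L v"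
  shows "(\<integral>\<^sup>+ S. ennreal (G (hmin S) * lexp (ennreal (hmin S powr \<beta>) * above w S)) \<partial>P)
    = (\<integral>\<^sup>+ v. ennreal (exponential_density c v * (G v * L v)) \<partial>lborel)"
proof -
  define d where "d n S = dyad n (hmin S)" for n S
  define F where "F v x = ennreal (v powr \<beta>) * (if v \<le> q x then w x else 0)" for v x
  have [measurable]: "d n \<in> borel_measurable P" for n unfolding d_def by measurable
  have Lb: "0 \<le> L v" "L v \<le> 1" if "0 < v" for v
    using L[OF that] lexp_nonneg lexp_le_one by metis+
  have FP: "psum (F v) S = ennreal (v powr \<beta>) * psum (\<lambda>x. if v \<le> q x then w x else 0) S" for v S
    unfolding F_def by (rule psum_cmult)
  \<comment> \<open>\<open>G\<close> and \<open>L\<close> are controlled only at positive levels;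
    extended by 0 they are Borel on the whole line, and the lowest level is almost surely
    positive.\<close>
  define G' where "G' v = (if 0 < v then G v else 0)" for v
  define L' where "L' v = (if 0 < v then L v else 0)" for v
  have [measurable]: "G' \<in> borel_measurable borel" "L' \<in> borel_measurable borel"
    unfolding G'_def L'_def
    using borel_measurable_continuous_on_if[of "{0<..}" G "\<lambda>_. 0"] G(1)
      borel_measurable_continuous_on_if[of "{0<..}" L "\<lambda>_. 0"] Lc by simp_all
  have AE_d: "AE S in P. S \<noteq> {} \<and> 0 < hmin S \<and> (\<forall>n. 0 < d n S) \<and> (\<lambda>n. d n S) \<longlonglongrightarrow> hmin S"
    using AE_nonempty AE_hmin_attained
  proof eventually_elim
    case (elim S)
    then have "0 < hmin S" by blast
    then show ?case using elim(1) dyad_gt[of "hmin S"] dyad_tendsto[of "hmin S"]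
      by (auto simp: d_def intro: less_trans)
  qed
  define H1 where "H1 n S = ennreal (G' (d n S) * lexp (psum (F (d n S)) S))" for n S
  define H2 where "H2 n S = ennreal (G' (d n S) * L' (d n S))" for n S
  have psm: "(\<lambda>S. psum (F (d n S)) S) \<in> borel_measurable P" for n
  proof -
    have "(\<lambda>S. psum (F ((real (nat j) + 1) / 2 ^ n)) S) \<in> borel_measurable P" for j :: int
      unfolding F_def measurable_cong_sets[OF sets_P refl]
      by (rule borel_measurable_psum[OF _ sp]) measurable
    then have "(\<lambda>S. psum (F ((real (nat \<lfloor>2 ^ n * hmin S\<rfloor>) + 1) / 2 ^ n)) S) \<in> borel_measurable P"
      by (rule measurable_compose_countable) measurable
    then show ?thesis by (simp add: d_def dyad_def)
  qed
  have H1m: "H1 n \<in> borel_measurable P" for n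
    unfolding H1_def using psm[of n] by measurable
  have H2m: "H2 n \<in> borel_measurable P" for n
    unfolding H2_def by measurable
  have lim1: "(\<lambda>n. \<integral>\<^sup>+ S. H1 n S \<partial>P) \<longlonglongrightarrow>
     (\<integral>\<^sup>+ S. ennreal (G' (hmin S) * lexp (ennreal (hmin S powr \<beta>) * above w S)) \<partial>P)"
  proof (rule nn_integral_dominated_convergence[where w="\<lambda>_. 1"])
    show "AE S in P. H1 n S \<le> 1" for n
      using G by (auto simp: H1_def G'_def mult_le_one)
    show "AE S in P. (\<lambda>n. H1 n S) \<longlonglongrightarrow>
        ennreal (G' (hmin S) * lexp (ennreal (hmin S powr \<beta>) * above w S))"
      using AE_d
    proof eventually_elim
      case (elim S)
      have "isCont G (hmin S)" using G(1) elim by (auto simp: continuous_on_eq_continuous_at)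
      then have 1: "(\<lambda>n. G (d n S)) \<longlonglongrightarrow> G (hmin S)"
        using elim by (auto intro: isCont_tendsto_compose)
      have "(\<lambda>n. ennreal (d n S powr \<beta>)) \<longlonglongrightarrow> ennreal (hmin S powr \<beta>)"
        using elim by (intro tendsto_ennrealI tendsto_powr) auto
      then have "(\<lambda>n. psum (F (d n S)) S) \<longlonglongrightarrow> ennreal (hmin S powr \<beta>) * above w S"
        unfolding FP using above_LIMSEQ_SUP(1)[of S w] elim
        by (intro tendsto_mult_ennreal) (auto simp: d_def)
      with 1 have "(\<lambda>n. ennreal (G (d n S) * lexp (psum (F (d n S)) S)))
          \<longlonglongrightarrow> ennreal (G (hmin S) * lexp (ennreal (hmin S powr \<beta>) * above w S))"
        by (intro tendsto_ennrealI tendsto_mult tendsto_lexp)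
      then show ?case using elim by (simp add: H1_def G'_def)
    qed
    show "(\<lambda>S. ennreal (G' (hmin S) * lexp (ennreal (hmin S powr \<beta>) * above w S)))
        \<in> borel_measurable P"
      by measurable
  qed (auto simp: H1m emeasure_space_1[simplified])
  have lim2: "(\<lambda>n. \<integral>\<^sup>+ S. H2 n S \<partial>P) \<longlonglongrightarrow>
     (\<integral>\<^sup>+ S. ennreal (G' (hmin S) * L' (hmin S)) \<partial>P)"
  proof (rule nn_integral_dominated_convergence[where w="\<lambda>_. 1"])
    show "AE S in P. H2 n S \<le> 1" for n
      using G Lb by (auto simp: H2_def G'_def L'_def mult_le_one)
    show "AE S in P. (\<lambda>n. H2 n S) \<longlonglongrightarrow>
        ennreal (G' (hmin S) * L' (hmin S))"
      using AE_d
    proof eventually_elim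
      case (elim S)
      have "isCont G (hmin S)" "isCont L (hmin S)"
        using G(1) Lc elim by (auto simp: continuous_on_eq_continuous_at)
      then have "(\<lambda>n. G (d n S)) \<longlonglongrightarrow> G (hmin S)" "(\<lambda>n. L (d n S)) \<longlonglongrightarrow> L (hmin S)"
        using elim by (auto intro: isCont_tendsto_compose)
      then have "(\<lambda>n. ennreal (G (d n S) * L (d n S))) \<longlonglongrightarrow> ennreal (G (hmin S) * L (hmin S))"
        by (intro tendsto_ennrealI tendsto_mult)
      then show ?case using elim by (simp add: H2_def G'_def L'_def)
    qed
    show "(\<lambda>S. ennreal (G' (hmin S) * L' (hmin S)))
        \<in> borel_measurable P"
      by measurable
  qed (auto simp: H2m emeasure_space_1[simplified])
  have eq: "(\<integral>\<^sup>+ S. H1 n S \<partial>P) = (\<integral>\<^sup>+ S. H2 n S \<partial>P)" for n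
    unfolding H1_def H2_def d_def
    by (rule nn_integral_lexp_dyad) (use G L in \<open>auto simp: F_def G'_def L'_def\<close>)
  have "(\<integral>\<^sup>+ S. ennreal (G (hmin S) * lexp (ennreal (hmin S powr \<beta>) * above w S)) \<partial>P)
     = (\<integral>\<^sup>+ S. ennreal (G' (hmin S) * lexp (ennreal (hmin S powr \<beta>) * above w S)) \<partial>P)"
    by (rule nn_integral_cong_AE, use AE_d in eventually_elim) (simp add: G'_def)
  also have "\<dots> = (\<integral>\<^sup>+ S. ennreal (G' (hmin S) * L' (hmin S)) \<partial>P)"
    using LIMSEQ_unique[OF lim1] lim2 eq by simp
  also have "\<dots> = (\<integral>\<^sup>+ v. ennreal (exponential_density c v) *
      ennreal (G' v * L' v) \<partial>lborel)"
    by (intro distributed_nn_integral[OF distributed_hmin, symmetric]) measurable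
  also have "\<dots> = (\<integral>\<^sup>+ v. ennreal (exponential_density c v * (G v * L v)) \<partial>lborel)"
  proof (rule nn_integral_cong_AE)
    have "AE v in lborel. v \<noteq> (0::real)" by (rule AE_lborel_singleton)
    then show "AE v in lborel. ennreal (exponential_density c v) *
        ennreal (G' v * L' v)
        = ennreal (exponential_density c v * (G v * L v))"
      by eventually_elim (use c_pos in \<open>auto simp: exponential_density_def G'_def L'_def simp flip: ennreal_mult'\<close>)
  qed
  finally show ?thesis .
qed

end

section \<open>The macro tier\<close>

text \<open>Polar coordinates without the angle: the disk of squared radius a has area pi a.
  Agreement on the generators \<open>{..a}\<close> suffices.\<close>

lemma distr_norm_sq:
  "distr lborel borel (\<lambda>y::real^2. (norm y)\<^sup>2) = density lborel (\<lambda>w. ennreal pi * indicator {0..} w)"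
proof (rule measure_eqI_generator_eq[where E="range atMost" and A="\<lambda>n. {..real n}" and \<Omega>=UNIV])
  have vol: "emeasure (distr lborel borel (\<lambda>y::real^2. (norm y)\<^sup>2)) {..a} = (if 0 \<le> a then ennreal (pi * a) else 0)" for a
  proof (cases "0 \<le> a")
    case True
    have "(\<lambda>y::real^2. (norm y)\<^sup>2) -` {..a} \<inter> space lborel = cball 0 (sqrt a)"
      using True by (auto simp: real_le_rsqrt sqrt_ge_absD)
    then have "emeasure (distr lborel borel (\<lambda>y::real^2. (norm y)\<^sup>2)) {..a} = emeasure lborel (cball (0::real^2) (sqrt a))"
      by (subst emeasure_distr) auto
    also have "\<dots> = ennreal (pi * a)"
      using True by (subst emeasure_cball) (auto simp: unit_ball_vol_2)
    finally show ?thesis using True by simp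
  next
    case False
    then have "(\<lambda>y::real^2. (norm y)\<^sup>2) -` {..a} \<inter> space lborel = {}"
    proof (intro equalityI subsetI)
      fix y :: "real^2" assume "y \<in> (\<lambda>y. (norm y)\<^sup>2) -` {..a} \<inter> space lborel"
      then have "(norm y)\<^sup>2 \<le> a" by simp
      with False zero_le_power2[of "norm y"] show "y \<in> {}" by linarith
    qed simp
    then show ?thesis using False by (subst emeasure_distr) auto
  qed
  fix X :: "real set" assume "X \<in> range atMost"
  then obtain a where X: "X = {..a}" by auto
  have "emeasure (density lborel (\<lambda>w. ennreal pi * indicator {0..} w)) {..a}
      = (\<integral>\<^sup>+ w. ennreal pi * indicator {0..a} w \<partial>lborel)"
    by (subst emeasure_density) (auto intro!: nn_integral_cong split: split_indicator)
  also have "\<dots> = (if 0 \<le> a then ennreal (pi * a) else 0)"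
    by (subst nn_integral_cmult_indicator) (auto simp: ennreal_mult)
  finally show "emeasure (distr lborel borel (\<lambda>y::real^2. (norm y)\<^sup>2)) X
      = emeasure (density lborel (\<lambda>w. ennreal pi * indicator {0..} w)) X"
    using vol X by simp
next
  fix n :: nat
  have "(\<lambda>y::real^2. (norm y)\<^sup>2) -` {..real n} \<inter> space lborel = cball 0 (sqrt n)"
    by (auto simp: real_le_rsqrt sqrt_ge_absD)
  then show "emeasure (distr lborel borel (\<lambda>y::real^2. (norm y)\<^sup>2)) {..real n} \<noteq> \<infinity>"
    by (subst emeasure_distr) (auto simp: emeasure_cball)
next
  show "Int_stable (range (atMost :: real \<Rightarrow> _))"
    by (auto simp: Int_stable_def)
  show "(\<Union>n. {..real n}) = UNIV" by (auto simp: real_arch_simple)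
qed (auto simp: borel_eq_atMost)

lemma nn_integral_norm_sq:
  assumes [measurable]: "f \<in> borel_measurable borel"
  shows "(\<integral>\<^sup>+ (y::real^2). f ((norm y)\<^sup>2) \<partial>lborel) = ennreal pi * (\<integral>\<^sup>+ w. f w * indicator {0..} w \<partial>lborel)"
proof -
  have "(\<integral>\<^sup>+ (y::real^2). f ((norm y)\<^sup>2) \<partial>lborel) = (\<integral>\<^sup>+ w. f w \<partial>distr lborel borel (\<lambda>y::real^2. (norm y)\<^sup>2))"
    by (rule nn_integral_distr[symmetric]) measurable
  also have "\<dots> = (\<integral>\<^sup>+ w. ennreal pi * (f w * indicator {0..} w) \<partial>lborel)"
    unfolding distr_norm_sq by (subst nn_integral_density) (auto simp: ac_simps)
  also have "\<dots> = ennreal pi * (\<integral>\<^sup>+ w. f w * indicator {0..} w \<partial>lborel)"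
    by (rule nn_integral_cmult) measurable
  finally show ?thesis .
qed

section \<open>Exponential fading and the path loss integral\<close>

lemma sets_exp_law [measurable_cong, simp]: "sets (exp_law mu) = sets borel"
  by (simp add: exp_law_def)

lemma space_exp_law [simp]: "space (exp_law mu) = UNIV"
  by (simp add: exp_law_def)

lemma prob_space_exp_law: "0 < mu \<Longrightarrow> prob_space (exp_law mu)"
  unfolding exp_law_def by (rule prob_space_exponential_density)

lemma AE_exp_law_pos: "AE g in exp_law mu. 0 < g"
  unfolding exp_law_def
proof (subst AE_density)
  have "AE g in lborel. g \<noteq> (0::real)" by (rule AE_lborel_singleton)
  then show "AE g in lborel. 0 < ennreal (exponential_density mu g) \<longrightarrow> 0 < g"
    by eventually_elim (auto simp: exponential_density_def split: if_splits)
qed simp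

text \<open>Exponential tilting: e^(-kg) times the density of rate mu is mu/(mu+k) times the density
  of rate mu+k. The complement follows by cancelling in a sum equal to 1.\<close>

lemma nn_integral_exp_law_laplace:
  assumes mu: "0 < mu" and k: "0 \<le> k"
  shows "(\<integral>\<^sup>+ g. ennreal (1 - lexp (ennreal (k * g))) \<partial>exp_law mu) = ennreal (k / (mu + k))"
proof -
  interpret prob_space "exp_law mu" by (rule prob_space_exp_law[OF mu])
  interpret K: prob_space "exp_law (mu + k)" using mu k by (intro prob_space_exp_law) auto
  have "(\<integral>\<^sup>+ g. ennreal (lexp (ennreal (k * g))) \<partial>exp_law mu)
      = (\<integral>\<^sup>+ g. ennreal (exponential_density mu g) * ennreal (lexp (ennreal (k * g))) \<partial>lborel)"
    unfolding exp_law_def by (rule nn_integral_density) measurable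
  also have "\<dots> = (\<integral>\<^sup>+ g. ennreal (mu / (mu + k)) * ennreal (exponential_density (mu + k) g) \<partial>lborel)"
  proof (intro nn_integral_cong)
    fix g :: real
    have "mu + k \<noteq> 0" using mu k by simp
    then have "exponential_density mu g * lexp (ennreal (k * g))
        = mu / (mu + k) * exponential_density (mu + k) g"
      using k by (auto simp: exponential_density_def lexp_ennreal mult_exp_exp ring_distribs(1) mult.commute)
    then show "ennreal (exponential_density mu g) * ennreal (lexp (ennreal (k * g)))
        = ennreal (mu / (mu + k)) * ennreal (exponential_density (mu + k) g)"
      using mu k by (subst ennreal_mult''[symmetric], simp, subst ennreal_mult'[symmetric]) auto
  qed
  also have "\<dots> = ennreal (mu / (mu + k)) * (\<integral>\<^sup>+ g. ennreal (exponential_density (mu + k) g) \<partial>lborel)"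
    by (rule nn_integral_cmult) measurable
  also have "(\<integral>\<^sup>+ g. ennreal (exponential_density (mu + k) g) \<partial>lborel) = 1"
    using K.emeasure_space_1 by (simp add: exp_law_def emeasure_density)
  finally have e: "(\<integral>\<^sup>+ g. ennreal (lexp (ennreal (k * g))) \<partial>exp_law mu) = ennreal (mu / (mu + k))" by simp
  have "ennreal (mu / (mu + k)) + (\<integral>\<^sup>+ g. ennreal (1 - lexp (ennreal (k * g))) \<partial>exp_law mu)
      = (\<integral>\<^sup>+ g. ennreal (lexp (ennreal (k * g))) + ennreal (1 - lexp (ennreal (k * g))) \<partial>exp_law mu)"
    unfolding e[symmetric] by (rule nn_integral_add[symmetric]) measurable
  also have "\<dots> = (\<integral>\<^sup>+ g. 1 \<partial>exp_law mu)"
    by (intro nn_integral_cong) (simp flip: ennreal_plus)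
  also have "\<dots> = 1" using emeasure_space_1 by simp
  also have "1 = ennreal (mu / (mu + k)) + ennreal (k / (mu + k))"
    using mu k by (simp add: add_divide_distrib[symmetric] flip: ennreal_plus)
  finally show ?thesis by (simp only: ennreal_add_left_cancel) simp
qed

text \<open>Comparison with u^(-alpha/2), whose antiderivative tends to 0 at infinity because alpha
  > 2.\<close>

lemma nn_integral_tail_finite:
  assumes "alpha > 2" "a > 0"
  shows "(\<integral>\<^sup>+ u. ennreal (1 / (1 + u powr (alpha / 2))) * indicator {a..} u \<partial>lborel) < \<top>"
proof -
  let ?p = "1 - alpha / 2"
  have "(\<integral>\<^sup>+ u. ennreal (1 / (1 + u powr (alpha / 2))) * indicator {a..} u \<partial>lborel)
      \<le> (\<integral>\<^sup>+ u. ennreal (u powr (- alpha / 2)) * indicator {a..} u \<partial>lborel)"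
  proof (rule nn_integral_mono)
    fix u :: real
    show "ennreal (1 / (1 + u powr (alpha / 2))) * indicator {a..} u
        \<le> ennreal (u powr (- alpha / 2)) * indicator {a..} u"
    proof (cases "a \<le> u")
      case True
      then have "0 < u" using assms by simp
      then have "1 / (1 + u powr (alpha / 2)) \<le> 1 / u powr (alpha / 2)"
        by (intro divide_left_mono) (auto intro!: mult_pos_pos add_pos_nonneg)
      then show ?thesis using \<open>0 < u\<close> by (auto simp: powr_minus_divide intro!: ennreal_leI mult_right_mono)
    qed simp
  qed
  also have "\<dots> = ennreal (0 - a powr ?p / ?p)"
  proof (rule nn_integral_FTC_atLeast)
    show "((\<lambda>u. u powr ?p / ?p) has_real_derivative u powr (- alpha / 2)) (at u)" if "a \<le> u" for u
    proof -
      have "0 < u" using assms that by simp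
      from DERIV_cdivide[OF has_real_derivative_powr[OF this, of ?p], of ?p]
      show ?thesis using assms by simp
    qed
    have "((\<lambda>u. u powr ?p / ?p) \<longlongrightarrow> 0 / ?p) at_top"
      using assms by (intro tendsto_divide tendsto_neg_powr tendsto_const) (auto intro: filterlim_ident)
    then show "((\<lambda>u. u powr ?p / ?p) \<longlongrightarrow> 0) at_top" by simp
  qed auto
  also have "\<dots> < \<top>" by simp
  finally show ?thesis .
qed

text \<open>The substitution w = k u with k = v T^(2/alpha) turns (1/T)(w/v)^(alpha/2) into
  u^(alpha/2) and the lower limit v into T^(-2/alpha). The Jacobian k supplies v and the prefactor
  of \<open>varphi\<close>.\<close>

lemma nn_integral_varphi:
  assumes alpha: "alpha > 2" and T: "T > 0" and v: "v > 0"
  shows "(\<integral>\<^sup>+ w. ennreal (1 / (1 + (1 / T) * (w / v) powr (alpha / 2))) * indicator {v..} w \<partial>lborel)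
    = ennreal (v * varphi T alpha)"
proof -
  define k where "k = v * T powr (2 / alpha)"
  have k: "k > 0" using T v by (simp add: k_def)
  let ?g = "\<lambda>u. 1 / (1 + u powr (alpha / 2))" and ?a = "T powr (- 2 / alpha)"
  have fin: "(\<integral>\<^sup>+ u. ennreal (?g u) * indicator {?a..} u \<partial>lborel) < \<top>"
    using T by (intro nn_integral_tail_finite[OF alpha]) auto
  have "(\<integral>\<^sup>+ w. ennreal (1 / (1 + (1 / T) * (w / v) powr (alpha / 2))) * indicator {v..} w \<partial>lborel)
      = ennreal \<bar>k\<bar> * (\<integral>\<^sup>+ u. ennreal (1 / (1 + (1 / T) * ((0 + k * u) / v) powr (alpha / 2))) * indicator {v..} (0 + k * u) \<partial>lborel)"
    using k by (intro nn_integral_real_affine) auto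
  also have "(\<integral>\<^sup>+ u. ennreal (1 / (1 + (1 / T) * ((0 + k * u) / v) powr (alpha / 2))) * indicator {v..} (0 + k * u) \<partial>lborel)
      = (\<integral>\<^sup>+ u. ennreal (?g u) * indicator {?a..} u \<partial>lborel)"
  proof (rule nn_integral_cong)
    fix u :: real
    have iff: "v \<le> k * u \<longleftrightarrow> ?a \<le> u"
      using v T by (simp add: k_def powr_minus field_simps)
    show "ennreal (1 / (1 + (1 / T) * ((0 + k * u) / v) powr (alpha / 2))) * indicator {v..} (0 + k * u)
        = ennreal (?g u) * indicator {?a..} u"
    proof (cases "?a \<le> u")
      case True
      have "0 < ?a" using T by simp
      with True have u: "0 < u" by linarith
      have "((0 + k * u) / v) powr (alpha / 2) = (T powr (2 / alpha)) powr (alpha / 2) * u powr (alpha / 2)"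
        using v u T by (simp add: k_def powr_mult)
      also have "\<dots> = T * u powr (alpha / 2)"
        using T alpha by (simp add: powr_powr)
      finally show ?thesis using True iff T by simp
    qed (use iff in simp)
  qed
  also have "\<dots> = ennreal (set_lebesgue_integral lborel {?a..} ?g)"
  proof -
    have e: "(\<integral>\<^sup>+ u. ennreal (?g u) * indicator {?a..} u \<partial>lborel)
        = (\<integral>\<^sup>+ u. ennreal (indicator {?a..} u *\<^sub>R ?g u) \<partial>lborel)"
      by (intro nn_integral_cong) (auto split: split_indicator)
    have "integrable lborel (\<lambda>u. indicator {?a..} u *\<^sub>R ?g u)"
      using fin unfolding e by (intro integrableI_nonneg) (auto intro!: AE_I2 add_nonneg_nonneg split: split_indicator)
    then show ?thesis unfolding e set_lebesgue_integral_def
      by (intro nn_integral_eq_integral) (auto intro!: AE_I2 add_nonneg_nonneg split: split_indicator)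
  qed
  also have "ennreal \<bar>k\<bar> * \<dots> = ennreal (k * set_lebesgue_integral lborel {?a..} ?g)"
    using k by (simp add: ennreal_mult')
  finally show ?thesis by (simp add: k_def varphi_def mult.assoc)
qed

lemma varphi_nonneg: "0 \<le> varphi T alpha"
  unfolding varphi_def set_lebesgue_integral_def
  by (intro mult_nonneg_nonneg integral_nonneg) (auto intro!: add_nonneg_nonneg split: split_indicator)

text \<open>In squared distance the integrand is at most 1 on [0,1], and beyond 1 it is the tail
  given by \<open>nn_integral_varphi\<close> at v = 1 and T = s.\<close>

lemma nn_integral_path_loss_finite:
  assumes alpha: "alpha > 2" and s: "s > 0"
  shows "(\<integral>\<^sup>+ (y::real^2). ennreal (1 / (1 + (1 / s) * norm y powr alpha)) \<partial>lborel) < \<top>"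
proof -
  let ?f = "\<lambda>w. ennreal (1 / (1 + (1 / s) * w powr (alpha / 2)))"
  have "(\<integral>\<^sup>+ (y::real^2). ennreal (1 / (1 + (1 / s) * norm y powr alpha)) \<partial>lborel)
      = (\<integral>\<^sup>+ (y::real^2). ?f ((norm y)\<^sup>2) \<partial>lborel)"
  proof (intro nn_integral_cong)
    fix y :: "real^2"
    have "(norm y)\<^sup>2 powr (alpha / 2) = norm y powr alpha"
      by (cases "y = 0") (simp_all add: powr_powr flip: powr_numeral)
    then show "ennreal (1 / (1 + (1 / s) * norm y powr alpha)) = ?f ((norm y)\<^sup>2)" by simp
  qed
  also have "\<dots> = ennreal pi * (\<integral>\<^sup>+ w. ?f w * indicator {0..} w \<partial>lborel)"
    by (rule nn_integral_norm_sq) measurable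
  finally have eq: "(\<integral>\<^sup>+ (y::real^2). ennreal (1 / (1 + (1 / s) * norm y powr alpha)) \<partial>lborel)
      = ennreal pi * (\<integral>\<^sup>+ w. ?f w * indicator {0..} w \<partial>lborel)" .
  have "(\<integral>\<^sup>+ w. ?f w * indicator {0..} w \<partial>lborel)
      \<le> (\<integral>\<^sup>+ w. indicator {0..1} w + ennreal (1 / (1 + (1 / s) * (w / 1) powr (alpha / 2))) * indicator {1..} w \<partial>lborel)"
  proof (intro nn_integral_mono)
    fix w :: real
    have "?f w \<le> 1" using s by (intro ennreal_le_1[THEN iffD2]) (simp add: add_pos_nonneg)
    then show "?f w * indicator {0..} w \<le> indicator {0..1} w + ennreal (1 / (1 + (1 / s) * (w / 1) powr (alpha / 2))) * indicator {1..} w"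
      by (cases "w < 0"; cases "w \<le> 1") (auto split: split_indicator)
  qed
  also have "\<dots> = ennreal 1 + ennreal (1 * varphi s alpha)"
    by (subst nn_integral_add) (auto simp: nn_integral_varphi[OF alpha s, of 1, simplified])
  also have "\<dots> < \<top>" by simp
  finally show ?thesis unfolding eq by (simp add: ennreal_mult_less_top)
qed

lemma sigma_finite_lborel_const: "sigma_finite_measure (density lborel (\<lambda>_::'b::euclidean_space. ennreal c))"
  by (subst sigma_finite_measure.sigma_finite_iff_density_finite'[OF sigma_finite_lborel]) auto

lemma emeasure_lborel_atLeast: "emeasure lborel {a::real..} = \<top>"
proof (rule ccontr)
  assume "emeasure lborel {a..} \<noteq> \<top>"
  then obtain r where r: "0 \<le> r" "emeasure lborel {a..} = ennreal r"
    by (cases "emeasure lborel {a..}") auto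
  have "emeasure lborel {a..a + (r + 1)} \<le> emeasure lborel {a..}"
    by (rule emeasure_mono) auto
  then have "ennreal (r + 1) \<le> ennreal r" using r by simp
  then show False using r(1) by simp
qed

section \<open>Marked macro stations\<close>

lemma sets_macro_intensity [measurable_cong]:
  "sets (macro_intensity lm Pb mu) = sets (borel \<Otimes>\<^sub>M (count_space UNIV \<Otimes>\<^sub>M borel))"
  unfolding macro_intensity_def by (intro sets_pair_measure_cong) auto

lemma space_macro_intensity [simp]: "space (macro_intensity lm Pb mu) = UNIV"
  by (simp add: macro_intensity_def space_pair_measure)

lemma prob_space_macro_mark:
  "0 < mu \<Longrightarrow> prob_space (measure_pmf (bernoulli_pmf Pb) \<Otimes>\<^sub>M exp_law mu)"
  by (intro prob_space_pair measure_pmf.prob_space_axioms prob_space_exp_law)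

lemma sigma_finite_macro_intensity:
  assumes "0 < mu" shows "sigma_finite_measure (macro_intensity lm Pb mu)"
proof -
  interpret prob_space "measure_pmf (bernoulli_pmf Pb) \<Otimes>\<^sub>M exp_law mu"
    by (rule prob_space_macro_mark[OF assms])
  show ?thesis unfolding macro_intensity_def
    by (intro sigma_finite_pair_measure sigma_finite_lborel_const sigma_finite_measure_axioms)
qed

text \<open>Thinning as a mark: when idle stations contribute 0, the Bernoulli mark leaves only the
  busy value with weight \<open>Pb\<close>. In the exponent this produces the intensity
  \<open>lm * Pb\<close>.\<close>

lemma nn_integral_macro_intensity:
  assumes mu: "0 < mu" and Pb: "0 \<le> Pb" "Pb \<le> 1"
    and F: "F \<in> borel_measurable (borel \<Otimes>\<^sub>M (count_space UNIV \<Otimes>\<^sub>M borel))"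
    and idle: "\<And>y g. F (y, False, g) = 0"
  shows "(\<integral>\<^sup>+ p. F p \<partial>macro_intensity lm Pb mu)
    = (\<integral>\<^sup>+ y. ennreal lm * (ennreal Pb * (\<integral>\<^sup>+ g. F (y, True, g) \<partial>exp_law mu)) \<partial>lborel)"
proof -
  interpret E: prob_space "exp_law mu" by (rule prob_space_exp_law[OF mu])
  interpret BE: prob_space "measure_pmf (bernoulli_pmf Pb) \<Otimes>\<^sub>M exp_law mu"
    by (rule prob_space_macro_mark[OF mu])
  have F1 [measurable]: "F \<in> borel_measurable (density lborel (\<lambda>_. ennreal lm) \<Otimes>\<^sub>M (measure_pmf (bernoulli_pmf Pb) \<Otimes>\<^sub>M exp_law mu))"
    using F unfolding measurable_cong_sets[OF sets_macro_intensity[unfolded macro_intensity_def] refl] .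
  have F2 [measurable]: "(\<lambda>z. F (y, z)) \<in> borel_measurable (measure_pmf (bernoulli_pmf Pb) \<Otimes>\<^sub>M exp_law mu)" for y
    by measurable
  have "(\<integral>\<^sup>+ p. F p \<partial>macro_intensity lm Pb mu)
      = (\<integral>\<^sup>+ y. (\<integral>\<^sup>+ z. F (y, z) \<partial>(measure_pmf (bernoulli_pmf Pb) \<Otimes>\<^sub>M exp_law mu)) \<partial>density lborel (\<lambda>_. ennreal lm))"
    unfolding macro_intensity_def by (rule BE.nn_integral_fst[symmetric]) measurable
  also have "\<dots> = (\<integral>\<^sup>+ y. ennreal Pb * (\<integral>\<^sup>+ g. F (y, True, g) \<partial>exp_law mu) \<partial>density lborel (\<lambda>_. ennreal lm))"
  proof (rule nn_integral_cong)
    fix y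
    have "(\<integral>\<^sup>+ z. F (y, z) \<partial>(measure_pmf (bernoulli_pmf Pb) \<Otimes>\<^sub>M exp_law mu))
        = (\<integral>\<^sup>+ b. (\<integral>\<^sup>+ g. F (y, b, g) \<partial>exp_law mu) \<partial>measure_pmf (bernoulli_pmf Pb))"
      by (rule E.nn_integral_fst[symmetric]) measurable
    also have "\<dots> = ennreal Pb * (\<integral>\<^sup>+ g. F (y, True, g) \<partial>exp_law mu)"
      using Pb by (subst nn_integral_bernoulli_pmf) (auto simp: idle mult.commute)
    finally show "(\<integral>\<^sup>+ z. F (y, z) \<partial>(measure_pmf (bernoulli_pmf Pb) \<Otimes>\<^sub>M exp_law mu))
        = ennreal Pb * (\<integral>\<^sup>+ g. F (y, True, g) \<partial>exp_law mu)" .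
  qed
  also have "\<dots> = (\<integral>\<^sup>+ y. ennreal lm * (ennreal Pb * (\<integral>\<^sup>+ g. F (y, True, g) \<partial>exp_law mu)) \<partial>lborel)"
    by (rule nn_integral_density) measurable
  finally show ?thesis .
qed

lemma AE_pair_snd:
  assumes "sigma_finite_measure N" "AE y in N. P y"
  shows "AE x in M \<Otimes>\<^sub>M N. P (snd x)"
proof -
  interpret sigma_finite_measure N by fact
  obtain Z where Z: "{y \<in> space N. \<not> P y} \<subseteq> Z" "Z \<in> sets N" "emeasure N Z = 0"
    using assms(2) by (auto elim: AE_E)
  show ?thesis
  proof (rule AE_I)
    show "{x \<in> space (M \<Otimes>\<^sub>M N). \<not> P (snd x)} \<subseteq> space M \<times> Z"
      using Z(1) by (auto simp: space_pair_measure)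
    show "emeasure (M \<Otimes>\<^sub>M N) (space M \<times> Z) = 0"
      using Z by (subst emeasure_pair_measure_Times) auto
  qed (use Z in auto)
qed

lemma AE_macro_fading_pos:
  assumes "0 < mu"
  shows "AE p in macro_intensity lm Pb mu. 0 < snd (snd p)"
  unfolding macro_intensity_def
  using prob_space_exp_law[OF assms] prob_space_macro_mark[OF assms]
  by (intro AE_pair_snd AE_exp_law_pos)
    (auto intro: finite_measure.sigma_finite_measure prob_space.finite_measure
      simp: prob_space_imp_sigma_finite)

text \<open>A sublevel is a disk of area pi v times all marks. The rate involves \<open>lm\<close>
  without \<open>Pb\<close>, since idle stations also compete to be the nearest.\<close>

lemma ppp_height_macro:
  assumes ppp: "is_ppp M (macro_intensity lm Pb mu) Psim" and mu: "0 < mu" and lm: "0 < lm"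
  shows "ppp_height (distr M (config_space (macro_intensity lm Pb mu)) Psim) (macro_intensity lm Pb mu)
    (\<lambda>p. (norm (fst p))\<^sup>2) (pi * lm)"
proof (rule ppp_height.intro)
  interpret BE: prob_space "measure_pmf (bernoulli_pmf Pb) \<Otimes>\<^sub>M exp_law mu"
    by (rule prob_space_macro_mark[OF mu])
  show "is_ppp (distr M (config_space (macro_intensity lm Pb mu)) Psim) (macro_intensity lm Pb mu) (\<lambda>S. S)"
    by (rule is_ppp_distr[OF ppp])
  show "sigma_finite_measure (macro_intensity lm Pb mu)"
    by (rule sigma_finite_macro_intensity[OF mu])
  fix v :: real assume v: "0 \<le> v"
  have eq: "{x::(real^2) \<times> bool \<times> real. (norm (fst x))\<^sup>2 < v}
      = ball 0 (sqrt v) \<times> space (measure_pmf (bernoulli_pmf Pb) \<Otimes>\<^sub>M exp_law mu)"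
  proof (rule set_eqI)
    fix x :: "(real^2) \<times> bool \<times> real"
    have "(norm (fst x))\<^sup>2 < v \<longleftrightarrow> norm (fst x) < sqrt v"
      using real_sqrt_less_iff[of "(norm (fst x))\<^sup>2" v] by simp
    then show "x \<in> {x. (norm (fst x))\<^sup>2 < v} \<longleftrightarrow>
        x \<in> ball 0 (sqrt v) \<times> space (measure_pmf (bernoulli_pmf Pb) \<Otimes>\<^sub>M exp_law mu)"
      by (cases x) (simp add: space_pair_measure)
  qed
  have "emeasure (macro_intensity lm Pb mu) {x. (norm (fst x))\<^sup>2 < v}
      = emeasure (density lborel (\<lambda>_. ennreal lm)) (ball (0::real^2) (sqrt v))"
    unfolding eq macro_intensity_def
    by (subst BE.emeasure_pair_measure_Times) (auto simp: BE.emeasure_space_1)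
  also have "\<dots> = ennreal lm * emeasure lborel (ball (0::real^2) (sqrt v))"
    by (simp add: emeasure_density_const)
  also have "\<dots> = ennreal (pi * lm * v)"
    using v lm by (simp add: emeasure_ball unit_ball_vol_2 ac_simps flip: ennreal_mult')
  finally show "emeasure (macro_intensity lm Pb mu) {x. (norm (fst x))\<^sup>2 < v} = ennreal (pi * lm * v)" .
qed (use lm in auto)

definition macro_gain :: "real \<Rightarrow> real \<Rightarrow> (real^2) \<times> bool \<times> real \<Rightarrow> ennreal" where
  "macro_gain Pm alpha p = (if fst (snd p) then ennreal (Pm * snd (snd p) * norm (fst p) powr (- alpha)) else 0)"

lemma macro_gain_idle [simp]: "macro_gain Pm alpha (y, False, g) = 0"
  by (simp add: macro_gain_def)

lemma measurable_macro_gain [measurable]: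
  "macro_gain Pm alpha \<in> borel_measurable (borel \<Otimes>\<^sub>M (count_space UNIV \<Otimes>\<^sub>M borel))"
  unfolding macro_gain_def by measurable

text \<open>The factor k/(mu+k) at k = B mu T / A. In the macro tier A and B are the powers alpha of
  the interferer's and the serving distance; in the femto tier B is 1 and T is the argument of
  \<open>eta\<close>.\<close>

lemma fading_ratio:
  fixes A B mu T :: real
  assumes "0 < A" "0 < B" "0 < mu" "0 < T"
  shows "B * (mu * T) / A / (mu + B * (mu * T) / A) = 1 / (1 + (1 / T) * (A / B))"
proof -
  have "mu + B * (mu * T) / A = mu * (A + B * T) / A" "1 + (1 / T) * (A / B) = (A + B * T) / (B * T)"
    using assms by (simp_all add: field_simps)
  then have "B * (mu * T) / A / (mu + B * (mu * T) / A) = (mu * (B * T)) / (mu * (A + B * T))"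
    "1 / (1 + (1 / T) * (A / B)) = B * T / (A + B * T)"
    using assms by simp_all
  then show ?thesis using assms by simp
qed

text \<open>Averaging over the fading leaves a function of the squared distance alone, so the planar
  integral becomes a multiple of \<open>varphi\<close>. The transmit power in the gain cancels
  against \<open>mu * T / Pm\<close>.\<close>

lemma nn_integral_macro_gain:
  assumes alpha: "2 < alpha" and mu: "0 < mu" and Pm: "0 < Pm" and lm: "0 < lm" and Pb: "0 \<le> Pb" "Pb \<le> 1"
    and T: "0 < T" and v: "0 < v"
  shows "(\<integral>\<^sup>+ p. ennreal (1 - lexp (ennreal (v powr (alpha / 2)) *
        (if v \<le> (norm (fst p))\<^sup>2 then ennreal (mu * T / Pm) * macro_gain Pm alpha p else 0))) \<partial>macro_intensity lm Pb mu)
    = ennreal (pi * v * (lm * Pb) * varphi T alpha)"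
proof -
  \<comment> \<open>\<open>F\<close> is the fading-averaged loss at squared distance
    \<open>w\<close>; the indicator removes the disk inside the serving distance.\<close>
  define F where "F w = ennreal (1 / (1 + (1 / T) * (w / v) powr (alpha / 2))) * indicator {v..} w" for w
  have [measurable]: "F \<in> borel_measurable borel" unfolding F_def by measurable
  have inner: "(\<integral>\<^sup>+ g. ennreal (1 - lexp (ennreal (v powr (alpha / 2)) *
        (if v \<le> (norm y)\<^sup>2 then ennreal (mu * T / Pm) * macro_gain Pm alpha (y, True, g) else 0))) \<partial>exp_law mu)
     = F ((norm y)\<^sup>2)" for y :: "real^2"
  proof (cases "v \<le> (norm y)\<^sup>2")
    case True
    define k where "k = v powr (alpha / 2) * (mu * T) * norm y powr (- alpha)"
    have y: "0 < norm y" using True v by auto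
    have k: "0 < k" using y v mu T by (simp add: k_def)
    have "ennreal (v powr (alpha / 2)) * (ennreal (mu * T / Pm) * macro_gain Pm alpha (y, True, g)) = ennreal (k * g)" for g
    proof -
      have "ennreal (v powr (alpha / 2)) * (ennreal (mu * T / Pm) * macro_gain Pm alpha (y, True, g))
          = ennreal (v powr (alpha / 2) * (mu * T / Pm * (Pm * g * norm y powr (- alpha))))"
        using mu T Pm by (simp add: macro_gain_def ennreal_mult'[symmetric])
      also have "v powr (alpha / 2) * (mu * T / Pm * (Pm * g * norm y powr (- alpha))) = k * g"
        using Pm by (simp add: k_def)
      finally show ?thesis .
    qed
    then have "(\<integral>\<^sup>+ g. ennreal (1 - lexp (ennreal (v powr (alpha / 2)) *
        (if v \<le> (norm y)\<^sup>2 then ennreal (mu * T / Pm) * macro_gain Pm alpha (y, True, g) else 0))) \<partial>exp_law mu)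
      = ennreal (k / (mu + k))"
      using True nn_integral_exp_law_laplace[OF mu less_imp_le[OF k]] by simp
    also have "k / (mu + k) = 1 / (1 + (1 / T) * ((norm y)\<^sup>2 / v) powr (alpha / 2))"
    proof -
      have "((norm y)\<^sup>2 / v) powr (alpha / 2) = norm y powr alpha / v powr (alpha / 2)"
        using y v by (simp add: powr_divide powr_powr flip: powr_numeral)
      moreover have "k = v powr (alpha / 2) * (mu * T) / norm y powr alpha"
        by (simp add: k_def powr_minus_divide)
      ultimately show ?thesis using fading_ratio[of "norm y powr alpha" "v powr (alpha / 2)" mu T] y v mu T
        by simp
    qed
    finally show ?thesis using True by (simp add: F_def)
  qed (simp add: F_def)
  have "(\<integral>\<^sup>+ p. ennreal (1 - lexp (ennreal (v powr (alpha / 2)) *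
        (if v \<le> (norm (fst p))\<^sup>2 then ennreal (mu * T / Pm) * macro_gain Pm alpha p else 0))) \<partial>macro_intensity lm Pb mu)
     = (\<integral>\<^sup>+ (y::real^2). ennreal lm * (ennreal Pb * F ((norm y)\<^sup>2)) \<partial>lborel)"
  proof (subst nn_integral_macro_intensity[OF mu Pb])
    show "(\<lambda>p. ennreal (1 - lexp (ennreal (v powr (alpha / 2)) *
        (if v \<le> (norm (fst p))\<^sup>2 then ennreal (mu * T / Pm) * macro_gain Pm alpha p else 0))))
      \<in> borel_measurable (borel \<Otimes>\<^sub>M (count_space UNIV \<Otimes>\<^sub>M borel))" by measurable
  qed (simp_all only: inner fst_conv macro_gain_idle mult_zero_right if_cancel lexp_zero diff_self ennreal_0)
  also have "\<dots> = ennreal (lm * Pb) * (\<integral>\<^sup>+ (y::real^2). F ((norm y)\<^sup>2) \<partial>lborel)"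
    using lm Pb by (subst nn_integral_cmult[symmetric]) (auto simp: ennreal_mult ac_simps)
  also have "(\<integral>\<^sup>+ (y::real^2). F ((norm y)\<^sup>2) \<partial>lborel) = ennreal pi * (\<integral>\<^sup>+ w. F w * indicator {0..} w \<partial>lborel)"
    by (rule nn_integral_norm_sq) measurable
  also have "(\<integral>\<^sup>+ w. F w * indicator {0..} w \<partial>lborel) = (\<integral>\<^sup>+ w. F w \<partial>lborel)"
    using v by (intro nn_integral_cong) (auto simp: F_def split: split_indicator)
  also have "\<dots> = ennreal (v * varphi T alpha)"
    unfolding F_def by (rule nn_integral_varphi[OF alpha T v])
  finally show ?thesis
    using lm Pb v varphi_nonneg[of T alpha] by (simp add: ac_simps flip: ennreal_mult')
qed

locale macro_process =
  fixes P :: "((real^2) \<times> bool \<times> real) set measure" and lm Pb mu Pm alpha :: real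
  assumes P: "ppp_height P (macro_intensity lm Pb mu) (\<lambda>p. (norm (fst p))\<^sup>2) (pi * lm)"
    and alpha: "2 < alpha" and mu: "0 < mu" and Pm: "0 < Pm" and lm: "0 < lm" and Pb: "0 < Pb" "Pb \<le> 1"
begin

sublocale ppp_height P "macro_intensity lm Pb mu" "\<lambda>p. (norm (fst p))\<^sup>2" "pi * lm"
  by (rule P)

abbreviation "J \<equiv> above (macro_gain Pm alpha)"

text \<open>The constant \<kappa> later absorbs noise and femto interference, which are fixed from
  the point of view of this tier.\<close>

lemma nn_integral_macro_laplace:
  assumes T: "0 < T" and \<kappa>: "0 \<le> \<kappa>"
  shows "(\<integral>\<^sup>+ S. ennreal (exp (- (\<kappa> * hmin S powr (alpha / 2))) *
        lexp (ennreal (hmin S powr (alpha / 2)) * (ennreal (mu * T / Pm) * J S))) \<partial>P)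
    = (\<integral>\<^sup>+ v. ennreal (exponential_density (pi * lm) v * (exp (- (\<kappa> * v powr (alpha / 2))) *
        exp (- (pi * v * (lm * Pb) * varphi T alpha)))) \<partial>lborel)"
proof -
  have ab: "above (\<lambda>p. ennreal (mu * T / Pm) * macro_gain Pm alpha p) S = ennreal (mu * T / Pm) * J S" for S
    unfolding above_def psum_cmult[symmetric] by (rule psum_cong) simp
  show ?thesis unfolding ab[symmetric]
  proof (rule nn_integral_lexp_above)
    show "(\<lambda>p. ennreal (mu * T / Pm) * macro_gain Pm alpha p) \<in> borel_measurable (macro_intensity lm Pb mu)"
      by measurable
    show "continuous_on {0<..} (\<lambda>v. exp (- (\<kappa> * v powr (alpha / 2))))"
      by (intro continuous_intros) auto
    show "continuous_on {0<..} (\<lambda>v. exp (- (pi * v * (lm * Pb) * varphi T alpha)))"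
      by (intro continuous_intros)
    fix v :: real assume v: "0 < v"
    show "lexp (\<integral>\<^sup>+ p. ennreal (1 - lexp (ennreal (v powr (alpha / 2)) *
        (if v \<le> (norm (fst p))\<^sup>2 then ennreal (mu * T / Pm) * macro_gain Pm alpha p else 0))) \<partial>macro_intensity lm Pb mu)
       = exp (- (pi * v * (lm * Pb) * varphi T alpha))"
      using Pb lm v varphi_nonneg[of T alpha]
      by (subst nn_integral_macro_gain[OF alpha mu Pm lm _ _ T v]) (auto simp: lexp_ennreal)
  qed (use \<kappa> in auto)
qed

text \<open>The cutoff at \<open>hmin S\<close> is random, so finiteness is shown for the countably
  many fixed cutoffs 1/(n+1), one of which lies below \<open>hmin S\<close>.\<close>

lemma AE_J_finite: "AE S in P. J S < \<top>"
proof -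
  have "AE S in P. psum (\<lambda>p. if 1 / real (Suc n) \<le> (norm (fst p))\<^sup>2 then macro_gain Pm alpha p else 0) S < \<top>" for n
  proof (rule ppp_AE_psum_finite[OF ppp sf sp])
    define v where "v = 1 / real (Suc n)"
    have v: "0 < v" by (simp add: v_def)
    \<comment> \<open>This \<open>T\<close> makes the product of \<open>v powr (alpha / 2)\<close>
      and \<open>mu * T / Pm\<close> equal to 1, so the exponent computed for the transform can be
      reused.\<close>
    define T where "T = Pm / (mu * v powr (alpha / 2))"
    have T: "0 < T" using Pm mu v by (simp add: T_def)
    have "ennreal (v powr (alpha / 2)) * ennreal (mu * T / Pm) = 1"
      using Pm mu v by (simp add: T_def flip: ennreal_mult')
    then have "(\<integral>\<^sup>+ p. ennreal (1 - lexp (if v \<le> (norm (fst p))\<^sup>2 then macro_gain Pm alpha p else 0)) \<partial>macro_intensity lm Pb mu)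
        = (\<integral>\<^sup>+ p. ennreal (1 - lexp (ennreal (v powr (alpha / 2)) *
        (if v \<le> (norm (fst p))\<^sup>2 then ennreal (mu * T / Pm) * macro_gain Pm alpha p else 0))) \<partial>macro_intensity lm Pb mu)"
      by (intro nn_integral_cong) (simp add: mult.assoc[symmetric])
    also have "\<dots> < \<top>"
      using Pb by (subst nn_integral_macro_gain[OF alpha mu Pm lm _ _ T v]) auto
    finally show "(\<integral>\<^sup>+ p. ennreal (1 - lexp (if 1 / real (Suc n) \<le> (norm (fst p))\<^sup>2 then macro_gain Pm alpha p else 0))
        \<partial>macro_intensity lm Pb mu) < \<top>" by (simp add: v_def)
  qed (auto simp: macro_gain_def intro!: AE_I2)
  then have "AE S in P. \<forall>n. psum (\<lambda>p. if 1 / real (Suc n) \<le> (norm (fst p))\<^sup>2 then macro_gain Pm alpha p else 0) S < \<top>"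
    by (simp add: AE_all_countable)
  with AE_hmin_attained show ?thesis
  proof eventually_elim
    case (elim S)
    then have "0 < hmin S" by blast
    then obtain n where n: "1 / real (Suc n) < hmin S"
      using reals_Archimedean by (auto simp: inverse_eq_divide)
    have "J S \<le> psum (\<lambda>p. if 1 / real (Suc n) \<le> (norm (fst p))\<^sup>2 then macro_gain Pm alpha p else 0) S"
      unfolding above_def using n by (intro psum_mono) auto
    also have "\<dots> < \<top>" using elim(2) by blast
    finally show ?case .
  qed
qed

lemma AE_fading_pos: "AE S in P. \<forall>p\<in>S. 0 < snd (snd p)"
  by (rule ppp_AE_ball[OF ppp AE_macro_fading_pos[OF mu] sp])

text \<open>Keeps the denominator of the SINR positive even without noise. Busy stations beyond
  every integer level have infinite mass, hence exist almost surely, and some such level exceeds the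
  lowest one.\<close>

lemma AE_J_pos: "AE S in P. 0 < J S"
proof -
  have "AE S in P. S \<inter> {p. real n \<le> (norm (fst p))\<^sup>2 \<and> fst (snd p)} \<noteq> {}" for n :: nat
  proof (rule ppp_AE_meets[OF ppp sf sp])
    let ?B = "{p::(real^2) \<times> bool \<times> real. real n \<le> (norm (fst p))\<^sup>2 \<and> fst (snd p)}"
    have "{p \<in> space (macro_intensity lm Pb mu). real n \<le> (norm (fst p))\<^sup>2 \<and> fst (snd p)} \<in> sets (macro_intensity lm Pb mu)"
      by measurable
    then show B: "?B \<in> sets (macro_intensity lm Pb mu)" by simp
    interpret E: prob_space "exp_law mu" by (rule prob_space_exp_law[OF mu])
    have "emeasure (macro_intensity lm Pb mu) ?B = (\<integral>\<^sup>+ p. indicator ?B p \<partial>macro_intensity lm Pb mu)"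
      using B by simp
    also have "\<dots> = (\<integral>\<^sup>+ (y::real^2). ennreal lm * (ennreal Pb * indicator {real n..} ((norm y)\<^sup>2)) \<partial>lborel)"
    proof (subst nn_integral_macro_intensity[OF mu])
      show "(\<integral>\<^sup>+ y. ennreal lm * (ennreal Pb * (\<integral>\<^sup>+ g. indicator ?B (y, True, g) \<partial>exp_law mu)) \<partial>lborel)
          = (\<integral>\<^sup>+ (y::real^2). ennreal lm * (ennreal Pb * indicator {real n..} ((norm y)\<^sup>2)) \<partial>lborel)"
      proof (intro nn_integral_cong)
        fix y :: "real^2"
        have "(\<integral>\<^sup>+ g. indicator ?B (y, True, g) \<partial>exp_law mu)
            = (\<integral>\<^sup>+ g. indicator {real n..} ((norm y)\<^sup>2) \<partial>exp_law mu)"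
          by (intro nn_integral_cong) (auto simp: indicator_def)
        then show "ennreal lm * (ennreal Pb * (\<integral>\<^sup>+ g. indicator ?B (y, True, g) \<partial>exp_law mu))
            = ennreal lm * (ennreal Pb * indicator {real n..} ((norm y)\<^sup>2))"
          using E.emeasure_space_1 by simp
      qed
      show "indicator ?B \<in> borel_measurable (borel \<Otimes>\<^sub>M (count_space UNIV \<Otimes>\<^sub>M borel))"
        using B unfolding sets_macro_intensity by measurable
    qed (use Pb in auto)
    also have "\<dots> = ennreal lm * (ennreal Pb * (\<integral>\<^sup>+ (y::real^2). indicator {real n..} ((norm y)\<^sup>2) \<partial>lborel))"
      by (simp add: nn_integral_cmult)
    also have "(\<integral>\<^sup>+ (y::real^2). indicator {real n..} ((norm y)\<^sup>2) \<partial>lborel)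
        = ennreal pi * (\<integral>\<^sup>+ w. indicator {real n..} w * indicator {0..} w \<partial>lborel)"
      by (rule nn_integral_norm_sq) measurable
    also have "(\<integral>\<^sup>+ w. indicator {real n..} w * indicator {0..} w \<partial>lborel) = (\<integral>\<^sup>+ w. indicator {real n..} w \<partial>lborel)"
      by (intro nn_integral_cong) (auto split: split_indicator)
    also have "\<dots> = \<top>"
      by (simp add: emeasure_lborel_atLeast)
    finally show "emeasure (macro_intensity lm Pb mu) ?B = \<infinity>"
      using lm Pb by (simp only: ennreal_mult_top ennreal_eq_0_iff infinity_ennreal_def not_le pi_gt_zero refl if_False)
        (simp add: ennreal_mult_top pi_gt_zero not_le)
  qed
  then have "AE S in P. \<forall>n::nat. S \<inter> {p. real n \<le> (norm (fst p))\<^sup>2 \<and> fst (snd p)} \<noteq> {}"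
    by (simp add: AE_all_countable)
  with AE_fading_pos AE_hmin_attained show ?thesis
  proof eventually_elim
    case (elim S)
    obtain n :: nat where n: "hmin S < real n" using reals_Archimedean2 by blast
    obtain p where p: "p \<in> S" "real n \<le> (norm (fst p))\<^sup>2" "fst (snd p)" using elim(3) by blast
    have "0 < hmin S" using elim(2) by blast
    then have "0 < (norm (fst p))\<^sup>2" using n p(2) by linarith
    then have "0 < norm (fst p)" by auto
    then have "0 < macro_gain Pm alpha p" using p elim(1) Pm by (simp add: macro_gain_def)
    also have "\<dots> = (if hmin S < (norm (fst p))\<^sup>2 then macro_gain Pm alpha p else 0)"
      using n p(2) by simp
    also have "\<dots> \<le> J S"
      unfolding above_def by (rule psum_ge_point[OF p(1)])
    finally show ?case .
  qed
qed

text \<open>Injectivity of the squared norm on marked points excludes ties in distance as well as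
  two marks at one location. The choice in \<open>nearest\<close> is thus forced, and dropping the
  serving location means keeping the points strictly above the lowest level.\<close>

lemma AE_serving_interf:
  "AE S in P. 0 < hmin S \<and> (norm (serving_bs S))\<^sup>2 = hmin S \<and> interf_m Pm alpha S = enn2real (J S)"
  using AE_hmin_attained AE_inj_on AE_fading_pos
proof eventually_elim
  case (elim S)
  then obtain x where x: "x \<in> S" "(norm (fst x))\<^sup>2 = hmin S" "0 < hmin S"
    and min: "\<And>y. y \<in> S \<Longrightarrow> hmin S \<le> (norm (fst y))\<^sup>2" by blast
  have uniq: "p = x" if "p \<in> S" "(norm (fst p))\<^sup>2 \<le> hmin S" for p
  proof -
    have "(norm (fst p))\<^sup>2 = (norm (fst x))\<^sup>2"
      unfolding x(2) using that(2) min[OF that(1)] by (rule antisym)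
    from inj_onD[OF elim(2) this that(1) x(1)] show ?thesis .
  qed
  have serving: "serving_bs S = fst x"
    unfolding serving_bs_def nearest_def
  proof (rule some_equality)
    have "norm (fst x) \<le> norm (fst z)" if "z \<in> S" for z
      by (rule power2_le_imp_le) (use min[OF that] x(2) in simp_all)
    then show "fst x \<in> fst ` S \<and> (\<forall>z\<in>fst ` S. norm (fst x) \<le> norm z)" using x(1) by auto
    fix y assume y: "y \<in> fst ` S \<and> (\<forall>z\<in>fst ` S. norm y \<le> norm z)"
    then obtain p where p: "p \<in> S" "y = fst p" by auto
    have "norm (fst p) \<le> norm (fst x)" using y p x(1) by auto
    then have "(norm (fst p))\<^sup>2 \<le> hmin S" using power_mono[of "norm (fst p)" "norm (fst x)" 2] x(2) by simp
    then show "y = fst x" using uniq p by auto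
  qed
  have cond: "fst p \<noteq> serving_bs S \<longleftrightarrow> hmin S < (norm (fst p))\<^sup>2" if "p \<in> S" for p
    using uniq[OF that] x(2) unfolding serving by (cases "p = x") (auto simp flip: not_le)
  have nn: "0 \<le> (\<lambda>(y, busy, g). Pm * g * norm y powr (- alpha)) p"
    if "p \<in> {p \<in> S. fst (snd p) \<and> fst p \<noteq> serving_bs S}" for p
    using that elim(3) Pm by (auto simp: case_prod_beta less_imp_le)
  have "interf_m Pm alpha S = enn2real (psum (\<lambda>p. ennreal ((\<lambda>(y, busy, g). Pm * g * norm y powr (- alpha)) p))
      {p \<in> S. fst (snd p) \<and> fst p \<noteq> serving_bs S})"
    unfolding interf_m_def by (rule infsum_eq_psum) (rule nn)
  also have "psum (\<lambda>p. ennreal ((\<lambda>(y, busy, g). Pm * g * norm y powr (- alpha)) p))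
      {p \<in> S. fst (snd p) \<and> fst p \<noteq> serving_bs S} = J S"
    unfolding psum_restrict above_def using cond
    by (intro psum_cong) (auto simp: macro_gain_def case_prod_beta)
  finally show ?case using x serving by simp
qed

end

section \<open>The femto tier\<close>

lemma psum_finite: "finite S \<Longrightarrow> psum f S = (\<Sum>x\<in>S. f x)"
  unfolding psum_def by (rule nn_integral_count_space_finite)

lemma sets_config_space_finite:
  assumes "space X = UNIV" shows "{S. finite S} \<in> sets (config_space X)"
proof -
  have "UNIV \<in> sets X" using sets.top[of X] assms by simp
  have "{S. finite S} = (\<Union>n. {S. finite (S \<inter> UNIV) \<and> card (S \<inter> UNIV) = n})" by auto
  also have "\<dots> \<in> sets (config_space X)"
    using sets_config_space_card[OF \<open>UNIV \<in> sets X\<close>] by (intro sets.countable_UN) auto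
  finally show ?thesis .
qed

text \<open>Complements are handled by subtraction, which is why the functional is cut off on infinite
  configurations.\<close>
lemma measurable_psum_pair:
  assumes k: "k \<in> borel_measurable (N \<Otimes>\<^sub>M X)" and sp: "space X = UNIV"
  shows "(\<lambda>z. if finite (snd z) then psum (\<lambda>p. k (fst z, p)) (snd z) else 0)
    \<in> borel_measurable (N \<Otimes>\<^sub>M config_space X)"
proof -
  define \<Phi> where "\<Phi> k z = (if finite (snd z) then psum (\<lambda>p. k (fst z, p)) (snd z) else 0)"
    for k :: "'a \<times> 'b \<Rightarrow> ennreal" and z :: "'a \<times> 'b set"
  have fin [measurable]: "{z \<in> space (N \<Otimes>\<^sub>M config_space X). finite (snd z)} \<in> sets (N \<Otimes>\<^sub>M config_space X)"
  proof -
    have "{z \<in> space (N \<Otimes>\<^sub>M config_space X). finite (snd z)} = snd -` {S. finite S} \<inter> space (N \<Otimes>\<^sub>M config_space X)"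
      by auto
    then show ?thesis using measurable_sets[OF measurable_snd sets_config_space_finite[OF sp], of N] by simp
  qed
  have ind: "\<Phi> (indicator A) \<in> borel_measurable (N \<Otimes>\<^sub>M config_space X)" if A: "A \<in> sets (N \<Otimes>\<^sub>M X)" for A
  proof -
    show ?thesis
      using Int_stable_pair_measure_generator pair_measure_closed A unfolding sets_pair_measure
    proof (induction rule: sigma_sets_induct_disjoint)
      case (basic A)
      then obtain a b where ab: "A = a \<times> b" "a \<in> sets N" "b \<in> sets X" by auto
      have [measurable]: "psum (indicator b) \<in> borel_measurable (config_space X)"
        by (rule borel_measurable_psum[OF _ sp]) (use ab in measurable)
      have "\<Phi> (indicator A) = (\<lambda>z. if finite (snd z) then indicator a (fst z) * psum (indicator b) (snd z) else 0)"
        unfolding \<Phi>_def psum_cmult[symmetric] ab(1)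
        by (intro ext if_cong refl psum_cong) (auto split: split_indicator)
      also have "\<dots> \<in> borel_measurable (N \<Otimes>\<^sub>M config_space X)"
        using ab(2) fin by measurable
      finally show ?case .
    next
      case empty
      show ?case by (simp add: \<Phi>_def cong: if_cong)
    next
      case (compl A)
      have one: "\<Phi> (\<lambda>_. 1) \<in> borel_measurable (N \<Otimes>\<^sub>M config_space X)"
      proof -
        have [measurable]: "psum (\<lambda>_. 1) \<in> borel_measurable (config_space X)"
          by (rule borel_measurable_psum[OF _ sp]) measurable
        show ?thesis unfolding \<Phi>_def using fin by measurable
      qed
      have eq: "\<Phi> (indicator (space N \<times> space X - A)) z = \<Phi> (\<lambda>_. 1) z - \<Phi> (indicator A) z"
        if z: "z \<in> space (N \<Otimes>\<^sub>M config_space X)" for z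
      proof (cases "finite (snd z)")
        case True
        have x: "fst z \<in> space N" using z by (auto simp: space_pair_measure)
        have "psum (\<lambda>_. 1) (snd z) = psum (\<lambda>p. indicator (space N \<times> space X - A) (fst z, p) + indicator A (fst z, p)) (snd z)"
          using x sp by (intro psum_cong) (auto split: split_indicator)
        also have "\<dots> = psum (\<lambda>p. indicator (space N \<times> space X - A) (fst z, p)) (snd z) + psum (\<lambda>p. indicator A (fst z, p)) (snd z)"
          by (rule psum_add)
        finally have "psum (\<lambda>_. 1) (snd z) - psum (\<lambda>p. indicator A (fst z, p)) (snd z)
            = psum (\<lambda>p. indicator (space N \<times> space X - A) (fst z, p)) (snd z)"
        proof -
          assume *: "psum (\<lambda>_. 1) (snd z) = psum (\<lambda>p. indicator (space N \<times> space X - A) (fst z, p)) (snd z)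
              + psum (\<lambda>p. indicator A (fst z, p)) (snd z)"
          have "psum (\<lambda>p. indicator A (fst z, p)) (snd z) \<noteq> \<top>"
            using True by (simp add: psum_finite[OF True] indicator_def)
          then show ?thesis unfolding * by (rule ennreal_add_diff_cancel_right)
        qed
        then show ?thesis using True by (simp add: \<Phi>_def)
      qed (simp add: \<Phi>_def)
      have "(\<lambda>z. \<Phi> (\<lambda>_. 1) z - \<Phi> (indicator A) z) \<in> borel_measurable (N \<Otimes>\<^sub>M config_space X)"
        using one compl(2) by measurable
      then show ?case
        by (rule measurable_cong[THEN iffD2, rotated]) (rule eq)
    next
      case (union A)
      have "\<Phi> (indicator (\<Union>i. A i)) = (\<lambda>z. \<Sum>i. \<Phi> (indicator (A i)) z)"
      proof
        fix z
        have "(\<integral>\<^sup>+ p. indicator (\<Union>i. A i) (fst z, p) \<partial>count_space (snd z))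
           = (\<integral>\<^sup>+ p. (\<Sum>i. indicator (A i) (fst z, p)) \<partial>count_space (snd z))"
          using union(1) by (simp add: suminf_indicator)
        also have "\<dots> = (\<Sum>i. \<integral>\<^sup>+ p. indicator (A i) (fst z, p) \<partial>count_space (snd z))"
          by (rule nn_integral_suminf) simp
        finally show "\<Phi> (indicator (\<Union>i. A i)) z = (\<Sum>i. \<Phi> (indicator (A i)) z)"
          by (simp add: \<Phi>_def psum_def)
      qed
      then show ?case using union(3) by simp
    qed
  qed
  have "\<Phi> k \<in> borel_measurable (N \<Otimes>\<^sub>M config_space X)"
    using k
  proof induction
    case (cong f g)
    have "\<Phi> f z = \<Phi> g z" if "z \<in> space (N \<Otimes>\<^sub>M config_space X)" for z
      unfolding \<Phi>_def using cong(3) that sp by (intro if_cong refl psum_cong) (auto simp: space_pair_measure)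
    then show ?case using cong(4) by (subst measurable_cong) auto
  next
    case (set A)
    then show ?case by (rule ind)
  next
    case (mult u c)
    have "\<Phi> (\<lambda>x. c * u x) = (\<lambda>z. c * \<Phi> u z)" by (auto simp: \<Phi>_def psum_cmult)
    then show ?case using mult(4) by simp
  next
    case (add u v)
    have "\<Phi> (\<lambda>x. v x + u x) = (\<lambda>z. \<Phi> v z + \<Phi> u z)" by (auto simp: \<Phi>_def psum_add)
    then show ?case using add by simp
  next
    case (seq U)
    have eq: "\<Phi> (Sup (range U)) = (\<lambda>z. SUP i. \<Phi> (U i) z)"
    proof
      fix z :: "'a \<times> 'b set"
      have "incseq (\<lambda>i p. U i (fst z, p))" using seq(3) by (auto simp: incseq_def le_fun_def)
      from psum_SUP[OF this, of "snd z"]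
      show "\<Phi> (Sup (range U)) z = (SUP i. \<Phi> (U i) z)"
        by (simp add: \<Phi>_def SUP_apply image_image)
    qed
    show ?case unfolding eq using seq by (intro borel_measurable_SUP) auto
  qed
  then show ?thesis unfolding \<Phi>_def .
qed

section \<open>Fading-marked clusters and the function eta\<close>

lemma sets_cluster_intensity [measurable_cong]:
  "sets (cluster_intensity lc Rc mu) = sets (borel \<Otimes>\<^sub>M borel)"
  unfolding cluster_intensity_def by (intro sets_pair_measure_cong) auto

lemma space_cluster_intensity [simp]: "space (cluster_intensity lc Rc mu) = UNIV"
  by (simp add: cluster_intensity_def space_pair_measure)

lemma cball_borel [measurable]: "cball (a::'b::metric_space) r \<in> sets borel"
  by (rule borel_closed) simp

lemma finite_measure_disk: "finite_measure (density lborel (\<lambda>y::real^2. ennreal lc * indicator (cball 0 Rc) y))"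
proof
  have "emeasure lborel (cball (0::real^2) Rc) < \<infinity>" by (rule emeasure_lborel_cball_finite)
  then show "emeasure (density lborel (\<lambda>y::real^2. ennreal lc * indicator (cball 0 Rc) y))
      (space (density lborel (\<lambda>y::real^2. ennreal lc * indicator (cball 0 Rc) y))) \<noteq> \<infinity>"
    using nn_integral_cmult_indicator[of "cball (0::real^2) Rc" lborel "ennreal lc"]
    by (simp add: emeasure_density ennreal_mult_eq_top_iff)
qed

lemma sigma_finite_cluster_intensity:
  "0 < mu \<Longrightarrow> sigma_finite_measure (cluster_intensity lc Rc mu)"
  unfolding cluster_intensity_def
  by (intro sigma_finite_pair_measure finite_measure.sigma_finite_measure finite_measure_disk
      prob_space.finite_measure prob_space_exp_law)

lemma emeasure_cluster_intensity_UNIV: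
  assumes "0 < mu" shows "emeasure (cluster_intensity lc Rc mu) UNIV < \<infinity>"
proof -
  interpret E: prob_space "exp_law mu" by (rule prob_space_exp_law[OF assms])
  interpret D: finite_measure "density lborel (\<lambda>y::real^2. ennreal lc * indicator (cball 0 Rc) y)"
    by (rule finite_measure_disk)
  have "emeasure (cluster_intensity lc Rc mu) (UNIV \<times> space (exp_law mu))
      = emeasure (density lborel (\<lambda>y::real^2. ennreal lc * indicator (cball 0 Rc) y)) UNIV"
    unfolding cluster_intensity_def by (subst E.emeasure_pair_measure_Times) (auto simp: E.emeasure_space_1[simplified])
  then show ?thesis by (simp add: less_top[symmetric])
qed

lemma nn_integral_cluster_intensity:
  assumes mu: "0 < mu" and F [measurable]: "F \<in> borel_measurable (borel \<Otimes>\<^sub>M borel)"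
  shows "(\<integral>\<^sup>+ p. F p \<partial>cluster_intensity lc Rc mu)
    = (\<integral>\<^sup>+ y. ennreal lc * indicator (cball 0 Rc) y * (\<integral>\<^sup>+ g. F (y, g) \<partial>exp_law mu) \<partial>lborel)"
proof -
  interpret E: prob_space "exp_law mu" by (rule prob_space_exp_law[OF mu])
  have "F \<in> borel_measurable (cluster_intensity lc Rc mu)" by measurable
  then have "(\<integral>\<^sup>+ p. F p \<partial>cluster_intensity lc Rc mu)
      = (\<integral>\<^sup>+ y. (\<integral>\<^sup>+ g. F (y, g) \<partial>exp_law mu) \<partial>density lborel (\<lambda>y. ennreal lc * indicator (cball 0 Rc) y))"
    unfolding cluster_intensity_def by (rule E.nn_integral_fst[symmetric])
  also have "\<dots> = (\<integral>\<^sup>+ y. ennreal lc * indicator (cball 0 Rc) y * (\<integral>\<^sup>+ g. F (y, g) \<partial>exp_law mu) \<partial>lborel)"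
    by (rule nn_integral_density) measurable
  finally show ?thesis .
qed

text \<open>The integral inside \<open>eta\<close> in \<open>ennreal\<close> form, to which Tonelli
  applies without integrability conditions.\<close>

definition disk_loss :: "real \<Rightarrow> real \<Rightarrow> real \<Rightarrow> real^2 \<Rightarrow> ennreal" where
  "disk_loss Rc alpha s x = (\<integral>\<^sup>+ y. indicator (cball 0 Rc) y * ennreal (1 / (1 + (1 / s) * norm (x + y) powr alpha)) \<partial>lborel)"

lemma measurable_disk_loss [measurable]: "disk_loss Rc alpha s \<in> borel_measurable borel"
  unfolding disk_loss_def by measurable

text \<open>The integrand is at most 1 on a bounded disk, so the set integral in \<open>eta\<close>
  is a genuine one and agrees with the \<open>ennreal\<close> integral.\<close>

lemma eta_eq_lexp:
  assumes s: "0 < s" and lc: "0 \<le> lc"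
  shows "eta lc Rc alpha s x = lexp (ennreal lc * disk_loss Rc alpha s x)"
proof -
  let ?f = "\<lambda>y. 1 / (1 + (1 / s) * norm (x + y) powr alpha)"
  have f01: "0 \<le> ?f y" "?f y \<le> 1" for y
    using s by (auto intro!: divide_nonneg_nonneg add_nonneg_nonneg simp: divide_le_eq_1 add_pos_nonneg)
  have e: "disk_loss Rc alpha s x = (\<integral>\<^sup>+ y. ennreal (indicator (cball 0 Rc) y *\<^sub>R ?f y) \<partial>lborel)"
    unfolding disk_loss_def by (intro nn_integral_cong) (auto split: split_indicator)
  have "(\<integral>\<^sup>+ y. ennreal (indicator (cball 0 Rc) y *\<^sub>R ?f y) \<partial>lborel) \<le> (\<integral>\<^sup>+ (y::real^2). indicator (cball 0 Rc) y \<partial>lborel)"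
    using f01 by (intro nn_integral_mono) (auto split: split_indicator)
  also have "\<dots> < \<infinity>" by (simp add: emeasure_lborel_cball_finite[simplified])
  finally have "integrable lborel (\<lambda>y. indicator (cball 0 Rc) y *\<^sub>R ?f y)"
    using f01 by (intro integrableI_nonneg) (auto simp: split: split_indicator)
  then have "disk_loss Rc alpha s x = ennreal (set_lebesgue_integral lborel (cball 0 Rc) ?f)"
    unfolding e set_lebesgue_integral_def using f01
    by (intro nn_integral_eq_integral) (auto split: split_indicator)
  moreover have "0 \<le> set_lebesgue_integral lborel (cball 0 Rc) ?f"
    unfolding set_lebesgue_integral_def using f01 by (intro Bochner_Integration.integral_nonneg) (auto split: split_indicator)
  ultimately show ?thesis
    using lc by (simp add: eta_def lexp_ennreal flip: ennreal_mult')
qed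

lemma measurable_eta [measurable]:
  "0 < s \<Longrightarrow> 0 \<le> lc \<Longrightarrow> eta lc Rc alpha s \<in> borel_measurable borel"
  by (subst measurable_cong[OF eta_eq_lexp]) auto

text \<open>\<open>1 - eta\<close> is at most \<open>lc * disk_loss\<close>. After exchanging the
  integrals, translation invariance separates the path loss over the plane from the area of the
  disk, both finite. So the Bochner integral is not a default value.\<close>

lemma nn_integral_one_minus_eta:
  assumes alpha: "2 < alpha" and s: "0 < s" and lc: "0 \<le> lc"
  shows "(\<integral>\<^sup>+ x. ennreal (1 - eta lc Rc alpha s x) \<partial>lborel) = ennreal (\<integral> x. 1 - eta lc Rc alpha s x \<partial>lborel)"
proof (rule nn_integral_eq_integral)
  have [measurable]: "eta lc Rc alpha s \<in> borel_measurable borel" using s lc by measurable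
  let ?f = "\<lambda>z::real^2. ennreal (1 / (1 + (1 / s) * norm z powr alpha))"
  have "(\<integral>\<^sup>+ x. ennreal (1 - eta lc Rc alpha s x) \<partial>lborel) \<le> (\<integral>\<^sup>+ x. ennreal lc * disk_loss Rc alpha s x \<partial>lborel)"
    using eta_eq_lexp[OF s lc] by (intro nn_integral_mono) (simp add: one_minus_lexp_le)
  also have "\<dots> = ennreal lc * (\<integral>\<^sup>+ x. disk_loss Rc alpha s x \<partial>lborel)"
    by (rule nn_integral_cmult) measurable
  also have "(\<integral>\<^sup>+ x. disk_loss Rc alpha s x \<partial>lborel)
      = (\<integral>\<^sup>+ y. (\<integral>\<^sup>+ x. indicator (cball 0 Rc) y * ?f (x + y) \<partial>lborel) \<partial>lborel)"
    unfolding disk_loss_def by (rule lborel_pair.Fubini') measurable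
  also have "\<dots> = (\<integral>\<^sup>+ (y::real^2). indicator (cball 0 Rc) y * (\<integral>\<^sup>+ x. ?f x \<partial>lborel) \<partial>lborel)"
  proof (rule nn_integral_cong)
    fix y :: "real^2"
    have "(\<integral>\<^sup>+ x. ?f (x + y) \<partial>lborel) = (\<integral>\<^sup>+ x. ?f x \<partial>distr lborel borel ((+) y))"
      by (subst nn_integral_distr) (auto simp: add.commute)
    also have "\<dots> = (\<integral>\<^sup>+ x. ?f x \<partial>lborel)" by (simp add: lborel_distr_plus)
    finally show "(\<integral>\<^sup>+ x. indicator (cball 0 Rc) y * ?f (x + y) \<partial>lborel) = indicator (cball 0 Rc) y * (\<integral>\<^sup>+ x. ?f x \<partial>lborel)"
      by (subst nn_integral_cmult) auto
  qed
  also have "\<dots> = (\<integral>\<^sup>+ x. ?f x \<partial>lborel) * emeasure lborel (cball (0::real^2) Rc)"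
    by (subst nn_integral_multc) (auto simp: mult.commute)
  finally have "(\<integral>\<^sup>+ x. ennreal (1 - eta lc Rc alpha s x) \<partial>lborel)
      \<le> ennreal lc * ((\<integral>\<^sup>+ x. ?f x \<partial>lborel) * emeasure lborel (cball (0::real^2) Rc))" .
  also have "\<dots> < \<infinity>"
    using nn_integral_path_loss_finite[OF alpha s] emeasure_lborel_cball_finite[of "0::real^2" Rc]
    by (simp add: ennreal_mult_less_top)
  finally show "integrable lborel (\<lambda>x. 1 - eta lc Rc alpha s x)"
    using eta_eq_lexp[OF s lc] by (intro integrableI_nonneg) auto
qed (use eta_eq_lexp[OF s lc] in auto)

text \<open>The Neyman-Scott process as one Poisson process of parents, each marked by its whole
  cluster relative to the parent. Independence of the clusters given the parents is contained in the
  product intensity.\<close>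

locale femto_process =
  fixes P :: "((real^2) \<times> ((real^2) \<times> real) set) set measure" and Q :: "((real^2) \<times> real) set measure"
    and lp lc Rc mu alpha W Pf :: real
  assumes ppp_P: "is_ppp P (parent_intensity lp Q) (\<lambda>S. S)"
    and ppp_Q: "is_ppp Q (cluster_intensity lc Rc mu) (\<lambda>S. S)"
    and sets_Q: "sets Q = sets (config_space (cluster_intensity lc Rc mu))"
    and sets_P [measurable_cong]: "sets P = sets (config_space (parent_intensity lp Q))"
    and alpha: "2 < alpha" and mu: "0 < mu" and lp: "0 < lp" and lc: "0 \<le> lc" and W: "0 < W" and Pf: "0 < Pf"
begin

lemma space_Q: "space Q = UNIV"
  using sets_eq_imp_space_eq[OF sets_Q] by simp

lemma sets_parent: "sets (parent_intensity lp Q) = sets (borel \<Otimes>\<^sub>M config_space (cluster_intensity lc Rc mu))"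
  unfolding parent_intensity_def by (intro sets_pair_measure_cong) (auto simp: sets_Q)

lemma space_parent: "space (parent_intensity lp Q) = UNIV"
  by (simp add: parent_intensity_def space_pair_measure space_Q)

lemma sigma_finite_parent: "sigma_finite_measure (parent_intensity lp Q)"
  unfolding parent_intensity_def
  by (intro sigma_finite_pair_measure sigma_finite_lborel_const prob_space_imp_sigma_finite is_pppD(1)[OF ppp_Q])

definition femto_gain :: "real^2 \<Rightarrow> (real^2) \<times> real \<Rightarrow> ennreal" where
  "femto_gain x p = ennreal (W * Pf * snd p * norm (x + fst p) powr (- alpha))"

text \<open>The value 0 on infinite clusters makes the gain jointly measurable and finite
  everywhere; clusters are almost surely finite, so the transforms do not change.\<close>

definition cluster_gain :: "(real^2) \<times> ((real^2) \<times> real) set \<Rightarrow> ennreal" where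
  "cluster_gain z = (if finite (snd z) then psum (femto_gain (fst z)) (snd z) else 0)"

lemma measurable_femto_gain: "femto_gain x \<in> borel_measurable (cluster_intensity lc Rc mu)"
  unfolding femto_gain_def by measurable

lemma measurable_cluster_gain: "cluster_gain \<in> borel_measurable (borel \<Otimes>\<^sub>M config_space (cluster_intensity lc Rc mu))"
proof -
  have "(\<lambda>z. femto_gain (fst z) (snd z)) \<in> borel_measurable (borel \<Otimes>\<^sub>M cluster_intensity lc Rc mu)"
    unfolding femto_gain_def by measurable
  from measurable_psum_pair[OF this space_cluster_intensity] show ?thesis
    unfolding fst_conv snd_conv by (simp add: cluster_gain_def[abs_def])
qed

lemma measurable_cluster_gain' [measurable]: "cluster_gain \<in> borel_measurable (parent_intensity lp Q)"
  using measurable_cluster_gain unfolding measurable_cong_sets[OF sets_parent refl] .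

lemma cluster_gain_finite: "cluster_gain z < \<top>"
  by (simp add: cluster_gain_def psum_finite femto_gain_def less_top[symmetric])

lemma AE_finite_cluster: "AE D in Q. finite D"
proof -
  have "AE D in Q. finite (D \<inter> UNIV)"
    using sets.top[of "cluster_intensity lc Rc mu"] emeasure_cluster_intensity_UNIV[OF mu]
    by (intro is_pppD(3)[OF ppp_Q]) auto
  then show ?thesis by simp
qed

text \<open>The fading is averaged at each displaced point; the division by \<open>mu\<close> in
  \<open>t * W * Pf / mu\<close> brings k/(mu+k) into the form 1/(1 + |x+y|^alpha / s).\<close>

lemma nn_integral_femto_gain:
  assumes t: "0 < t"
  shows "(\<integral>\<^sup>+ p. ennreal (1 - lexp (ennreal t * femto_gain x p)) \<partial>cluster_intensity lc Rc mu)
    = ennreal lc * disk_loss Rc alpha (t * W * Pf / mu) x"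
proof -
  define s where "s = t * W * Pf / mu"
  have s: "0 < s" using t W Pf mu by (simp add: s_def)
  have "(\<integral>\<^sup>+ p. ennreal (1 - lexp (ennreal t * femto_gain x p)) \<partial>cluster_intensity lc Rc mu)
     = (\<integral>\<^sup>+ y. ennreal lc * indicator (cball 0 Rc) y * (\<integral>\<^sup>+ g. ennreal (1 - lexp (ennreal t * femto_gain x (y, g))) \<partial>exp_law mu) \<partial>lborel)"
    by (rule nn_integral_cluster_intensity[OF mu]) (simp add: femto_gain_def, measurable)
  also have "\<dots> = (\<integral>\<^sup>+ y. ennreal lc * (indicator (cball 0 Rc) y * ennreal (1 / (1 + (1 / s) * norm (x + y) powr alpha))) \<partial>lborel)"
  proof (rule nn_integral_cong_AE)
    \<comment> \<open>At y = -x the convention \<open>0 powr (- alpha) = 0\<close> makes the gain 0,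
      whereas the target fraction is 1. A single point is null.\<close>
    have "AE y in lborel. y \<noteq> - x" by (rule AE_lborel_singleton)
    then show "AE y in lborel. ennreal lc * indicator (cball 0 Rc) y * (\<integral>\<^sup>+ g. ennreal (1 - lexp (ennreal t * femto_gain x (y, g))) \<partial>exp_law mu)
       = ennreal lc * (indicator (cball 0 Rc) y * ennreal (1 / (1 + (1 / s) * norm (x + y) powr alpha)))"
    proof eventually_elim
      case (elim y)
      define A where "A = norm (x + y) powr alpha"
      have "x + y \<noteq> 0" using elim by (auto simp: eq_neg_iff_add_eq_0 add.commute)
      then have A: "0 < A" by (simp add: A_def)
      define k where "k = 1 * (mu * s) / A"
      have k: "0 \<le> k" using mu s A by (simp add: k_def)
      have "ennreal t * femto_gain x (y, g) = ennreal (k * g)" for g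
        using t mu by (simp add: femto_gain_def k_def s_def A_def powr_minus_divide ac_simps flip: ennreal_mult')
      then have "(\<integral>\<^sup>+ g. ennreal (1 - lexp (ennreal t * femto_gain x (y, g))) \<partial>exp_law mu) = ennreal (k / (mu + k))"
        using nn_integral_exp_law_laplace[OF mu k] by simp
      also have "k / (mu + k) = 1 / (1 + (1 / s) * A)"
        using fading_ratio[OF A zero_less_one mu s] by (simp add: k_def)
      finally show ?case by (simp add: A_def mult.assoc)
    qed
  qed
  also have "\<dots> = ennreal lc * disk_loss Rc alpha s x"
    unfolding disk_loss_def by (rule nn_integral_cmult) measurable
  finally show ?thesis by (simp add: s_def)
qed

text \<open>The Laplace functional of one cluster with parent at x; \<open>1 - eta\<close> then
  becomes the integrand of the exponent for the parents.\<close>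

lemma nn_integral_cluster_laplace:
  assumes t: "0 < t"
  shows "(\<integral>\<^sup>+ D. ennreal (1 - lexp (ennreal t * cluster_gain (x, D))) \<partial>Q)
    = ennreal (1 - eta lc Rc alpha (t * W * Pf / mu) x)"
proof -
  interpret Q: prob_space Q by (rule is_pppD(1)[OF ppp_Q])
  have s: "0 < t * W * Pf / mu" using t W Pf mu by simp
  have m: "(\<lambda>p. ennreal t * femto_gain x p) \<in> borel_measurable (cluster_intensity lc Rc mu)"
    using measurable_femto_gain by measurable
  have [measurable]: "(\<lambda>D. cluster_gain (x, D)) \<in> borel_measurable Q"
    using measurable_cluster_gain unfolding measurable_cong_sets[OF sets_Q refl] by measurable
  have "(\<integral>\<^sup>+ D. ennreal (lexp (ennreal t * cluster_gain (x, D))) \<partial>Q)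
      = (\<integral>\<^sup>+ D. ennreal (lexp (psum (\<lambda>p. ennreal t * femto_gain x p) D)) \<partial>Q)"
    by (rule nn_integral_cong_AE, use AE_finite_cluster in eventually_elim) (simp add: cluster_gain_def psum_cmult)
  also have "\<dots> = ennreal (eta lc Rc alpha (t * W * Pf / mu) x)"
    by (subst ppp_laplace[OF ppp_Q sigma_finite_cluster_intensity[OF mu] space_cluster_intensity m])
      (simp add: nn_integral_femto_gain[OF t] eta_eq_lexp[OF s lc])
  finally have e: "(\<integral>\<^sup>+ D. ennreal (lexp (ennreal t * cluster_gain (x, D))) \<partial>Q)
      = ennreal (eta lc Rc alpha (t * W * Pf / mu) x)" .
  have "ennreal (eta lc Rc alpha (t * W * Pf / mu) x) + (\<integral>\<^sup>+ D. ennreal (1 - lexp (ennreal t * cluster_gain (x, D))) \<partial>Q)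
     = (\<integral>\<^sup>+ D. ennreal (lexp (ennreal t * cluster_gain (x, D))) + ennreal (1 - lexp (ennreal t * cluster_gain (x, D))) \<partial>Q)"
    unfolding e[symmetric] by (rule nn_integral_add[symmetric]) measurable
  also have "\<dots> = (\<integral>\<^sup>+ D. 1 \<partial>Q)"
    by (intro nn_integral_cong) (simp flip: ennreal_plus)
  also have "\<dots> = ennreal 1" using Q.emeasure_space_1 by simp
  also have "\<dots> = ennreal (eta lc Rc alpha (t * W * Pf / mu) x) + ennreal (1 - eta lc Rc alpha (t * W * Pf / mu) x)"
    using eta_eq_lexp[OF s lc] by (simp flip: ennreal_plus)
  finally show ?thesis by (simp only: ennreal_add_left_cancel) simp
qed

definition loss :: "real \<Rightarrow> real" where
  "loss t = (\<integral> x. 1 - eta lc Rc alpha (t * W * Pf / mu) x \<partial>lborel)"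

lemma loss_nonneg:
  assumes "0 < t" shows "0 \<le> loss t"
proof -
  have s: "0 < t * W * Pf / mu" using assms W Pf mu by simp
  show ?thesis unfolding loss_def
    by (rule Bochner_Integration.integral_nonneg) (simp add: eta_eq_lexp[OF s lc])
qed

lemma nn_integral_parent_laplace:
  assumes t: "0 < t"
  shows "(\<integral>\<^sup>+ z. ennreal (1 - lexp (ennreal t * cluster_gain z)) \<partial>parent_intensity lp Q) = ennreal (lp * loss t)"
proof -
  interpret Q: prob_space Q by (rule is_pppD(1)[OF ppp_Q])
  have s: "0 < t * W * Pf / mu" using t W Pf mu by simp
  have [measurable]: "eta lc Rc alpha (t * W * Pf / mu) \<in> borel_measurable borel" using s lc by measurable
  have "(\<lambda>z. ennreal (1 - lexp (ennreal t * cluster_gain z))) \<in> borel_measurable (parent_intensity lp Q)"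
    by measurable
  then have "(\<integral>\<^sup>+ z. ennreal (1 - lexp (ennreal t * cluster_gain z)) \<partial>parent_intensity lp Q)
     = (\<integral>\<^sup>+ x. (\<integral>\<^sup>+ D. ennreal (1 - lexp (ennreal t * cluster_gain (x, D))) \<partial>Q) \<partial>density lborel (\<lambda>_. ennreal lp))"
    unfolding parent_intensity_def by (rule Q.nn_integral_fst[symmetric])
  also have "\<dots> = (\<integral>\<^sup>+ x. ennreal lp * ennreal (1 - eta lc Rc alpha (t * W * Pf / mu) x) \<partial>lborel)"
    unfolding nn_integral_cluster_laplace[OF t] by (rule nn_integral_density) measurable
  also have "\<dots> = ennreal lp * (\<integral>\<^sup>+ x. ennreal (1 - eta lc Rc alpha (t * W * Pf / mu) x) \<partial>lborel)"
    by (rule nn_integral_cmult) measurable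
  finally show ?thesis
    using lp by (simp add: nn_integral_one_minus_eta[OF alpha s lc] loss_def ennreal_mult')
qed

abbreviation "I \<equiv> psum cluster_gain"

lemma measurable_I [measurable]: "I \<in> borel_measurable (config_space (parent_intensity lp Q))"
  by (rule borel_measurable_psum[OF measurable_cluster_gain' space_parent])

lemma nn_integral_femto_laplace:
  assumes t: "0 < t"
  shows "(\<integral>\<^sup>+ R. ennreal (lexp (ennreal t * I R)) \<partial>P) = ennreal (exp (- (lp * loss t)))"
proof -
  have "(\<integral>\<^sup>+ R. ennreal (lexp (psum (\<lambda>z. ennreal t * cluster_gain z) R)) \<partial>P)
      = ennreal (lexp (\<integral>\<^sup>+ z. ennreal (1 - lexp (ennreal t * cluster_gain z)) \<partial>parent_intensity lp Q))"
    by (rule ppp_laplace[OF ppp_P sigma_finite_parent space_parent]) measurable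
  then show ?thesis
    using lp loss_nonneg[OF t] by (simp add: psum_cmult nn_integral_parent_laplace[OF t] lexp_ennreal)
qed

lemma AE_I_finite: "AE R in P. I R < \<top>"
proof (rule ppp_AE_psum_finite[OF ppp_P sigma_finite_parent space_parent])
  show "(\<integral>\<^sup>+ z. ennreal (1 - lexp (cluster_gain z)) \<partial>parent_intensity lp Q) < \<top>"
    using nn_integral_parent_laplace[of 1] by simp
qed (auto simp: cluster_gain_finite)

text \<open>Positive fading is lifted three times: from the cluster intensity to all points of a
  cluster, from clusters to the marks of the parent intensity, from there to all parents. It makes
  the terms of the nested \<open>infsum\<close>s nonnegative.\<close>

lemma AE_interf_f: "AE R in P. interf_f W Pf alpha R = enn2real (I R)"
proof -
  have "AE p in cluster_intensity lc Rc mu. 0 < snd p"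
    unfolding cluster_intensity_def
    by (intro AE_pair_snd AE_exp_law_pos prob_space_imp_sigma_finite prob_space_exp_law mu)
  then have "AE D in Q. \<forall>p\<in>D. 0 < snd p"
    by (rule ppp_AE_ball[OF ppp_Q _ space_cluster_intensity])
  with AE_finite_cluster have "AE D in Q. finite D \<and> (\<forall>p\<in>D. 0 < snd p)"
    by eventually_elim simp
  then have "AE z in parent_intensity lp Q. finite (snd z) \<and> (\<forall>p\<in>snd z. 0 < snd p)"
    unfolding parent_intensity_def
    by (rule AE_pair_snd[OF prob_space_imp_sigma_finite[OF is_pppD(1)[OF ppp_Q]]])
  then have "AE R in P. \<forall>z\<in>R. finite (snd z) \<and> (\<forall>p\<in>snd z. 0 < snd p)"
    by (rule ppp_AE_ball[OF ppp_P _ space_parent])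
  then show ?thesis
  proof eventually_elim
    case (elim R)
    have inner: "infsum (\<lambda>(d, g). W * Pf * g * norm (fst z + d) powr (- alpha)) (snd z) = enn2real (cluster_gain z)"
      if z: "z \<in> R" for z
    proof -
      have "infsum (\<lambda>(d, g). W * Pf * g * norm (fst z + d) powr (- alpha)) (snd z)
          = enn2real (psum (\<lambda>p. ennreal ((\<lambda>(d, g). W * Pf * g * norm (fst z + d) powr (- alpha)) p)) (snd z))"
        using elim z W Pf by (intro infsum_eq_psum) (auto simp: case_prod_beta less_imp_le)
      also have "psum (\<lambda>p. ennreal ((\<lambda>(d, g). W * Pf * g * norm (fst z + d) powr (- alpha)) p)) (snd z) = cluster_gain z"
        using elim z by (auto simp: cluster_gain_def femto_gain_def case_prod_beta intro!: psum_cong)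
      finally show ?thesis .
    qed
    have "interf_f W Pf alpha R = infsum (\<lambda>z. enn2real (cluster_gain z)) R"
      unfolding interf_f_def by (rule infsum_cong) (use inner in \<open>auto simp: case_prod_beta\<close>)
    also have "\<dots> = enn2real (psum (\<lambda>z. ennreal (enn2real (cluster_gain z))) R)"
      by (rule infsum_eq_psum) simp
    also have "psum (\<lambda>z. ennreal (enn2real (cluster_gain z))) R = I R"
      using cluster_gain_finite by (intro psum_cong) simp
    finally show ?case .
  qed
qed

end

section \<open>The SINR\<close>

text \<open>The product rule is given on triples of sets only, so rectangles are extended in two
  passes: with \<open>a\<close> fixed, the restriction to X in \<open>a\<close> is compared with a
  scaled product in the last two coordinates; \<open>pair_measure_eqI\<close> then adds the first
  one.\<close>

lemma distr_triple_indep: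
  assumes "prob_space M" and X [measurable]: "X \<in> M \<rightarrow>\<^sub>M A" and Y [measurable]: "Y \<in> M \<rightarrow>\<^sub>M B"
    and Z [measurable]: "Z \<in> M \<rightarrow>\<^sub>M C"
    and indep: "\<And>a b c. a \<in> sets A \<Longrightarrow> b \<in> sets B \<Longrightarrow> c \<in> sets C \<Longrightarrow>
      measure M {\<omega> \<in> space M. X \<omega> \<in> a \<and> Y \<omega> \<in> b \<and> Z \<omega> \<in> c}
      = measure M {\<omega> \<in> space M. X \<omega> \<in> a} * measure M {\<omega> \<in> space M. Y \<omega> \<in> b} * measure M {\<omega> \<in> space M. Z \<omega> \<in> c}"
  shows "distr M (A \<Otimes>\<^sub>M (B \<Otimes>\<^sub>M C)) (\<lambda>\<omega>. (X \<omega>, (Y \<omega>, Z \<omega>)))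
    = distr M A X \<Otimes>\<^sub>M (distr M B Y \<Otimes>\<^sub>M distr M C Z)"
proof -
  interpret prob_space M by fact
  let ?X = "distr M A X" and ?Y = "distr M B Y" and ?Z = "distr M C Z"
  interpret X: prob_space ?X by (rule prob_space_distr[OF X])
  interpret Y: prob_space ?Y by (rule prob_space_distr[OF Y])
  interpret Z: prob_space ?Z by (rule prob_space_distr[OF Z])
  interpret YZ: prob_space "?Y \<Otimes>\<^sub>M ?Z"
    by (intro prob_space_pair Y.prob_space_axioms Z.prob_space_axioms)
  have main: "distr (density M (indicator (X -` a \<inter> space M))) (B \<Otimes>\<^sub>M C) (\<lambda>\<omega>. (Y \<omega>, Z \<omega>))
      = scale_measure (emeasure ?X a) (?Y \<Otimes>\<^sub>M ?Z)" (is "?L = ?R") if a: "a \<in> sets A" for a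
  proof (rule measure_eqI_generator_eq[where A="\<lambda>_::nat. space B \<times> space C" and \<Omega>="space B \<times> space C"
        and E="{b \<times> c | b c. b \<in> sets B \<and> c \<in> sets C}"])
    show "Int_stable {b \<times> c | b c. b \<in> sets B \<and> c \<in> sets C}"
      by (rule Int_stable_pair_measure_generator)
    show "{b \<times> c | b c. b \<in> sets B \<and> c \<in> sets C} \<subseteq> Pow (space B \<times> space C)"
      by (rule pair_measure_closed)
    show "sets ?L = sigma_sets (space B \<times> space C) {b \<times> c | b c. b \<in> sets B \<and> c \<in> sets C}"
      by (simp add: sets_pair_measure)
    show "sets ?R = sigma_sets (space B \<times> space C) {b \<times> c | b c. b \<in> sets B \<and> c \<in> sets C}"
      by (simp add: sets_pair_measure)
    have aM [measurable]: "X -` a \<inter> space M \<in> sets M" using a by measurable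
    have L: "emeasure ?L V = emeasure M {\<omega> \<in> space M. X \<omega> \<in> a \<and> (Y \<omega>, Z \<omega>) \<in> V}"
      if V: "V \<in> sets (B \<Otimes>\<^sub>M C)" for V
    proof -
      have VM: "(\<lambda>\<omega>. (Y \<omega>, Z \<omega>)) -` V \<inter> space M \<in> sets M" using V by measurable
      have "emeasure ?L V = emeasure (density M (indicator (X -` a \<inter> space M))) ((\<lambda>\<omega>. (Y \<omega>, Z \<omega>)) -` V \<inter> space M)"
        using V by (subst emeasure_distr) auto
      also have "\<dots> = emeasure M ((X -` a \<inter> space M) \<inter> ((\<lambda>\<omega>. (Y \<omega>, Z \<omega>)) -` V \<inter> space M))"
        by (rule emeasure_restricted) (rule aM, rule VM)
      also have "(X -` a \<inter> space M) \<inter> ((\<lambda>\<omega>. (Y \<omega>, Z \<omega>)) -` V \<inter> space M) = {\<omega> \<in> space M. X \<omega> \<in> a \<and> (Y \<omega>, Z \<omega>) \<in> V}"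
        by auto
      finally show ?thesis .
    qed
    show "emeasure ?L (space B \<times> space C) \<noteq> \<infinity>"
      by (subst L) (auto simp: space_pair_measure[symmetric] simp del: space_pair_measure)
    show "range (\<lambda>_::nat. space B \<times> space C) \<subseteq> {b \<times> c | b c. b \<in> sets B \<and> c \<in> sets C}"
      by auto
    fix V assume "V \<in> {b \<times> c | b c. b \<in> sets B \<and> c \<in> sets C}"
    then obtain b c where V: "V = b \<times> c" "b \<in> sets B" "c \<in> sets C" by auto
    have "emeasure ?L V = ennreal (prob {\<omega> \<in> space M. X \<omega> \<in> a \<and> Y \<omega> \<in> b \<and> Z \<omega> \<in> c})"
      using V by (subst L) (auto simp: emeasure_eq_measure)
    also have "\<dots> = emeasure ?X a * (emeasure ?Y b * emeasure ?Z c)"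
      unfolding indep[OF a V(2,3)] using a V
      by (simp add: emeasure_distr emeasure_eq_measure vimage_def Int_def conj_commute ennreal_mult mult.assoc)
    also have "\<dots> = emeasure ?R V"
      using V by (simp add: Z.emeasure_pair_measure_Times)
    finally show "emeasure ?L V = emeasure ?R V" .
  qed auto
  show ?thesis
  proof (rule pair_measure_eqI[symmetric])
    fix a V assume a: "a \<in> sets ?X" and V: "V \<in> sets (?Y \<Otimes>\<^sub>M ?Z)"
    have aM [measurable]: "X -` a \<inter> space M \<in> sets M" using a by measurable
    have V': "V \<in> sets (B \<Otimes>\<^sub>M C)" using V by (simp cong: sets_pair_measure_cong)
    have VM: "(\<lambda>\<omega>. (Y \<omega>, Z \<omega>)) -` V \<inter> space M \<in> sets M" using V' by measurable
    have "emeasure ?X a * emeasure (?Y \<Otimes>\<^sub>M ?Z) V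
        = emeasure (distr (density M (indicator (X -` a \<inter> space M))) (B \<Otimes>\<^sub>M C) (\<lambda>\<omega>. (Y \<omega>, Z \<omega>))) V"
      using main[of a] a by simp
    also have "\<dots> = emeasure M ((X -` a \<inter> space M) \<inter> ((\<lambda>\<omega>. (Y \<omega>, Z \<omega>)) -` V \<inter> space M))"
      using VM V' by (subst emeasure_distr, simp_all, intro emeasure_restricted) (auto simp: aM)
    also have "\<dots> = emeasure (distr M (A \<Otimes>\<^sub>M (B \<Otimes>\<^sub>M C)) (\<lambda>\<omega>. (X \<omega>, (Y \<omega>, Z \<omega>)))) (a \<times> V)"
      using a V' by (subst emeasure_distr) (auto intro!: arg_cong[where f="emeasure M"])
    finally show "emeasure ?X a * emeasure (?Y \<Otimes>\<^sub>M ?Z) V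
        = emeasure (distr M (A \<Otimes>\<^sub>M (B \<Otimes>\<^sub>M C)) (\<lambda>\<omega>. (X \<omega>, (Y \<omega>, Z \<omega>)))) (a \<times> V)" .
  qed (auto intro: prob_space_imp_sigma_finite X.prob_space_axioms YZ.prob_space_axioms cong: sets_pair_measure_cong)
qed

lemma emeasure_exp_law_tail:
  assumes mu: "0 < mu" and c: "0 \<le> c"
  shows "emeasure (exp_law mu) {c<..} = ennreal (exp (- (mu * c)))"
proof -
  interpret prob_space "exp_law mu" by (rule prob_space_exp_law[OF mu])
  have "distributed (exp_law mu) lborel (\<lambda>x. x) (\<lambda>x. ennreal (exponential_density mu x))"
    unfolding distributed_def by (auto simp: exp_law_def distr_id2 intro!: measure_eqI)
  from exponential_distributedD_gt[OF this c mu]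
  show ?thesis by (simp add: emeasure_eq_measure greaterThan_def mult.commute)
qed

section \<open>Joint Laplace transform of the two tiers\<close>

locale two_tier = macro: macro_process Pm_law lm Pb mu Pm alpha + femto: femto_process Pf_law Q lp lc Rc mu alpha W Pf
  for Pm_law lm Pb mu Pm alpha Pf_law Q lp lc Rc W Pf +
  fixes sigma2 :: real
  assumes sigma2: "0 \<le> sigma2"
begin

abbreviation "V \<equiv> macro.hmin"

text \<open>The value \<open>h\<close> must exceed for SINR > T, obtained by solving for
  \<open>h\<close> with r^alpha = v^(alpha/2).\<close>

definition threshold :: "real \<Rightarrow> ((real^2) \<times> bool \<times> real) set \<Rightarrow> ((real^2) \<times> ((real^2) \<times> real) set) set \<Rightarrow> real" where
  "threshold T S R = T * V S powr (alpha / 2) * (enn2real (macro.J S) + enn2real (femto.I R) + sigma2) / Pm"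

text \<open>Multiplied by pi lm, this is the density at squared serving distance v of the event SINR
  > T.\<close>

definition coverage :: "real \<Rightarrow> real \<Rightarrow> real" where
  "coverage T v = exp (- pi * v * lm
              - lp * integral\<^sup>L lborel (\<lambda>x. 1 - eta lc Rc alpha (T * v powr (alpha / 2) * W * Pf / Pm) x)
              - mu * T * v powr (alpha / 2) * sigma2 / Pm
              - pi * v * (lm * Pb) * varphi T alpha)"

lemma nn_integral_femto_exp:
  assumes t: "0 < t"
  shows "(\<integral>\<^sup>+ R. ennreal (exp (- (t * enn2real (femto.I R)))) \<partial>Pf_law) = ennreal (exp (- (lp * femto.loss t)))"
proof -
  have "(\<integral>\<^sup>+ R. ennreal (exp (- (t * enn2real (femto.I R)))) \<partial>Pf_law) = (\<integral>\<^sup>+ R. ennreal (lexp (ennreal t * femto.I R)) \<partial>Pf_law)"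
  proof (rule nn_integral_cong_AE, use femto.AE_I_finite in eventually_elim)
    case (elim R)
    then obtain r where "0 \<le> r" "femto.I R = ennreal r" by (cases "femto.I R") auto
    then show ?case using t by (simp add: lexp_ennreal flip: ennreal_mult')
  qed
  then show ?thesis using femto.nn_integral_femto_laplace[OF t] by simp
qed

lemma femto_exp_measurable:
  assumes [measurable]: "f \<in> borel_measurable N"
  shows "(\<lambda>v. \<integral>\<^sup>+ R. ennreal (exp (- (f v * enn2real (femto.I R)))) \<partial>Pf_law) \<in> borel_measurable N"
proof -
  interpret F: prob_space Pf_law by (rule is_pppD(1)[OF femto.ppp_P])
  show ?thesis by measurable
qed

text \<open>The last factor is an expectation over femto configurations, so measurability in v
  follows from that of a parametric integral. The rate \<open>mu\<close> cancels in the argument of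
  \<open>eta\<close>.\<close>

lemma coverage_eq:
  assumes T: "0 < T" and v: "0 < v"
  shows "ennreal (pi * lm * coverage T v) = ennreal (exponential_density (pi * lm) v
       * exp (- (mu * T / Pm * sigma2 * v powr (alpha / 2))) * exp (- (pi * v * (lm * Pb) * varphi T alpha)))
     * (\<integral>\<^sup>+ R. ennreal (exp (- (mu * T / Pm * v powr (alpha / 2) * enn2real (femto.I R)))) \<partial>Pf_law)"
proof -
  let ?t = "mu * T / Pm * v powr (alpha / 2)"
  have t: "0 < ?t" using macro.mu macro.Pm T v by simp
  have arg: "?t * W * Pf / mu = T * v powr (alpha / 2) * W * Pf / Pm"
    using macro.mu by simp
  have "pi * lm * coverage T v = exponential_density (pi * lm) v
       * exp (- (mu * T / Pm * sigma2 * v powr (alpha / 2))) * exp (- (pi * v * (lm * Pb) * varphi T alpha))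
       * exp (- (lp * femto.loss ?t))"
    using v unfolding coverage_def femto.loss_def arg
    by (simp add: exponential_density_def mult_exp_exp algebra_simps)
  then show ?thesis
    unfolding nn_integral_femto_exp[OF t] by (simp add: ennreal_mult'')
qed

lemma coverage_measurable:
  assumes T: "0 < T"
  shows "(\<lambda>v. indicator {0<..} v *\<^sub>R coverage T v) \<in> borel_measurable borel"
proof -
  let ?g = "\<lambda>v. enn2real (ennreal (exponential_density (pi * lm) v
       * exp (- (mu * T / Pm * sigma2 * v powr (alpha / 2))) * exp (- (pi * v * (lm * Pb) * varphi T alpha)))
     * (\<integral>\<^sup>+ R. ennreal (exp (- (mu * T / Pm * v powr (alpha / 2) * enn2real (femto.I R)))) \<partial>Pf_law))"
  have [measurable]: "(\<lambda>v. \<integral>\<^sup>+ R. ennreal (exp (- (mu * T / Pm * v powr (alpha / 2) * enn2real (femto.I R)))) \<partial>Pf_law)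
      \<in> borel_measurable borel"
    by (rule femto_exp_measurable) measurable
  have "?g \<in> borel_measurable borel" by measurable
  then have "(\<lambda>v. indicator {0<..} v * (?g v / (pi * lm))) \<in> borel_measurable borel" by measurable
  moreover have "indicator {0<..} v *\<^sub>R coverage T v = indicator {0<..} v * (?g v / (pi * lm))" for v
  proof (cases "0 < v")
    case True
    have "?g v = pi * lm * coverage T v"
      unfolding coverage_eq[OF T True, symmetric] using macro.lm by (simp add: coverage_def)
    then show ?thesis using macro.lm by simp
  qed simp
  ultimately show ?thesis by simp
qed

text \<open>Femto interference and noise are frozen in \<kappa>, so the macro tier is integrated for
  fixed \<open>R\<close>; after exchanging back, the femto tier is integrated for fixed v. Each
  transform thus sees the other random quantity as a constant.\<close>

lemma nn_integral_threshold:
  assumes T: "0 < T"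
  shows "(\<integral>\<^sup>+ S. (\<integral>\<^sup>+ R. ennreal (exp (- (mu * threshold T S R))) \<partial>Pf_law) \<partial>Pm_law)
    = (\<integral>\<^sup>+ v. ennreal (pi * lm * coverage T v) * indicator {0<..} v \<partial>lborel)"
proof -
  define b where "b = alpha / 2"
  define m where "m = mu * T / Pm"
  have m: "0 < m" using macro.mu macro.Pm T by (simp add: m_def)
  interpret F: prob_space Pf_law by (rule is_pppD(1)[OF femto.ppp_P])
  interpret S: pair_sigma_finite Pm_law Pf_law ..
  interpret L: pair_sigma_finite lborel Pf_law ..
  define \<kappa> where "\<kappa> R = m * (enn2real (femto.I R) + sigma2)" for R
  have \<kappa>: "0 \<le> \<kappa> R" for R using m sigma2 by (simp add: \<kappa>_def)
  have [measurable]: "\<kappa> \<in> borel_measurable Pf_law" unfolding \<kappa>_def by measurable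
  have "(\<integral>\<^sup>+ S. (\<integral>\<^sup>+ R. ennreal (exp (- (mu * threshold T S R))) \<partial>Pf_law) \<partial>Pm_law)
     = (\<integral>\<^sup>+ S. (\<integral>\<^sup>+ R. ennreal (exp (- (\<kappa> R * V S powr b)) * lexp (ennreal (V S powr b) * (ennreal m * macro.J S))) \<partial>Pf_law) \<partial>Pm_law)"
  proof (rule nn_integral_cong_AE, use macro.AE_J_finite in eventually_elim)
    case (elim S)
    then obtain j where j: "0 \<le> j" "macro.J S = ennreal j" by (cases "macro.J S") auto
    have "lexp (ennreal (V S powr b) * (ennreal m * macro.J S)) = exp (- (V S powr b * (m * j)))"
      using j m by (simp add: lexp_ennreal flip: ennreal_mult')
    moreover have "exp (- (mu * threshold T S R)) = exp (- (\<kappa> R * V S powr b)) * exp (- (V S powr b * (m * j)))" for R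
      unfolding mult_exp_exp threshold_def \<kappa>_def m_def b_def j(2) using j(1) by (simp add: field_simps add_divide_distrib)
    ultimately show ?case by simp
  qed
  also have "\<dots> = (\<integral>\<^sup>+ R. (\<integral>\<^sup>+ S. ennreal (exp (- (\<kappa> R * V S powr b)) * lexp (ennreal (V S powr b) * (ennreal m * macro.J S))) \<partial>Pm_law) \<partial>Pf_law)"
    by (rule S.Fubini'[symmetric]) measurable
  also have "\<dots> = (\<integral>\<^sup>+ R. (\<integral>\<^sup>+ v. ennreal (exponential_density (pi * lm) v * (exp (- (\<kappa> R * v powr b)) *
        exp (- (pi * v * (lm * Pb) * varphi T alpha)))) \<partial>lborel) \<partial>Pf_law)"
    unfolding m_def b_def by (subst macro.nn_integral_macro_laplace[OF T \<kappa>]) (rule refl)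
  also have "\<dots> = (\<integral>\<^sup>+ v. (\<integral>\<^sup>+ R. ennreal (exponential_density (pi * lm) v * (exp (- (\<kappa> R * v powr b)) *
        exp (- (pi * v * (lm * Pb) * varphi T alpha)))) \<partial>Pf_law) \<partial>lborel)"
    by (rule L.Fubini') measurable
  also have "\<dots> = (\<integral>\<^sup>+ v. ennreal (pi * lm * coverage T v) * indicator {0<..} v \<partial>lborel)"
  proof (rule nn_integral_cong_AE)
    \<comment> \<open>At v = 0 the exponential density is positive but the indicator is 0; for
      negative v both sides are 0.\<close>
    have "AE v in lborel. v \<noteq> (0::real)" by (rule AE_lborel_singleton)
    then show "AE v in lborel. (\<integral>\<^sup>+ R. ennreal (exponential_density (pi * lm) v * (exp (- (\<kappa> R * v powr b)) *
        exp (- (pi * v * (lm * Pb) * varphi T alpha)))) \<partial>Pf_law) = ennreal (pi * lm * coverage T v) * indicator {0<..} v"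
    proof eventually_elim
      case (elim v)
      show ?case
      proof (cases "0 < v")
        case True
        let ?c = "exponential_density (pi * lm) v
          * exp (- (mu * T / Pm * sigma2 * v powr (alpha / 2))) * exp (- (pi * v * (lm * Pb) * varphi T alpha))"
        have "0 \<le> ?c" using macro.lm by (simp add: exponential_density_nonneg)
        moreover have "exponential_density (pi * lm) v * (exp (- (\<kappa> R * v powr b)) * exp (- (pi * v * (lm * Pb) * varphi T alpha)))
            = ?c * exp (- (mu * T / Pm * v powr (alpha / 2) * enn2real (femto.I R)))" for R
        proof -
          have "exp (- (\<kappa> R * v powr b)) = exp (- (mu * T / Pm * sigma2 * v powr (alpha / 2)))
              * exp (- (mu * T / Pm * v powr (alpha / 2) * enn2real (femto.I R)))"
            unfolding mult_exp_exp \<kappa>_def m_def b_def by (simp add: algebra_simps add_divide_distrib)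
          then show ?thesis by simp
        qed
        ultimately have "(\<integral>\<^sup>+ R. ennreal (exponential_density (pi * lm) v * (exp (- (\<kappa> R * v powr b)) *
            exp (- (pi * v * (lm * Pb) * varphi T alpha)))) \<partial>Pf_law)
          = (\<integral>\<^sup>+ R. ennreal ?c * ennreal (exp (- (mu * T / Pm * v powr (alpha / 2) * enn2real (femto.I R)))) \<partial>Pf_law)"
          by (simp only: ennreal_mult')
        also have "\<dots> = ennreal (pi * lm * coverage T v)"
          unfolding coverage_eq[OF T True] by (rule nn_integral_cmult) measurable
        finally show ?thesis using True by simp
      qed (use elim in \<open>simp add: exponential_density_def\<close>)
    qed
  qed
  finally show ?thesis .
qed

end

section \<open>Distribution of the SINR and mean rate\<close>

locale sinr_model =
  two_tier "distr M (config_space (macro_intensity lm Pb mu)) Psim" lm Pb mu Pm alpha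
    "distr M (config_space (parent_intensity lp Q)) Psip" Q lp lc Rc W Pf sigma2
  for M :: "'a measure" and Psim lm Pb mu Pm alpha Psip Q lp lc Rc W Pf sigma2 +
  fixes h :: "'a \<Rightarrow> real"
  assumes prob_M: "prob_space M"
    and Psim [measurable]: "Psim \<in> M \<rightarrow>\<^sub>M config_space (macro_intensity lm Pb mu)"
    and Psip [measurable]: "Psip \<in> M \<rightarrow>\<^sub>M config_space (parent_intensity lp Q)"
    and h_law: "distributed M lborel h (\<lambda>x. ennreal (exponential_density mu x))"
    and indep: "\<And>A B C. A \<in> sets (config_space (macro_intensity lm Pb mu)) \<Longrightarrow>
       B \<in> sets (config_space (parent_intensity lp Q)) \<Longrightarrow> C \<in> sets borel \<Longrightarrow>
       measure M {\<omega> \<in> space M. Psim \<omega> \<in> A \<and> Psip \<omega> \<in> B \<and> h \<omega> \<in> C}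
       = measure M {\<omega> \<in> space M. Psim \<omega> \<in> A} * measure M {\<omega> \<in> space M. Psip \<omega> \<in> B}
         * measure M {\<omega> \<in> space M. h \<omega> \<in> C}"
begin

sublocale prob_space M by (rule prob_M)

lemma measurable_h [measurable]: "h \<in> borel_measurable M"
  using distributed_measurable[OF h_law] by simp

lemma distr_h: "distr M borel h = exp_law mu"
proof -
  have "distr M borel h = distr M lborel h" by (rule distr_cong) auto
  then show ?thesis using distributed_distr_eq_density[OF h_law] by (simp add: exp_law_def)
qed

text \<open>A measurable version of the SINR: \<open>hmin\<close> replaces the chosen nearest point
  and \<open>ennreal\<close> sums the real ones. As \<open>V\<close> is a squared distance, the
  exponent is halved.\<close>

definition X :: "'a \<Rightarrow> real" where
  "X \<omega> = Pm * h \<omega> * V (Psim \<omega>) powr (- alpha / 2)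
    / (enn2real (macro.J (Psim \<omega>)) + enn2real (femto.I (Psip \<omega>)) + sigma2)"

lemma measurable_X [measurable]: "X \<in> borel_measurable M"
  unfolding X_def by measurable

text \<open>With positive serving distance and positive denominator no default value interferes, and
  SINR > T is a linear inequality in \<open>h\<close>, that is, a fading tail.\<close>

lemma AE_model:
  "AE \<omega> in M. sinr alpha Pm Pf W sigma2 (Psim \<omega>) (Psip \<omega>) (h \<omega>) = X \<omega> \<and> 0 \<le> X \<omega>
     \<and> (\<forall>T>0. T < X \<omega> \<longleftrightarrow> threshold T (Psim \<omega>) (Psip \<omega>) < h \<omega>)"
proof -
  have "AE \<omega> in M. 0 < h \<omega>"
  proof -
    have "AE x in distr M borel h. 0 < x" unfolding distr_h by (rule AE_exp_law_pos)
    then show ?thesis by (rule AE_distrD[rotated]) measurable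
  qed
  with AE_distrD[OF Psim macro.AE_serving_interf] AE_distrD[OF Psim macro.AE_J_finite]
    AE_distrD[OF Psim macro.AE_J_pos] AE_distrD[OF Psip femto.AE_interf_f]
  show ?thesis
  proof eventually_elim
    case (elim \<omega>)
    let ?V = "V (Psim \<omega>)"
    let ?D = "enn2real (macro.J (Psim \<omega>)) + enn2real (femto.I (Psip \<omega>)) + sigma2"
    have V: "0 < ?V" and norm: "(norm (serving_bs (Psim \<omega>)))\<^sup>2 = ?V" using elim by auto
    \<comment> \<open>Positivity comes from the macro interference alone, so zero noise and empty
      clusters are covered.\<close>
    have D: "0 < ?D"
      using elim sigma2 enn2real_positive_iff[of "macro.J (Psim \<omega>)"] by (simp add: add_pos_nonneg)
    have "norm (serving_bs (Psim \<omega>)) \<noteq> 0" using V norm by auto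
    then have "norm (serving_bs (Psim \<omega>)) powr (- alpha) = ?V powr (- alpha / 2)"
      unfolding norm[symmetric] by (simp add: powr_powr flip: powr_numeral)
    then have "sinr alpha Pm Pf W sigma2 (Psim \<omega>) (Psip \<omega>) (h \<omega>) = X \<omega>"
      unfolding sinr_def X_def using elim by simp
    moreover have "0 \<le> X \<omega>"
      unfolding X_def using elim D macro.Pm by (intro divide_nonneg_pos mult_nonneg_nonneg) auto
    moreover have "T < X \<omega> \<longleftrightarrow> threshold T (Psim \<omega>) (Psip \<omega>) < h \<omega>" if "0 < T" for T
    proof -
      have p: "0 < ?V powr (alpha / 2)" using V by simp
      have "X \<omega> = Pm * h \<omega> / (?V powr (alpha / 2) * ?D)"
        by (simp add: X_def powr_minus_divide)
      then have "T < X \<omega> \<longleftrightarrow> T * (?V powr (alpha / 2) * ?D) < Pm * h \<omega>"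
        using p D by (simp add: pos_less_divide_eq)
      also have "\<dots> \<longleftrightarrow> threshold T (Psim \<omega>) (Psip \<omega>) < h \<omega>"
        unfolding threshold_def using macro.Pm by (simp add: pos_divide_less_eq mult.assoc mult.commute[of Pm])
      finally show ?thesis .
    qed
    ultimately show ?case by blast
  qed
qed

text \<open>The joint law is a product, so \<open>h\<close> can be integrated innermost, for fixed
  configurations, where the exponential tail turns the event into e^(-mu threshold).\<close>

lemma emeasure_X_greater:
  assumes T: "0 < T"
  shows "emeasure M {\<omega> \<in> space M. T < X \<omega>} = (\<integral>\<^sup>+ v. ennreal (pi * lm * coverage T v) * indicator {0<..} v \<partial>lborel)"
proof -
  let ?A = "config_space (macro_intensity lm Pb mu)" and ?B = "config_space (parent_intensity lp Q)"
  let ?PA = "distr M ?A Psim" and ?PB = "distr M ?B Psip"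
  interpret E: prob_space "exp_law mu" by (rule prob_space_exp_law[OF macro.mu])
  interpret PB: prob_space ?PB by (rule prob_space_distr[OF Psip])
  interpret BE: prob_space "?PB \<Otimes>\<^sub>M exp_law mu"
    by (intro prob_space_pair PB.prob_space_axioms E.prob_space_axioms)
  define F :: "_ \<Rightarrow> ennreal" where
    "F z = (if threshold T (fst z) (fst (snd z)) < snd (snd z) then 1 else 0)" for z
  have F [measurable]: "F \<in> borel_measurable (?A \<Otimes>\<^sub>M (?B \<Otimes>\<^sub>M borel))"
    unfolding F_def threshold_def by measurable
  have F' [measurable]: "F \<in> borel_measurable (?PA \<Otimes>\<^sub>M (?PB \<Otimes>\<^sub>M exp_law mu))"
    by measurable
  have "emeasure M {\<omega> \<in> space M. T < X \<omega>} = (\<integral>\<^sup>+ \<omega>. indicator {\<omega> \<in> space M. T < X \<omega>} \<omega> \<partial>M)"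
    by (rule nn_integral_indicator[symmetric]) measurable
  also have "\<dots> = (\<integral>\<^sup>+ \<omega>. F (Psim \<omega>, Psip \<omega>, h \<omega>) \<partial>M)"
    by (rule nn_integral_cong_AE, use AE_model AE_space in eventually_elim) (use T in \<open>auto simp: F_def\<close>)
  also have "\<dots> = (\<integral>\<^sup>+ z. F z \<partial>distr M (?A \<Otimes>\<^sub>M (?B \<Otimes>\<^sub>M borel)) (\<lambda>\<omega>. (Psim \<omega>, Psip \<omega>, h \<omega>)))"
    by (rule nn_integral_distr[symmetric]) measurable
  also have "\<dots> = (\<integral>\<^sup>+ z. F z \<partial>(?PA \<Otimes>\<^sub>M (?PB \<Otimes>\<^sub>M exp_law mu)))"
    by (subst distr_triple_indep[OF prob_M Psim Psip measurable_h indep]) (simp_all add: distr_h)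
  also have "\<dots> = (\<integral>\<^sup>+ S. (\<integral>\<^sup>+ y. F (S, y) \<partial>(?PB \<Otimes>\<^sub>M exp_law mu)) \<partial>?PA)"
    by (rule BE.nn_integral_fst[symmetric]) measurable
  also have "\<dots> = (\<integral>\<^sup>+ S. (\<integral>\<^sup>+ R. (\<integral>\<^sup>+ x. F (S, R, x) \<partial>exp_law mu) \<partial>?PB) \<partial>?PA)"
    by (intro nn_integral_cong E.nn_integral_fst[symmetric]) measurable
  also have "\<dots> = (\<integral>\<^sup>+ S. (\<integral>\<^sup>+ R. ennreal (exp (- (mu * threshold T S R))) \<partial>?PB) \<partial>?PA)"
  proof (intro nn_integral_cong)
    fix S R
    have "0 \<le> threshold T S R"
      unfolding threshold_def using T macro.Pm sigma2
      by (intro divide_nonneg_pos mult_nonneg_nonneg add_nonneg_nonneg) auto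
    moreover have "(\<integral>\<^sup>+ x. F (S, R, x) \<partial>exp_law mu) = (\<integral>\<^sup>+ x. indicator {threshold T S R<..} x \<partial>exp_law mu)"
      by (intro nn_integral_cong) (simp add: F_def indicator_def)
    ultimately show "(\<integral>\<^sup>+ x. F (S, R, x) \<partial>exp_law mu) = ennreal (exp (- (mu * threshold T S R)))"
      using emeasure_exp_law_tail[OF macro.mu] by simp
  qed
  also have "\<dots> = (\<integral>\<^sup>+ v. ennreal (pi * lm * coverage T v) * indicator {0<..} v \<partial>lborel)"
    by (rule nn_integral_threshold[OF T])
  finally show ?thesis .
qed

lemma prob_X_greater:
  assumes T: "0 < T"
  shows "prob {\<omega> \<in> space M. T < X \<omega>} = pi * lm * set_lebesgue_integral lborel {0<..} (coverage T)"
proof -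
  have cov: "0 \<le> coverage T v" for v by (simp add: coverage_def)
  have "prob {\<omega> \<in> space M. T < X \<omega>} = enn2real (\<integral>\<^sup>+ v. ennreal (pi * lm * coverage T v) * indicator {0<..} v \<partial>lborel)"
    unfolding emeasure_X_greater[OF T, symmetric] by (simp add: measure_def)
  also have "(\<integral>\<^sup>+ v. ennreal (pi * lm * coverage T v) * indicator {0<..} v \<partial>lborel)
      = (\<integral>\<^sup>+ v. ennreal (pi * lm * (indicator {0<..} v *\<^sub>R coverage T v)) \<partial>lborel)"
    by (intro nn_integral_cong) (auto split: split_indicator)
  also have "enn2real \<dots> = (\<integral> v. pi * lm * (indicator {0<..} v *\<^sub>R coverage T v) \<partial>lborel)"
    using cov macro.lm coverage_measurable[OF T] by (intro integral_eq_nn_integral[symmetric]) auto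
  finally show ?thesis by (simp add: set_lebesgue_integral_def)
qed

text \<open>Each preimage differs from a preimage under \<open>X\<close> only inside a null set, and
  the completion contains all subsets of null sets.\<close>

lemma sinr_measurable:
  "(\<lambda>\<omega>. sinr alpha Pm Pf W sigma2 (Psim \<omega>) (Psip \<omega>) (h \<omega>)) \<in> borel_measurable (completion M)"
proof (rule measurableI)
  fix B :: "real set" assume B: "B \<in> sets borel"
  show "(\<lambda>\<omega>. sinr alpha Pm Pf W sigma2 (Psim \<omega>) (Psip \<omega>) (h \<omega>)) -` B \<inter> space (completion M) \<in> sets (completion M)"
  proof (rule completion.in_sets_AE)
    show "X -` B \<inter> space M \<in> sets (completion M)"
      using measurable_sets[OF measurable_X B] by simp
    have "AE \<omega> in M. \<omega> \<in> X -` B \<inter> space M \<longleftrightarrow>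
        \<omega> \<in> (\<lambda>\<omega>. sinr alpha Pm Pf W sigma2 (Psim \<omega>) (Psip \<omega>) (h \<omega>)) -` B \<inter> space (completion M)"
      using AE_model by eventually_elim auto
    then show "AE \<omega> in completion M. \<omega> \<in> X -` B \<inter> space M \<longleftrightarrow>
        \<omega> \<in> (\<lambda>\<omega>. sinr alpha Pm Pf W sigma2 (Psim \<omega>) (Psip \<omega>) (h \<omega>)) -` B \<inter> space (completion M)"
      by (rule AE_completion)
  qed auto
qed auto

lemma prob_sinr_le:
  assumes T: "0 < T"
  shows "measure (completion M) {\<omega> \<in> space M. sinr alpha Pm Pf W sigma2 (Psim \<omega>) (Psip \<omega>) (h \<omega>) \<le> T}
    = 1 - pi * lm * set_lebesgue_integral lborel {0<..} (coverage T)"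
proof -
  have "measure (completion M) {\<omega> \<in> space M. sinr alpha Pm Pf W sigma2 (Psim \<omega>) (Psip \<omega>) (h \<omega>) \<le> T}
      = measure (completion M) {\<omega> \<in> space M. X \<omega> \<le> T}"
  proof (rule measure_eq_AE)
    have "AE \<omega> in M. \<omega> \<in> {\<omega> \<in> space M. sinr alpha Pm Pf W sigma2 (Psim \<omega>) (Psip \<omega>) (h \<omega>) \<le> T}
        \<longleftrightarrow> \<omega> \<in> {\<omega> \<in> space M. X \<omega> \<le> T}"
      using AE_model by eventually_elim auto
    then show "AE \<omega> in completion M. \<omega> \<in> {\<omega> \<in> space M. sinr alpha Pm Pf W sigma2 (Psim \<omega>) (Psip \<omega>) (h \<omega>) \<le> T}
        \<longleftrightarrow> \<omega> \<in> {\<omega> \<in> space M. X \<omega> \<le> T}"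
      by (rule AE_completion)
    have "{\<omega> \<in> space (completion M). sinr alpha Pm Pf W sigma2 (Psim \<omega>) (Psip \<omega>) (h \<omega>) \<le> T} \<in> sets (completion M)"
      using sinr_measurable by measurable
    then show "{\<omega> \<in> space M. sinr alpha Pm Pf W sigma2 (Psim \<omega>) (Psip \<omega>) (h \<omega>) \<le> T} \<in> sets (completion M)"
      by simp
    have "{\<omega> \<in> space M. X \<omega> \<le> T} \<in> sets M" by measurable
    then show "{\<omega> \<in> space M. X \<omega> \<le> T} \<in> sets (completion M)" by simp
  qed
  also have "\<dots> = prob {\<omega> \<in> space M. X \<omega> \<le> T}"
    by (rule measure_completion) measurable
  also have "{\<omega> \<in> space M. X \<omega> \<le> T} = space M - {\<omega> \<in> space M. T < X \<omega>}" by auto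
  also have "prob \<dots> = 1 - prob {\<omega> \<in> space M. T < X \<omega>}"
    by (rule prob_compl) measurable
  finally show ?thesis unfolding prob_X_greater[OF T] .
qed

text \<open>Layer cake: ln(1 + X) is the length of the set of t > 0 with e^t - 1 < X. The exchange
  is done with nonnegative integrals and \<open>enn2real\<close> is applied to their common value,
  so the identity does not rest on a proof that the mean is finite.\<close>

lemma expectation_ln_sinr:
  "integral\<^sup>L (completion M) (\<lambda>\<omega>. ln (1 + sinr alpha Pm Pf W sigma2 (Psim \<omega>) (Psip \<omega>) (h \<omega>)))
    = pi * lm * set_lebesgue_integral lborel {0<..} (\<lambda>t. set_lebesgue_integral lborel {0<..} (coverage (exp t - 1)))"
proof -
  interpret LM: pair_sigma_finite lborel M ..
  define p where "p t = (\<integral>\<^sup>+ \<omega>. (if exp t - 1 < X \<omega> then 1 else 0) \<partial>M)" for t :: real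
  have [measurable]: "p \<in> borel_measurable borel" unfolding p_def by measurable
  have p_eq: "p t = ennreal (pi * lm * set_lebesgue_integral lborel {0<..} (coverage (exp t - 1)))" if "0 < t" for t
  proof -
    have "p t = (\<integral>\<^sup>+ \<omega>. indicator {\<omega> \<in> space M. exp t - 1 < X \<omega>} \<omega> \<partial>M)"
      unfolding p_def by (intro nn_integral_cong) (simp add: indicator_def)
    also have "\<dots> = emeasure M {\<omega> \<in> space M. exp t - 1 < X \<omega>}"
      by (rule nn_integral_indicator) measurable
    finally show ?thesis using prob_X_greater[of "exp t - 1"] that by (simp add: emeasure_eq_measure)
  qed
  have "integral\<^sup>L (completion M) (\<lambda>\<omega>. ln (1 + sinr alpha Pm Pf W sigma2 (Psim \<omega>) (Psip \<omega>) (h \<omega>)))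
      = integral\<^sup>L (completion M) (\<lambda>\<omega>. ln (1 + X \<omega>))"
  proof (rule integral_cong_AE)
    show "(\<lambda>\<omega>. ln (1 + sinr alpha Pm Pf W sigma2 (Psim \<omega>) (Psip \<omega>) (h \<omega>))) \<in> borel_measurable (completion M)"
      using sinr_measurable by measurable
    show "(\<lambda>\<omega>. ln (1 + X \<omega>)) \<in> borel_measurable (completion M)"
      by (rule measurable_completion) measurable
    show "AE \<omega> in completion M. ln (1 + sinr alpha Pm Pf W sigma2 (Psim \<omega>) (Psip \<omega>) (h \<omega>)) = ln (1 + X \<omega>)"
      by (rule AE_completion, use AE_model in eventually_elim) simp
  qed
  also have "\<dots> = integral\<^sup>L M (\<lambda>\<omega>. ln (1 + X \<omega>))"
    by (rule integral_completion) measurable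
  also have "\<dots> = enn2real (\<integral>\<^sup>+ \<omega>. ennreal (ln (1 + X \<omega>)) \<partial>M)"
    proof (rule integral_eq_nn_integral)
    show "AE \<omega> in M. 0 \<le> ln (1 + X \<omega>)" using AE_model by eventually_elim simp
  qed measurable
  also have "(\<integral>\<^sup>+ \<omega>. ennreal (ln (1 + X \<omega>)) \<partial>M)
      = (\<integral>\<^sup>+ \<omega>. (\<integral>\<^sup>+ t. indicator {0<..} t * (if exp t - 1 < X \<omega> then 1 else 0) \<partial>lborel) \<partial>M)"
  proof (rule nn_integral_cong_AE, use AE_model in eventually_elim)
    case (elim \<omega>)
    have iff: "exp t - 1 < X \<omega> \<longleftrightarrow> t < ln (1 + X \<omega>)" for t
      using elim ln_less_cancel_iff[of "exp t" "1 + X \<omega>"] by (simp add: algebra_simps)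
    have "(\<integral>\<^sup>+ t. indicator {0<..} t * (if exp t - 1 < X \<omega> then 1 else 0) \<partial>lborel)
        = (\<integral>\<^sup>+ t. indicator {0<..<ln (1 + X \<omega>)} t \<partial>lborel)"
      unfolding iff by (intro nn_integral_cong) (simp add: indicator_def)
    also have "\<dots> = ennreal (ln (1 + X \<omega>))" using elim by simp
    finally show ?case by simp
  qed
  also have "\<dots> = (\<integral>\<^sup>+ t. (\<integral>\<^sup>+ \<omega>. indicator {0<..} t * (if exp t - 1 < X \<omega> then 1 else 0) \<partial>M) \<partial>lborel)"
    by (rule LM.Fubini') measurable
  also have "\<dots> = (\<integral>\<^sup>+ t. indicator {0<..} t * p t \<partial>lborel)"
    unfolding p_def by (intro nn_integral_cong nn_integral_cmult) measurable
  also have "\<dots> = (\<integral>\<^sup>+ t. ennreal (indicator {0<..} t * enn2real (p t)) \<partial>lborel)"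
    by (intro nn_integral_cong) (auto simp: p_eq split: split_indicator)
  also have "enn2real \<dots> = (\<integral> t. indicator {0<..} t * enn2real (p t) \<partial>lborel)"
    by (rule integral_eq_nn_integral[symmetric]) auto
  also have "\<dots> = (\<integral> t. pi * lm * (indicator {0<..} t *\<^sub>R set_lebesgue_integral lborel {0<..} (coverage (exp t - 1))) \<partial>lborel)"
  proof (rule Bochner_Integration.integral_cong[OF refl])
    fix t :: real
    \<comment> \<open>The right side is a probability, hence nonnegative, so \<open>enn2real\<close>
      undoes \<open>ennreal\<close> in \<open>p_eq\<close>.\<close>
    have "0 < t \<Longrightarrow> 0 \<le> pi * lm * set_lebesgue_integral lborel {0<..} (coverage (exp t - 1))"
      using prob_X_greater[of "exp t - 1"] by (metis measure_nonneg diff_gt_0_iff_gt one_less_exp_iff)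
    then show "indicator {0<..} t * enn2real (p t)
        = pi * lm * (indicator {0<..} t *\<^sub>R set_lebesgue_integral lborel {0<..} (coverage (exp t - 1)))"
      by (cases "0 < t") (simp_all add: p_eq)
  qed
  finally show ?thesis by (simp add: set_lebesgue_integral_def)
qed

end

theorem theorem3:
  fixes M :: "'a measure"
    and Psim :: "'a \<Rightarrow> ((real^2) \<times> bool \<times> real) set"
    and Psip :: "'a \<Rightarrow> ((real^2) \<times> ((real^2) \<times> real) set) set"
    and h :: "'a \<Rightarrow> real"
    and Q :: "((real^2) \<times> real) set measure"
    and alpha mu Pm Pf W sigma2 lm Pb lp lc Rc T :: real
  assumes "alpha > 2" and "mu > 0" and "Pm > 0" and "Pf > 0"
    and "0 < W" and "W \<le> 1" and "sigma2 \<ge> 0" and "lm > 0"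
    and "0 < Pb" and "Pb \<le> 1" and "lp > 0" and "lc \<ge> 0" and "Rc > 0"
    and "T > 0"
    and M: "prob_space M"
    and macro: "is_ppp M (macro_intensity lm Pb mu) Psim"
    and Q_sets: "sets Q = sets (config_space (cluster_intensity lc Rc mu))"
    and Q_law: "is_ppp Q (cluster_intensity lc Rc mu) (\<lambda>S. S)"
    and parents: "is_ppp M (parent_intensity lp Q) Psip"
    and h_law: "distributed M lborel h (\<lambda>x. ennreal (exponential_density mu x))"
    and indep: "\<And>A B C. A \<in> sets (config_space (macro_intensity lm Pb mu)) \<Longrightarrow>
                 B \<in> sets (config_space (parent_intensity lp Q)) \<Longrightarrow> C \<in> sets borel \<Longrightarrow>
                 measure M {\<omega> \<in> space M. Psim \<omega> \<in> A \<and> Psip \<omega> \<in> B \<and> h \<omega> \<in> C}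
                 = measure M {\<omega> \<in> space M. Psim \<omega> \<in> A} * measure M {\<omega> \<in> space M. Psip \<omega> \<in> B}
                   * measure M {\<omega> \<in> space M. h \<omega> \<in> C}"
  shows
    "(measure (completion M)
       {\<omega> \<in> space M. sinr alpha Pm Pf W sigma2 (Psim \<omega>) (Psip \<omega>) (h \<omega>) \<le> T}
     = 1 - pi * lm * set_lebesgue_integral lborel {0<..} (\<lambda>v.
         exp (- pi * v * lm
              - lp * integral\<^sup>L lborel (\<lambda>x. 1 - eta lc Rc alpha (T * v powr (alpha / 2) * W * Pf / Pm) x)
              - mu * T * v powr (alpha / 2) * sigma2 / Pm
              - pi * v * (lm * Pb) * varphi T alpha)))
    \<and>
    (integral\<^sup>L (completion M)
       (\<lambda>\<omega>. ln (1 + sinr alpha Pm Pf W sigma2 (Psim \<omega>) (Psip \<omega>) (h \<omega>)))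
     = pi * lm * set_lebesgue_integral lborel {0<..} (\<lambda>t.
         set_lebesgue_integral lborel {0<..} (\<lambda>v.
           exp (- pi * v * lm
                - lp * integral\<^sup>L lborel
                         (\<lambda>x. 1 - eta lc Rc alpha ((exp t - 1) * v powr (alpha / 2) * W * Pf / Pm) x)
                - mu * (exp t - 1) * v powr (alpha / 2) * sigma2 / Pm
                - pi * v * (lm * Pb) * varphi (exp t - 1) alpha))))"
proof -
  \<comment> \<open>The tiers enter through the image laws of \<open>Psim\<close> and
    \<open>Psip\<close>, under which the identity is again a Poisson process.\<close>
  have "sinr_model M Psim lm Pb mu Pm alpha Psip Q lp lc Rc W Pf sigma2 h"
  proof (intro sinr_model.intro two_tier.intro two_tier_axioms.intro sinr_model_axioms.intro)
    show "macro_process (distr M (config_space (macro_intensity lm Pb mu)) Psim) lm Pb mu Pm alpha"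
      by (intro macro_process.intro ppp_height_macro[OF macro]) fact+
    show "femto_process (distr M (config_space (parent_intensity lp Q)) Psip) Q lp lc Rc mu alpha W Pf"
      by (intro femto_process.intro is_ppp_distr[OF parents] Q_law Q_sets) (fact | simp)+
    show "Psim \<in> M \<rightarrow>\<^sub>M config_space (macro_intensity lm Pb mu)" by (rule is_pppD(2)[OF macro])
    show "Psip \<in> M \<rightarrow>\<^sub>M config_space (parent_intensity lp Q)" by (rule is_pppD(2)[OF parents])
  qed (fact M h_law indep \<open>sigma2 \<ge> 0\<close>)+
  then interpret sinr_model M Psim lm Pb mu Pm alpha Psip Q lp lc Rc W Pf sigma2 h .
  show ?thesis
    using prob_sinr_le[OF \<open>T > 0\<close>] expectation_ln_sinr unfolding coverage_def[abs_def] by (rule conjI)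
qed

end
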